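(* Let $N\ge 1$ be an integer, $p\ge 2$, $\alpha\in(0,N)$, $h:\mathbb{Z}^N\to\mathbb{R}$ and $f:\mathbb{R}\to\mathbb{R}$, with $F(t)=\int_0^t f(s)\,ds$. Assume: (1) there is a constant $h_0>0$ such that $h(x)\ge h_0$ for all $x\in\mathbb{Z}^N$; (2) there is a positive integer $T$ such that $h$ is $T$-periodic, i.e. $h(x+Te_i)=h(x)$ for all $x\in\mathbb{Z}^N$ and all $i=1,\dots,N$, where $e_1,\dots,e_N$ is the standard basis; (3) $f$ is continuous and $f(t)=o(|t|^{p-1})$ as $t\to 0$; (4) there exist constants $C>0$ and $\tau>\frac{(N+\alpha)p}{2N}$ such that $|f(t)|\le C(1+|t|^{\tau-1})$ for all $t\in\mathbb{R}$; (5) there exists a constant $\theta>p$ such that $0\le\theta F(t)\le 2f(t)t$ for all $t\in\mathbb{R}$; (6) for any $u\in H\setminus\{0\}$, the function $t\mapsto \frac{1}{t^p}\int_{\mathbb{Z}^N}(R_\alpha * F(tu))f(tu)u\,d\mu$ is strictly increasing on $(0,\infty)$. Then the equation $$-\Delta_p u+h(x)|u|^{p-2}u=(R_\alpha * F(u))f(u)\quad\text{on }\mathbb{Z}^N$$ has a ground state solution.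
   Context: $\mathbb{Z}^N$ is the integer lattice graph: $x\sim y$ iff $\sum_{i=1}^N|x_i-y_i|=1$. $\mu$ is the counting measure, so $\int_{\mathbb{Z}^N}g\,d\mu=\sum_{x\in\mathbb{Z}^N}g(x)$. For $u,v:\mathbb{Z}^N\to\mathbb{R}$: $\nabla u\nabla v(x):=\frac12\sum_{y\sim x}(u(y)-u(x))(v(y)-v(x))$, $|\nabla u|(x)=\big(\frac12\sum_{y\sim x}(u(y)-u(x))^2\big)^{1/2}$, and $$\Delta_p u(x)=\frac12\sum_{y\sim x}\big(|\nabla u|^{p-2}(y)+|\nabla u|^{p-2}(x)\big)(u(y)-u(x)).$$ $R_\alpha$ is the Green's function of the discrete fractional Laplacian: $$R_\alpha(x,y)=\frac{K_\alpha}{(2\pi)^N}\int_{[0,2\pi]^N}e^{i(x-y)\cdot k}\,\mu(k)^{-\alpha/2}\,dk,\quad K_\alpha=\frac1{(2\pi)^N}\int_{[0,2\pi]^N}\mu(k)^{\alpha/2}\,dk,\quad \mu(k)=2N-2\sum_{j=1}^N\cos(k_j)$$ (here $\mu(k)$ is a function, not the counting measure), and $(R_\alpha * g)(x)=\sum_{y\in\mathbb{Z}^N}R_\alpha(x,y)g(y)$. $W^{1,p}(\mathbb{Z}^N)$ is the completion of the finitely supported functions with respect to $\|u\|_{W^{1,p}}=\big(\int_{\mathbb{Z}^N}(|\nabla u|^p+|u|^p)\,d\mu\big)^{1/p}$. $H=\{u\in W^{1,p}(\mathbb{Z}^N):\int_{\mathbb{Z}^N}h|u|^p\,d\mu<\infty\}$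 with norm $\|u\|=\big(\int_{\mathbb{Z}^N}(|\nabla u|^p+h|u|^p)\,d\mu\big)^{1/p}$. The energy functional is $J:H\to\mathbb{R}$, $$J(u)=\frac1p\|u\|^p-\frac12\int_{\mathbb{Z}^N}(R_\alpha * F(u))F(u)\,d\mu,$$ which is $C^1$ with $$\langle J'(u),\phi\rangle=\int_{\mathbb{Z}^N}\big(|\nabla u|^{p-2}\nabla u\nabla\phi+h|u|^{p-2}u\phi\big)d\mu-\int_{\mathbb{Z}^N}(R_\alpha * F(u))f(u)\phi\,d\mu,\quad \phi\in H.$$ The Nehari manifold is $\mathcal{M}=\{v\in H\setminus\{0\}:\langle J'(v),v\rangle=0\}$. A ground state solution of the equation is a $u\in H\setminus\{0\}$ with $J'(u)=0$ and $J(u)=\inf_{v\in\mathcal{M}}J(v)$. *)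

theory Defs
  imports
    "HOL-Analysis.Analysis"
    "HOL-Library.Landau_Symbols"
begin

text \<open>
  The lattice \<open>\<int>\<^sup>N\<close> is the type \<open>int ^ 'n\<close> with \<open>N = CARD('n) \<ge> 1\<close>.  Integrals and sums over the
  lattice are Bochner integrals over \<open>count_space UNIV\<close>.
\<close>

definition lattice_adj :: "int ^ 'n \<Rightarrow> int ^ 'n \<Rightarrow> bool" where
  "lattice_adj x y \<longleftrightarrow> (\<Sum>i\<in>UNIV. \<bar>x $ i - y $ i\<bar>) = 1"

definition nbrs :: "int ^ 'n \<Rightarrow> (int ^ 'n) set" where
  "nbrs x = {y. lattice_adj x y}"

lemma finite_nbrs: "finite (nbrs (x :: int ^ 'n))"
proof (rule finite_subset)
  show "nbrs x \<subseteq> vec_lambda ` (PiE UNIV (\<lambda>i. {x $ i - 1..x $ i + 1}))"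
  proof
    fix y assume "y \<in> nbrs x"
    then have s: "(\<Sum>i\<in>UNIV. \<bar>x $ i - y $ i\<bar>) = 1"
      by (simp add: nbrs_def lattice_adj_def)
    have "\<bar>x $ i - y $ i\<bar> \<le> 1" for i
      using member_le_sum[of i UNIV "\<lambda>i. \<bar>x $ i - y $ i\<bar>"] s by simp
    then have "vec_nth y \<in> PiE UNIV (\<lambda>i. {x $ i - 1..x $ i + 1})"
      by (auto simp: abs_le_iff algebra_simps)
    then show "y \<in> vec_lambda ` (PiE UNIV (\<lambda>i. {x $ i - 1..x $ i + 1}))"
      by (metis image_eqI vec_nth_inverse)
  qed
qed (intro finite_imageI finite_PiE; simp)

text \<open>
  Since \<open>0 powr 0 = 0\<close> in HOL, \<open>rpow\<close> restores the convention \<open>0\<^sup>0 = 1\<close>; it is used for the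
  exponent \<open>p - 2\<close>, which vanishes for \<open>p = 2\<close>.
\<close>

definition rpow :: "real \<Rightarrow> real \<Rightarrow> real" where
  "rpow a s = (if s = 0 then 1 else a powr s)"

definition grad_prod :: "(int ^ 'n \<Rightarrow> real) \<Rightarrow> (int ^ 'n \<Rightarrow> real) \<Rightarrow> int ^ 'n \<Rightarrow> real" where
  "grad_prod u v x = 1 / 2 * (\<Sum>y\<in>nbrs x. (u y - u x) * (v y - v x))"

definition grad_norm :: "(int ^ 'n \<Rightarrow> real) \<Rightarrow> int ^ 'n \<Rightarrow> real" where
  "grad_norm u x = sqrt (1 / 2 * (\<Sum>y\<in>nbrs x. (u y - u x)\<^sup>2))"

definition p_laplacian :: "real \<Rightarrow> (int ^ 'n \<Rightarrow> real) \<Rightarrow> int ^ 'n \<Rightarrow> real" where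
  "p_laplacian p u x =
     1 / 2 * (\<Sum>y\<in>nbrs x. (rpow (grad_norm u y) (p - 2) + rpow (grad_norm u x) (p - 2)) * (u y - u x))"

definition symb :: "real ^ 'n \<Rightarrow> real" where
  "symb k = 2 * real CARD('n) - 2 * (\<Sum>j\<in>UNIV. cos (k $ j))"

definition torus_box :: "(real ^ 'n) set" where
  "torus_box = cbox 0 (\<chi> j. 2 * pi)"

text \<open>The dimension enters \<open>K_const\<close> only through the type \<open>'n\<close>, hence the \<open>itself\<close> argument.\<close>

definition K_const :: "'n::finite itself \<Rightarrow> real \<Rightarrow> real" where
  "K_const _ \<alpha> =
     1 / (2 * pi) ^ CARD('n) * (LINT k : (torus_box :: (real ^ 'n) set) | lborel. symb k powr (\<alpha> / 2))"

text \<open>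
  The complex integral below is real, as \<open>k \<mapsto> (2\<pi>, \<dots>, 2\<pi>) - k\<close> conjugates the integrand; \<open>Re\<close> only
  changes the type.
\<close>

definition green :: "real \<Rightarrow> int ^ 'n \<Rightarrow> int ^ 'n \<Rightarrow> real" where
  "green \<alpha> x y =
     Re (complex_of_real (K_const TYPE('n) \<alpha> / (2 * pi) ^ CARD('n)) *
         (LINT k : (torus_box :: (real ^ 'n) set) | lborel.
            exp (\<i> * complex_of_real (\<Sum>j\<in>UNIV. real_of_int (x $ j - y $ j) * k $ j)) *
            complex_of_real (symb k powr (- \<alpha> / 2))))"

definition green_conv :: "real \<Rightarrow> (int ^ 'n \<Rightarrow> real) \<Rightarrow> int ^ 'n \<Rightarrow> real" where
  "green_conv \<alpha> g x = (\<integral>y. green \<alpha> x y * g y \<partial>count_space UNIV)"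

definition primitive :: "(real \<Rightarrow> real) \<Rightarrow> real \<Rightarrow> real" where
  "primitive f t = (LBINT s = ereal 0..ereal t. f s)"

definition W1p_norm :: "real \<Rightarrow> (int ^ 'n \<Rightarrow> real) \<Rightarrow> real" where
  "W1p_norm p u = (\<integral>x. (grad_norm u x powr p + \<bar>u x\<bar> powr p) \<partial>count_space UNIV) powr (1 / p)"

text \<open>
  The completion of the finitely supported functions, realised as the set of all functions that are
  limits of finitely supported ones in the \<open>W\<^sup>1\<^sup>,\<^sup>p\<close> norm.  The integrability clause says that the
  distance \<open>W1p_norm p (u - s n)\<close> is finite.
\<close>

definition W1p :: "real \<Rightarrow> (int ^ 'n \<Rightarrow> real) set" where
  "W1p p = {u. \<exists>s :: nat \<Rightarrow> int ^ 'n \<Rightarrow> real.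
      (\<forall>n. finite {x. s n x \<noteq> 0}) \<and>
      (\<forall>n. integrable (count_space UNIV)
             (\<lambda>x. grad_norm (\<lambda>z. u z - s n z) x powr p + \<bar>u x - s n x\<bar> powr p)) \<and>
      (\<lambda>n. W1p_norm p (\<lambda>z. u z - s n z)) \<longlonglongrightarrow> 0}"

definition H_space :: "real \<Rightarrow> (int ^ 'n \<Rightarrow> real) \<Rightarrow> (int ^ 'n \<Rightarrow> real) set" where
  "H_space p h = {u \<in> W1p p. integrable (count_space UNIV) (\<lambda>x. h x * \<bar>u x\<bar> powr p)}"

definition H_norm :: "real \<Rightarrow> (int ^ 'n \<Rightarrow> real) \<Rightarrow> (int ^ 'n \<Rightarrow> real) \<Rightarrow> real" where
  "H_norm p h u = (\<integral>x. (grad_norm u x powr p + h x * \<bar>u x\<bar> powr p) \<partial>count_space UNIV) powr (1 / p)"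

definition energy ::
  "real \<Rightarrow> real \<Rightarrow> (int ^ 'n \<Rightarrow> real) \<Rightarrow> (real \<Rightarrow> real) \<Rightarrow> (int ^ 'n \<Rightarrow> real) \<Rightarrow> real" where
  "energy p \<alpha> h f u =
     1 / p * H_norm p h u powr p -
     1 / 2 * (\<integral>x. green_conv \<alpha> (\<lambda>y. primitive f (u y)) x * primitive f (u x) \<partial>count_space UNIV)"

text \<open>\<open>energy_deriv p \<alpha> h f u \<phi>\<close> is the pairing of \<open>J'(u)\<close> with \<open>\<phi>\<close>, for \<open>J = energy p \<alpha> h f\<close>.\<close>

definition energy_deriv ::
  "real \<Rightarrow> real \<Rightarrow> (int ^ 'n \<Rightarrow> real) \<Rightarrow> (real \<Rightarrow> real) \<Rightarrow>
   (int ^ 'n \<Rightarrow> real) \<Rightarrow> (int ^ 'n \<Rightarrow> real) \<Rightarrow> real" where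
  "energy_deriv p \<alpha> h f u \<phi> =
     (\<integral>x. (rpow (grad_norm u x) (p - 2) * grad_prod u \<phi> x
            + h x * rpow \<bar>u x\<bar> (p - 2) * u x * \<phi> x) \<partial>count_space UNIV) -
     (\<integral>x. green_conv \<alpha> (\<lambda>y. primitive f (u y)) x * f (u x) * \<phi> x \<partial>count_space UNIV)"

definition nehari ::
  "real \<Rightarrow> real \<Rightarrow> (int ^ 'n \<Rightarrow> real) \<Rightarrow> (real \<Rightarrow> real) \<Rightarrow> (int ^ 'n \<Rightarrow> real) set" where
  "nehari p \<alpha> h f = {v \<in> H_space p h - {\<lambda>_. 0}. energy_deriv p \<alpha> h f v v = 0}"

text \<open>
  The infimum is taken in the extended reals, where it is meaningful without a priori
  boundedness of the energy from below.
\<close>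

definition ground_state ::
  "real \<Rightarrow> real \<Rightarrow> (int ^ 'n \<Rightarrow> real) \<Rightarrow> (real \<Rightarrow> real) \<Rightarrow> (int ^ 'n \<Rightarrow> real) \<Rightarrow> bool" where
  "ground_state p \<alpha> h f u \<longleftrightarrow>
     u \<in> H_space p h - {\<lambda>_. 0} \<and>
     (\<forall>\<phi>\<in>H_space p h. energy_deriv p \<alpha> h f u \<phi> = 0) \<and>
     ereal (energy p \<alpha> h f u) = (INF v\<in>nehari p \<alpha> h f. ereal (energy p \<alpha> h f v))"

definition solves_eq ::
  "real \<Rightarrow> real \<Rightarrow> (int ^ 'n \<Rightarrow> real) \<Rightarrow> (real \<Rightarrow> real) \<Rightarrow> (int ^ 'n \<Rightarrow> real) \<Rightarrow> bool" where
  "solves_eq p \<alpha> h f u \<longleftrightarrow>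
     (\<forall>x. - p_laplacian p u x + h x * rpow \<bar>u x\<bar> (p - 2) * u x =
          green_conv \<alpha> (\<lambda>y. primitive f (u y)) x * f (u x))"

end

(*
  Since h is periodic, it is bounded, so H is the space l^p.  There F(u) is summable, because f(t) = o(|t|^(p-1)),
  and the Green's function is bounded and vanishes at infinity (Riemann-Lebesgue); the
  convolution term is thus a bounded bilinear form on l^1 and no Hardy-Littlewood-Sobolev inequality
  is needed.

  Along a ray, hypothesis (6) makes J increase up to a unique point of the Nehari manifold and
  decrease afterwards, and it makes J coercive on the manifold.  A minimizing sequence, translated by periods
  so that it does not vanish, converges pointwise to some u \<noteq> 0.  By a Brezis-Lieb splitting
  the energy separates into the parts carried by u and by the remainder, and a comparison of the two
  rays shows that the rescaled u attains the infimum.  Comparing u with nearby points of the manifold on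
  perturbed rays shows that the minimizer is a critical point, although the manifold need not
  be smooth; testing with point masses gives the equation.
*)
theory Submission
  imports Defs
begin

section \<open>Summable functions on a countable set\<close>

text \<open>Since \<open>f\<close> is merely continuous, a minimizing sequence on the Nehari
  manifold is not known to be a Palais--Smale sequence, so its pointwise limit cannot be shown
  directly to be critical, or even to lie on the manifold. The existence part therefore compares
  energy values only. Every point of the manifold maximizes \<open>J\<close> on its ray; hence
  multiplying the n-th member of the minimizing sequence by any nonnegative factor, which may depend
  on n, keeps its energy below the level plus o(1). This freedom allows the splitting to be
  evaluated at the scale that suits the limit or the remainder.

  Hypothesis (6) divides by t^p, whereas the local part of the derivative along a ray has order
  t^(p-1). The spare power of t is the source of the coercivity constant
  \<open>1 / p - 1 / (p + 1)\<close>. Moreover the quotient tends to 0 as t decreases to 0, so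
  monotonicity makes it positive and no sign of the Green's function enters.

  Bounded sequences in l^p may lose mass at infinity, so the remainder is null pointwise only. Its
  interaction with the limit through the kernel is controlled by the decay of the Green's function,
  without any rate.\<close>

abbreviation (input) l1 :: "('a \<Rightarrow> real) \<Rightarrow> bool" where
  "l1 g \<equiv> integrable (count_space UNIV) g"

abbreviation (input) lsum :: "('a \<Rightarrow> real) \<Rightarrow> real" where
  "lsum g \<equiv> integral\<^sup>L (count_space UNIV) g"

definition lp :: "real \<Rightarrow> ('a \<Rightarrow> real) \<Rightarrow> bool" where
  "lp p u \<longleftrightarrow> l1 (\<lambda>x. \<bar>u x\<bar> powr p)"

lemmas l1_add = Bochner_Integration.integrable_add [where M = "count_space UNIV"]
  and l1_diff = Bochner_Integration.integrable_diff [where M = "count_space UNIV"]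
  and lsum_add = Bochner_Integration.integral_add [where M = "count_space UNIV"]
  and lsum_diff = Bochner_Integration.integral_diff [where M = "count_space UNIV"]

lemma l1_bound:
  assumes "l1 w" "\<And>x. \<bar>g x\<bar> \<le> w x"
  shows "l1 g"
proof (rule Bochner_Integration.integrable_bound[OF assms(1)])
  show "AE x in count_space UNIV. norm (g x) \<le> norm (w x)"
    using assms(2) by (auto simp: AE_count_space intro: order_trans[OF _ abs_ge_self])
qed simp

lemma lsum_mono:
  assumes "l1 f" "l1 g" "\<And>x. f x \<le> g x"
  shows "lsum f \<le> lsum g" using assms by (intro integral_mono) auto

lemma lsum_mono_bound:
  assumes "l1 g" "\<And>x. 0 \<le> f x" "\<And>x. f x \<le> g x"
  shows "lsum f \<le> lsum g"
proof -
  have "l1 f" by (rule l1_bound[OF assms(1)]) (use assms in auto)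
  then show ?thesis using assms by (intro lsum_mono) auto
qed

lemma lsum_abs_le:
  assumes "l1 k" "\<And>x. \<bar>g x\<bar> \<le> c * k x"
  shows "lsum (\<lambda>x. \<bar>g x\<bar>) \<le> c * lsum k"
  using lsum_mono_bound[OF integrable_mult_right[OF assms(1)] abs_ge_zero assms(2)] by simp

lemma lsum_dominated_convergence:
  assumes "l1 w" "\<And>n x. \<bar>g n x\<bar> \<le> w x" "\<And>x. (\<lambda>n. g n x) \<longlonglongrightarrow> g' x"
  shows "(\<lambda>n. lsum (g n)) \<longlonglongrightarrow> lsum g'"
  by (rule integral_dominated_convergence[where w = w]) (use assms in \<open>auto simp: AE_count_space\<close>)

lemma l1_finite_support:
  assumes "finite A" "\<And>x. x \<notin> A \<Longrightarrow> g x = 0"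
  shows "l1 g" "lsum g = sum g A"
proof -
  have e: "g = (\<lambda>x. \<Sum>a\<in>A. g a * indicator {a} x)"
  proof
    fix x show "g x = (\<Sum>a\<in>A. g a * indicator {a} x)"
      using assms by (cases "x \<in> A") (auto simp: indicator_def if_distrib cong: if_cong)
  qed
  have i: "l1 (\<lambda>x. g a * indicator {a} x)" for a
    by (intro integrable_mult_right integrable_real_indicator) (auto simp: emeasure_count_space)
  show "l1 g" by (subst e) (intro Bochner_Integration.integrable_sum i)
  have "lsum g = (\<Sum>a\<in>A. lsum (\<lambda>x. g a * indicator {a} x))" by (subst e) (intro Bochner_Integration.integral_sum i)
  also have "\<dots> = sum g A" by (intro sum.cong refl) (simp add: measure_count_space)
  finally show "lsum g = sum g A" .
qed

lemma sum_le_lsum: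
  assumes "l1 g" "\<And>x. 0 \<le> g x" "finite A"
  shows "sum g A \<le> lsum g"
proof -
  have "sum g A = lsum (\<lambda>x. if x \<in> A then g x else 0)" by (subst l1_finite_support(2)[OF assms(3)]) auto
  also have "\<dots> \<le> lsum g" by (rule lsum_mono_bound[OF assms(1)]) (use assms in auto)
  finally show ?thesis .
qed

lemma point_le_lsum:
  assumes "l1 g" "\<And>x. 0 \<le> g x"
  shows "g x \<le> lsum g" using sum_le_lsum[OF assms, of "{x}"] by simp

text \<open>Fatou's lemma for the counting measure; it returns the pointwise limit of a bounded
  sequence to l^p.\<close>

lemma l1_Fatou:
  fixes g :: "nat \<Rightarrow> 'a \<Rightarrow> real"
  assumes "\<And>n. l1 (g n)" "\<And>n x. 0 \<le> g n x" "\<And>n. lsum (g n) \<le> M" "\<And>x. (\<lambda>n. g n x) \<longlonglongrightarrow> g' x"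
  shows "l1 g'"
proof (rule integrableI_bounded)
  have n: "(\<integral>\<^sup>+ x. ennreal (g n x) \<partial>count_space UNIV) \<le> ennreal M" for n
    using assms by (subst nn_integral_eq_integral) (auto intro!: ennreal_leI)
  have p: "0 \<le> g' x" for x by (rule LIMSEQ_le_const[OF assms(4)]) (use assms(2) in auto)
  have "(\<integral>\<^sup>+ x. ennreal (norm (g' x)) \<partial>count_space UNIV) = (\<integral>\<^sup>+ x. liminf (\<lambda>n. ennreal (g n x)) \<partial>count_space UNIV)"
    using p by (intro nn_integral_cong) (auto intro!: lim_imp_Liminf[symmetric] tendsto_ennrealI assms(4))
  also have "\<dots> \<le> liminf (\<lambda>n. \<integral>\<^sup>+ x. ennreal (g n x) \<partial>count_space UNIV)" by (rule nn_integral_liminf) auto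
  also have "\<dots> \<le> liminf (\<lambda>n::nat. ennreal M)" by (intro Liminf_mono) (use n in auto)
  also have "\<dots> = ennreal M" by (simp add: Liminf_const)
  also have "\<dots> < \<infinity>" by simp
  finally show "(\<integral>\<^sup>+ x. ennreal (norm (g' x)) \<partial>count_space UNIV) < \<infinity>" .
qed simp

section \<open>Elementary inequalities for powers and the space l^p\<close>

lemma powr_add_le:
  fixes a b :: real
  assumes "0 \<le> a" "0 \<le> b" "0 \<le> p"
  shows "(a + b) powr p \<le> 2 powr p * (a powr p + b powr p)"
proof -
  have "(a + b) powr p \<le> (2 * max a b) powr p" using assms by (intro powr_mono2) auto
  also have "\<dots> = 2 powr p * max a b powr p" using assms by (simp add: powr_mult)
  also have "max a b powr p \<le> a powr p + b powr p" by (simp add: max_def)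
  finally show ?thesis by (simp add: mult_left_mono)
qed

lemma powr_minus_one_mult:
  fixes a :: real assumes "0 \<le> a" shows "a powr (p - 1) * a = a powr p"
  using assms by (cases "a = 0") (auto simp: powr_mult_base[symmetric] powr_diff)

text \<open>A crude Young inequality: both factors are replaced by the larger of \<open>a\<close>
  and \<open>b\<close>. It takes the place of Hoelder's inequality where only the summability of a
  mixed term is at stake.\<close>

lemma powr_mult_le:
  fixes a b :: real
  assumes "0 \<le> a" "0 \<le> b" "1 \<le> p"
  shows "a powr (p - 1) * b \<le> a powr p + b powr p"
proof -
  have "a powr (p - 1) * b \<le> max a b powr (p - 1) * max a b" using assms by (intro mult_mono powr_mono2) auto
  also have "\<dots> = max a b powr p" using assms by (intro powr_minus_one_mult) auto
  also have "\<dots> \<le> a powr p + b powr p" by (simp add: max_def)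
  finally show ?thesis .
qed

lemma lsum_powr_add_le:
  assumes "l1 (\<lambda>x. a x powr p)" "l1 (\<lambda>x. b x powr p)" "\<And>x. 0 \<le> a x" "\<And>x. 0 \<le> b x"
    "\<And>x. 0 \<le> c x" "\<And>x. c x \<le> a x + b x" "0 \<le> p"
  shows "lsum (\<lambda>x. c x powr p) \<le> 2 powr p * (lsum (\<lambda>x. a x powr p) + lsum (\<lambda>x. b x powr p))"
proof -
  have "c x powr p \<le> 2 powr p * (a x powr p + b x powr p)" for x
    by (rule order_trans[OF powr_mono2 powr_add_le]) (use assms in simp_all)
  from lsum_mono_bound[OF integrable_mult_right[OF l1_add[OF assms(1,2)]] powr_ge_zero this]
  show ?thesis by (simp only: integral_mult_right_zero lsum_add[OF assms(1,2)])
qed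

lemma lp_D: "lp p u \<Longrightarrow> l1 (\<lambda>x. \<bar>u x\<bar> powr p)"
  by (simp add: lp_def)

lemma lp_bound:
  assumes "lp p v" "\<And>x. \<bar>u x\<bar> \<le> \<bar>v x\<bar>" "0 \<le> p"
  shows "lp p u" unfolding lp_def by (rule l1_bound[OF lp_D[OF assms(1)]]) (use assms in \<open>auto intro!: powr_mono2\<close>)

lemma lp_abs: "lp p (\<lambda>x. \<bar>u x\<bar>) \<longleftrightarrow> lp p u"
  by (simp add: lp_def)

lemma lp_add:
  assumes "lp p u" "lp p v" "0 \<le> p"
  shows "lp p (\<lambda>x. u x + v x)" unfolding lp_def
proof (rule l1_bound)
  show "l1 (\<lambda>x. 2 powr p * (\<bar>u x\<bar> powr p + \<bar>v x\<bar> powr p))"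
    using assms by (intro integrable_mult_right l1_add) (auto simp: lp_def)
  show "\<bar>\<bar>u x + v x\<bar> powr p\<bar> \<le> 2 powr p * (\<bar>u x\<bar> powr p + \<bar>v x\<bar> powr p)" for x
    using powr_add_le[of "\<bar>u x\<bar>" "\<bar>v x\<bar>" p] abs_triangle_ineq[of "u x" "v x"]
      powr_mono2[of p "\<bar>u x + v x\<bar>" "\<bar>u x\<bar> + \<bar>v x\<bar>"] assms(3) by fastforce
qed

lemma lp_scale: "lp p u \<Longrightarrow> lp p (\<lambda>x. c * u x)"
  by (simp add: lp_def abs_mult powr_mult)

lemma lp_uminus: "lp p u \<Longrightarrow> lp p (\<lambda>x. - u x)"
  by (simp add: lp_def)

lemma lp_diff: "lp p u \<Longrightarrow> lp p v \<Longrightarrow> 0 \<le> p \<Longrightarrow> lp p (\<lambda>x. u x - v x)"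
  using lp_add[of p u "\<lambda>x. - v x"] lp_uminus by auto

lemma lp_sum:
  assumes "finite A" "\<And>a. a \<in> A \<Longrightarrow> lp p (u a)" "0 \<le> p"
  shows "lp p (\<lambda>x. \<Sum>a\<in>A. u a x)" using assms(1,2)
proof (induction A rule: finite_induct)
  case empty then show ?case by (simp add: lp_def)
next
  case (insert a A)
  then show ?case using assms(3) by (simp add: lp_add)
qed

lemma lp_finite_support:
  assumes "finite {x. u x \<noteq> 0}"
  shows "lp p u" unfolding lp_def by (rule l1_finite_support(1)[OF assms]) auto

lemma lp_powr_mult:
  assumes "lp p u" "lp p v" "1 \<le> p"
  shows "l1 (\<lambda>x. \<bar>u x\<bar> powr (p - 1) * \<bar>v x\<bar>)"
proof (rule l1_bound)
  show "l1 (\<lambda>x. \<bar>u x\<bar> powr p + \<bar>v x\<bar> powr p)" using assms by (intro l1_add) (auto simp: lp_def)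
  show "\<bar>\<bar>u x\<bar> powr (p - 1) * \<bar>v x\<bar>\<bar> \<le> \<bar>u x\<bar> powr p + \<bar>v x\<bar> powr p" for x
    using powr_mult_le[of "\<bar>u x\<bar>" "\<bar>v x\<bar>" p] assms by simp
qed

text \<open>The embedding of l^p into the bounded functions, special to a discrete space: each
  summand is at most the sum. It lets growth conditions on bounded sets of arguments act
  globally.\<close>

lemma lp_le_norm:
  assumes "lp p u" "lsum (\<lambda>x. \<bar>u x\<bar> powr p) \<le> M" "0 < p"
  shows "\<bar>u x\<bar> \<le> M powr (1 / p)"
proof -
  have "\<bar>u x\<bar> powr p \<le> M" using point_le_lsum[OF lp_D[OF assms(1)], of x] assms(2) by simp
  then have "(\<bar>u x\<bar> powr p) powr (1 / p) \<le> M powr (1 / p)" using assms by (intro powr_mono2) auto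
  then show ?thesis using assms by (simp add: powr_powr)
qed

lemma lp_bounded:
  assumes "lp p u" "0 < p"
  obtains M where "0 < M" "\<And>x. \<bar>u x\<bar> \<le> M"
proof -
  let ?M = "lsum (\<lambda>x. \<bar>u x\<bar> powr p) powr (1 / p) + 1"
  have "\<bar>u x\<bar> \<le> ?M" for x using lp_le_norm[OF assms(1) order_refl assms(2), of x] by simp
  moreover have "0 < ?M" by (simp add: add_nonneg_pos)
  ultimately show ?thesis using that by blast
qed

section \<open>Vanishing of the Brezis--Lieb errors\<close>

abbreviation (input) err :: "real \<Rightarrow> real \<Rightarrow> real \<Rightarrow> real" where
  "err p a b \<equiv> min a b * (a + b) powr (p - 1)"

text \<open>
  The Brezis--Lieb splitting errors below are all dominated by
  \<open>err p a b\<close>: the part of the sum where \<open>b \<le> \<delta> * a\<close> is at most a small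
  multiple of \<open>a powr p\<close>, and on the rest the summand is dominated by a multiple of \<open>b powr p\<close>.
\<close>

lemma brezis_lieb_error:
  fixes a :: "nat \<Rightarrow> 'a \<Rightarrow> real"
  assumes p: "1 \<le> p" and b: "l1 (\<lambda>x. b x powr p)" and b0: "\<And>x. 0 \<le> b x"
    and a0: "\<And>n x. 0 \<le> a n x" and a1: "\<And>n. l1 (\<lambda>x. a n x powr p)"
    and aM: "\<And>n. lsum (\<lambda>x. a n x powr p) \<le> M"
    and lim: "\<And>x. (\<lambda>n. a n x) \<longlonglongrightarrow> 0"
  shows "(\<lambda>n. lsum (\<lambda>x. err p (a n x) (b x))) \<longlonglongrightarrow> 0"
proof -
  define q where "q n x = err p (a n x) (b x)" for n x
  have q0: "0 \<le> q n x" for n x using a0 b0 by (simp add: q_def)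
  have M0: "0 \<le> M" by (rule order_trans[OF Bochner_Integration.integral_nonneg aM[of 0]]) simp
  have qlim: "(\<lambda>n. q n x) \<longlonglongrightarrow> 0" for x
  proof (rule tendsto_sandwich[where f = "\<lambda>_. 0"])
    have "(\<lambda>n. a n x * (a n x + b x) powr (p - 1)) \<longlonglongrightarrow> 0 * (if p = 1 then 1 else (0 + b x) powr (p - 1))"
    \<comment> \<open>For \<open>p = 1\<close> the exponent vanishes, and \<open>powr\<close> with
      exponent \<open>0\<close> is \<open>0\<close> at base \<open>0\<close> and \<open>1\<close>
      elsewhere; instead of passing to the limit in the second factor, it is bounded by
      \<open>1\<close>.\<close>
    proof (cases "p = 1")
      case True
      have "(\<lambda>n. a n x * (a n x + b x) powr 0) \<longlonglongrightarrow> 0"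
        by (rule tendsto_sandwich[OF _ _ tendsto_const lim]) (use a0 in \<open>auto intro!: always_eventually simp: powr_zero_eq_one\<close>)
      with True show ?thesis by simp
    next
      case False
      with p have "p > 1" by simp
      have "(\<lambda>n. (a n x + b x) powr (p - 1)) \<longlonglongrightarrow> (0 + b x) powr (p - 1)"
        by (rule tendsto_powr'[OF tendsto_add[OF lim tendsto_const] tendsto_const])
          (use \<open>p > 1\<close> a0 b0 in \<open>auto intro!: always_eventually\<close>)
      from tendsto_mult[OF lim this] False show ?thesis by simp
    qed
    then show "(\<lambda>n. a n x * (a n x + b x) powr (p - 1)) \<longlonglongrightarrow> 0" by simp
  qed (use q0 in \<open>auto intro!: always_eventually mult_right_mono simp: q_def\<close>)
  have key: "\<exists>N. \<forall>n\<ge>N. lsum (q n) < e" if e: "e > 0" for e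
  proof -
    \<comment> \<open>The quotient makes the part with \<open>b x \<le> \<delta> * a n x\<close>
      contribute less than \<open>e / 2\<close>, with \<open>M + 1\<close> guarding against division
      by \<open>0\<close>; the cap at \<open>1\<close> gives
      \<open>a n x + b x \<le> 2 * a n x\<close> there.\<close>
    define \<delta> where "\<delta> = min 1 (e / (2 * (M + 1) * 2 powr (p - 1)))"
    have d: "0 < \<delta>" "\<delta> \<le> 1" using e M0 by (auto simp: \<delta>_def)
    have "\<delta> * (2 * (M + 1) * 2 powr (p - 1)) \<le> e" using M0 by (subst pos_le_divide_eq[symmetric]) (auto simp: \<delta>_def)
    then have d2: "\<delta> * 2 powr (p - 1) * (M + 1) \<le> e / 2" by (simp add: algebra_simps)
    have "0 < \<delta> * 2 powr (p - 1)" using d by simp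
    then have d3: "\<delta> * 2 powr (p - 1) * M < e / 2" using d2 by (simp add: distrib_left)
    define K where "K = (1 / \<delta> + 1) powr (p - 1)"
    \<comment> \<open>Cutting the error off at a summable function makes dominated convergence
      applicable, and where \<open>b x > \<delta> * a n x\<close> the cut changes nothing.\<close>
    define r where "r n x = min (q n x) (K * b x powr p)" for n x
    have qle: "q n x \<le> \<delta> * 2 powr (p - 1) * a n x powr p + r n x" for n x
    proof (cases "b x \<le> \<delta> * a n x")
      case True
      have "\<delta> * a n x \<le> a n x" using d a0[of n x] by (simp add: mult_left_le_one_le)
      with True have "q n x \<le> (\<delta> * a n x) * (2 * a n x) powr (p - 1)"
        unfolding q_def using a0[of n x] b0[of x] p d by (intro mult_mono powr_mono2) auto
      also have "\<dots> = \<delta> * 2 powr (p - 1) * (a n x powr (p - 1) * a n x)" using a0[of n x] by (simp add: powr_mult)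
      also have "\<dots> = \<delta> * 2 powr (p - 1) * a n x powr p" by (simp only: powr_minus_one_mult[OF a0])
      moreover have "0 \<le> r n x" using q0[of n x] by (simp add: r_def K_def)
      ultimately show ?thesis by linarith
    next
      case False
      then have "a n x \<le> b x / \<delta>" using d by (simp add: field_simps)
      then have "q n x \<le> b x * ((1 / \<delta> + 1) * b x) powr (p - 1)" unfolding q_def using a0[of n x] b0[of x] p d
        by (intro mult_mono powr_mono2) (auto simp: distrib_right)
      also have "\<dots> = K * (b x powr (p - 1) * b x)" using b0[of x] d by (simp add: K_def powr_mult)
      also have "\<dots> = K * b x powr p" by (simp only: powr_minus_one_mult[OF b0])
      finally show ?thesis using d by (simp add: r_def)
    qed
    have Kb: "l1 (\<lambda>x. K * b x powr p)" using b by simp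
    have K0: "0 \<le> K" by (simp add: K_def)
    have rb: "\<bar>r n x\<bar> \<le> K * b x powr p" and r0: "0 \<le> r n x" for n x using q0[of n x] K0 by (auto simp: r_def)
    have "(\<lambda>n. lsum (r n)) \<longlonglongrightarrow> lsum (\<lambda>x::'a. 0)"
    proof (rule lsum_dominated_convergence[OF Kb rb])
      show "(\<lambda>n. r n x) \<longlonglongrightarrow> 0" for x
        by (rule tendsto_sandwich[OF _ _ tendsto_const qlim[of x]]) (use r0 in \<open>auto simp: r_def\<close>)
    qed
    then have "(\<lambda>n. lsum (r n)) \<longlonglongrightarrow> 0" by simp
    then obtain N where N: "\<And>n. n \<ge> N \<Longrightarrow> lsum (r n) < e / 2"
      using e by (metis half_gt_zero order_tendstoD(2) eventually_sequentially)
    have "lsum (q n) < e" if "n \<ge> N" for n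
    proof -
      have r1: "l1 (r n)" by (rule l1_bound[OF Kb rb])
      have "lsum (q n) \<le> lsum (\<lambda>x. \<delta> * 2 powr (p - 1) * a n x powr p + r n x)"
        by (rule lsum_mono_bound) (use a1 r1 q0 qle in auto)
      also have "\<dots> = \<delta> * 2 powr (p - 1) * lsum (\<lambda>x. a n x powr p) + lsum (r n)" using a1 r1 by simp
      also have "\<dots> \<le> \<delta> * 2 powr (p - 1) * M + lsum (r n)"
        using aM[of n] d by (intro add_right_mono mult_left_mono) auto
      also have "\<dots> < e" using N[OF that] d3 by simp
      finally show ?thesis .
    qed
    then show ?thesis by blast
  qed
  have "(\<lambda>n. lsum (q n)) \<longlonglongrightarrow> 0"
  proof (rule LIMSEQ_I)
    fix e :: real assume "0 < e"
    then obtain N where "\<forall>n\<ge>N. lsum (q n) < e" using key by blast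
    moreover have "0 \<le> lsum (q n)" for n using q0 by simp
    ultimately show "\<exists>N. \<forall>n\<ge>N. norm (lsum (q n) - 0) < e" by auto
  qed
  then show ?thesis by (simp add: q_def[abs_def])
qed

section \<open>Fourier coefficients and the Green's function\<close>

text \<open>Lebesgue measure is the image of a product of one-dimensional measures under the
  coordinate map, so integrals of product functions factor. This reduces the orthogonality of
  characters to one dimension.\<close>

lemma lborel_integral_prod_Basis:
  fixes g :: "'a::euclidean_space \<Rightarrow> real \<Rightarrow> complex"
  assumes "\<And>b. b \<in> Basis \<Longrightarrow> integrable lborel (g b)"
  shows "(\<integral>x. (\<Prod>b\<in>Basis. g b (x \<bullet> b)) \<partial>(lborel :: 'a measure)) = (\<Prod>b\<in>Basis. integral\<^sup>L lborel (g b))"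
proof -
  interpret product_sigma_finite "\<lambda>_::'a. lborel :: real measure" ..
  have m: "g b \<in> borel_measurable borel" if "b \<in> Basis" for b
    using borel_measurable_integrable[OF assms[OF that]] by simp
  have "(\<integral>x. (\<Prod>b\<in>Basis. g b (x \<bullet> b)) \<partial>(lborel :: 'a measure)) =
      (\<integral>f. (\<Prod>b\<in>Basis. g b ((\<Sum>b\<in>Basis. f b *\<^sub>R b) \<bullet> b)) \<partial>(\<Pi>\<^sub>M b\<in>(Basis::'a set). lborel))"
    by (subst lborel_eq, subst integral_distr) (auto intro!: borel_measurable_prod measurable_compose[OF _ m])
  also have "\<dots> = (\<integral>f. (\<Prod>b\<in>Basis. g b (f b)) \<partial>(\<Pi>\<^sub>M b\<in>(Basis::'a set). lborel))"
    by (intro Bochner_Integration.integral_cong refl prod.cong) (simp add: inner_sum_left inner_Basis if_distrib cong: if_cong)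
  also have "\<dots> = (\<Prod>b\<in>Basis. integral\<^sup>L lborel (g b))" using assms by (intro product_integral_prod) auto
  finally show ?thesis .
qed

section \<open>Trigonometric integrals over the torus\<close>

definition phase :: "int ^ 'n \<Rightarrow> real ^ 'n \<Rightarrow> real" where
  "phase m k = (\<Sum>j\<in>UNIV. real_of_int (m $ j) * k $ j)"

lemma phase_add: "phase (m + m') k = phase m k + phase m' k"
  by (simp add: phase_def distrib_right sum.distrib)

lemma phase_diff: "phase (m - m') k = phase m k - phase m' k"
  by (simp add: phase_def left_diff_distrib sum_subtractf)

lemma phase_uminus: "phase (- m) k = - phase m k"
  by (simp add: phase_def sum_negf)

lemma phase_measurable [measurable]: "phase m \<in> borel_measurable borel"
proof -
  have "continuous_on UNIV (phase m)" unfolding phase_def by (intro continuous_intros)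
  then show ?thesis by (rule borel_measurable_continuous_onI)
qed

text \<open>The real part of a Fourier coefficient of a real weight; the complex exponential appears
  only where orthogonality is proved and where the Green's function is unfolded.\<close>

abbreviation (input) cos_coeff :: "int ^ 'n \<Rightarrow> (real ^ 'n \<Rightarrow> real) \<Rightarrow> real" where
  "cos_coeff m V \<equiv> \<integral>k. indicator torus_box k * (cos (phase m k) * V k) \<partial>lborel"

lemma torus_box_measurable [measurable]: "torus_box \<in> sets borel"
  by (simp add: torus_box_def)

lemma torus_box_finite: "emeasure lborel (torus_box :: (real ^ 'n) set) < \<infinity>"
  by (simp add: torus_box_def emeasure_lborel_cbox_eq)

lemma integrable_torus_bounded:
  fixes V :: "real ^ 'n \<Rightarrow> real"
  assumes "V \<in> borel_measurable borel" "\<And>k. \<bar>V k\<bar> \<le> B"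
  shows "integrable lborel (\<lambda>k. indicator torus_box k * V k)"
proof (rule Bochner_Integration.integrable_bound)
  show "integrable lborel (\<lambda>k::real ^ 'n. B * indicator torus_box k)"
    using torus_box_finite by (intro integrable_mult_right integrable_real_indicator) auto
  show "AE k in lborel. norm (indicator torus_box k * V k) \<le> norm (B * indicator torus_box k)"
    using assms(2) by (intro AE_I2) (auto simp: indicator_def intro: order_trans[OF _ abs_ge_self])
qed (use assms(1) in measurable)

lemma integral_cis_period:
  fixes n :: int assumes "n \<noteq> 0"
  shows "(\<integral>t. complex_of_real (indicator {0..2 * pi} t) * exp (\<i> * complex_of_real (real_of_int n * t)) \<partial>lborel) = 0"
proof -
  let ?F = "\<lambda>t::real. exp (\<i> * complex_of_real (real_of_int n * t)) / (\<i> * of_int n)"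
  have "(\<integral>t. indicator {0..2 * pi} t *\<^sub>R exp (\<i> * complex_of_real (real_of_int n * t)) \<partial>lborel) = ?F (2 * pi) - ?F 0"
  proof (rule integral_FTC_atLeastAtMost)
    show "(?F has_vector_derivative exp (\<i> * complex_of_real (real_of_int n * t))) (at t within {0..2 * pi})" for t
      using assms by (auto intro!: derivative_eq_intros has_vector_derivative_real_field simp: field_simps)
    show "continuous_on {0..2 * pi} (\<lambda>t. exp (\<i> * complex_of_real (real_of_int n * t)))" by (intro continuous_intros)
  qed simp
  also have "exp (\<i> * complex_of_real (real_of_int n * (2 * pi))) = 1"
    by (metis exp_integer_2pi Ints_of_int mult.assoc mult.commute of_real_mult of_real_of_int_eq of_real_numeral)
  then have "?F (2 * pi) - ?F 0 = 0" by simp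
  finally show ?thesis by (simp add: scaleR_conv_of_real)
qed

text \<open>Some coordinate of \<open>m\<close> is nonzero, and along it the exponential runs
  through whole periods; this factor of the product integral vanishes.\<close>

lemma integral_cos_phase_eq_0:
  fixes m :: "int ^ 'n"
  assumes "m \<noteq> 0"
  shows "(\<integral>k. indicator torus_box k * cos (phase m k) \<partial>lborel) = 0"
proof -
  define m' :: "real ^ 'n" where "m' = (\<chi> j. real_of_int (m $ j))"
  define g where "g b t = complex_of_real (indicator {0..2 * pi} t) * exp (\<i> * complex_of_real ((m' \<bullet> b) * t))"
    for b :: "real ^ 'n" and t
  have g1: "integrable lborel (g b)" for b
  proof -
    have "integrable lborel (\<lambda>t. indicator {0..2 * pi} t *\<^sub>R exp (\<i> * complex_of_real ((m' \<bullet> b) * t)))"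
      unfolding set_integrable_def[symmetric] by (intro borel_integrable_atLeastAtMost' continuous_intros)
    then show ?thesis by (simp add: g_def[abs_def] scaleR_conv_of_real)
  qed
  have ph: "phase m k = (\<Sum>b\<in>Basis. (m' \<bullet> b) * (k \<bullet> b))" for k
    by (subst euclidean_inner[symmetric]) (simp add: phase_def m'_def inner_vec_def)
  have box: "complex_of_real (indicator torus_box k) = (\<Prod>b\<in>Basis. complex_of_real (indicator {0..2 * pi} (k \<bullet> b)))"
    for k :: "real ^ 'n"
  proof (cases "k \<in> torus_box")
    case True
    then have "k \<bullet> b \<in> {0..2 * pi}" if "b \<in> Basis" for b
      using that by (auto simp: torus_box_def mem_box Basis_vec_def inner_axis)
    with True show ?thesis by simp
  next
    case False
    then obtain j where "k $ j \<notin> {0..2 * pi}" by (auto simp: torus_box_def mem_box Basis_vec_def inner_axis)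
    then have "complex_of_real (indicator {0..2 * pi} (k \<bullet> axis j 1)) = 0" by (simp add: inner_axis)
    moreover have "axis j (1::real) \<in> Basis" by (auto simp: Basis_vec_def)
    ultimately show ?thesis using False by (subst prod_zero) auto
  qed
  have e: "complex_of_real (indicator torus_box k) * exp (\<i> * complex_of_real (phase m k)) = (\<Prod>b\<in>Basis. g b (k \<bullet> b))" for k
    unfolding g_def prod.distrib box[symmetric] ph by (simp add: exp_sum[symmetric] sum_distrib_left)
  obtain j where j: "m $ j \<noteq> 0" using assms by (auto simp: vec_eq_iff)
  have "integral\<^sup>L lborel (g (axis j 1)) = 0"
    using integral_cis_period[OF j] by (simp add: g_def[abs_def] m'_def inner_axis)
  moreover have "axis j (1::real) \<in> Basis" by (auto simp: Basis_vec_def)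
  ultimately have "(\<Prod>b\<in>Basis. integral\<^sup>L lborel (g b)) = 0" by auto
  then have z: "(\<integral>k. complex_of_real (indicator torus_box k) * exp (\<i> * complex_of_real (phase m k)) \<partial>lborel) = 0"
    unfolding e by (subst lborel_integral_prod_Basis[OF g1])
  have "complex_of_real (\<integral>k. indicator torus_box k * cos (phase m k) \<partial>lborel) =
      (\<integral>k. complex_of_real (indicator torus_box k * cos (phase m k)) \<partial>lborel)"
    by (simp only: integral_complex_of_real)
  also have "\<dots> = (\<integral>k. (complex_of_real (indicator torus_box k) * exp (\<i> * complex_of_real (phase m k)) +
      cnj (complex_of_real (indicator torus_box k) * exp (\<i> * complex_of_real (phase m k)))) / 2 \<partial>lborel)"
    by (intro Bochner_Integration.integral_cong refl) (simp add: complex_add_cnj exp_Euler complex_eq_iff cos_of_real sin_of_real Re_exp Im_exp)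
  also have "\<dots> = 0"
  proof -
    have "integrable lborel (\<lambda>k. complex_of_real (indicator torus_box k) * exp (\<i> * complex_of_real (phase m k)))"
    proof (rule Bochner_Integration.integrable_bound)
      show "integrable lborel (\<lambda>k::real ^ 'n. 1 * indicator torus_box k :: real)"
        using torus_box_finite by (intro integrable_mult_right integrable_real_indicator) auto
    qed (auto intro!: AE_I2 simp: norm_mult indicator_def)
    then show ?thesis using z
      by (subst integral_divide_zero, subst Bochner_Integration.integral_add) (simp_all del: complex_cnj_mult)
  qed
  finally show ?thesis by (simp only: of_real_eq_0_iff)
qed

lemma integrable_torus_trig:
  fixes f :: "real ^ 'n \<Rightarrow> real"
  assumes "f \<in> borel_measurable borel" "\<And>k. \<bar>f k\<bar> \<le> B"
  shows "integrable lborel (\<lambda>k. indicator torus_box k * f k)"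
    and "\<bar>\<integral>k. indicator torus_box k * f k \<partial>lborel\<bar> \<le> B * measure lborel (torus_box :: (real ^ 'n) set)"
proof -
  show i: "integrable lborel (\<lambda>k. indicator torus_box k * f k)" by (rule integrable_torus_bounded[OF assms])
  have B: "integrable lborel (\<lambda>k::real ^ 'n. indicator torus_box k * B)"
    by (rule integrable_torus_bounded[of "\<lambda>_. B" "\<bar>B\<bar>"]) auto
  have "\<bar>\<integral>k. indicator torus_box k * f k \<partial>lborel\<bar> \<le> (\<integral>k. \<bar>indicator torus_box k * f k\<bar> \<partial>lborel)"
    by (rule integral_abs_bound)
  also have "\<dots> \<le> (\<integral>k. indicator (torus_box :: (real ^ 'n) set) k * B \<partial>lborel)"
    using i B assms(2) by (intro integral_mono) (auto simp: indicator_def)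
  also have "\<dots> = B * measure lborel (torus_box :: (real ^ 'n) set)" by simp
  finally show "\<bar>\<integral>k. indicator torus_box k * f k \<partial>lborel\<bar> \<le> B * measure lborel (torus_box :: (real ^ 'n) set)" .
qed

text \<open>
  The Bessel-type bound behind the Riemann--Lebesgue lemma: pairing \<open>V\<close> with the trigonometric
  polynomial whose coefficients are the signs of the Fourier coefficients gives the \<open>l\<^sup>1\<close> sum of
  the latter, while orthogonality bounds the \<open>L\<^sup>2\<close> norm of that polynomial.
\<close>

lemma fourier_coeff_card_bound:
  fixes V :: "real ^ 'n \<Rightarrow> real" and Y :: "(int ^ 'n) set"
  assumes V: "V \<in> borel_measurable borel" "\<And>k. \<bar>V k\<bar> \<le> B" and Y: "finite Y" and e: "0 < e"
    and big: "\<And>m. m \<in> Y \<Longrightarrow> e \<le> \<bar>cos_coeff m V\<bar>"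
  shows "real (card Y) * e\<^sup>2 \<le> (2 * B * measure lborel (torus_box :: (real ^ 'n) set))\<^sup>2"
proof (cases "Y = {}")
  case False
  note [measurable] = V(1)
  define T where "T = measure lborel (torus_box :: (real ^ 'n) set)"
  define a where "a m = (cos_coeff m V)" for m
  define S where "S k = (\<Sum>m\<in>Y. sgn (a m) * cos (phase m k))" for k
  \<comment> \<open>The weight in
    \<open>\<bar>S k\<bar> \<le> l / 2 + (S k)\<^sup>2 / (2 * l)\<close>, which stands in for
    Cauchy--Schwarz. The root of the cardinality balances the two terms, because the integral of
    \<open>(S k)\<^sup>2\<close> is of the order of \<open>card Y\<close>.\<close>
  define l where "l = sqrt (real (card Y))"
  have T0: "0 \<le> T" by (simp add: T_def)
  have B0: "0 \<le> B" using V(2)[of 0] by linarith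
  have [measurable]: "S \<in> borel_measurable borel" unfolding S_def by measurable
  have cY: "0 < card Y" using False Y by (simp add: card_gt_0_iff)
  then have l0: "0 < l" and ll: "l * l = card Y" by (auto simp: l_def)
  have Sb: "\<bar>S k\<bar> \<le> card Y" for k
  proof -
    have "\<bar>S k\<bar> \<le> (\<Sum>m\<in>Y. \<bar>sgn (a m) * cos (phase m k)\<bar>)" unfolding S_def by (rule sum_abs)
    also have "\<dots> \<le> (\<Sum>m\<in>Y. 1)" by (intro sum_mono) (auto simp: abs_mult sgn_if)
    finally show ?thesis by simp
  qed
  have cos1: "\<bar>cos s * cos t\<bar> \<le> 1" for s t :: real unfolding abs_mult by (rule mult_le_one) simp_all
  \<comment> \<open>Cosines do not distinguish \<open>m\<close> from \<open>- m\<close>, so up to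
    two indices survive orthogonality; hence the factor \<open>2\<close> in the bound on the square
    integral of \<open>S\<close>.\<close>
  have cc: "\<bar>cos_coeff m (\<lambda>k. cos (phase m' k))\<bar>
      \<le> (if m' = m \<or> m' = - m then T else 0)" for m m' :: "int ^ 'n"
  proof -
    let ?I = "cos_coeff m (\<lambda>k. cos (phase m' k))"
    show "\<bar>?I\<bar> \<le> (if m' = m \<or> m' = - m then T else 0)"
    proof (cases "m' = m \<or> m' = - m")
      case True
      have "\<bar>?I\<bar> \<le> 1 * T" unfolding T_def by (rule integrable_torus_trig(2)) (use cos1 in simp_all)
      with True show ?thesis by simp
    next
      case False
      then have nz: "m + m' \<noteq> 0" "m - m' \<noteq> 0" by (auto simp: add_eq_0_iff2)
      have i: "integrable lborel (\<lambda>k. indicator torus_box k * cos (phase z k))" for z :: "int ^ 'n"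
        by (rule integrable_torus_trig(1)[of _ 1]) auto
      have "?I = (\<integral>k. (indicator torus_box k * cos (phase (m - m') k) + indicator torus_box k * cos (phase (m + m') k)) / 2 \<partial>lborel)"
        by (intro Bochner_Integration.integral_cong refl)
          (simp add: phase_add phase_diff cos_times_cos distrib_left[symmetric])
      also have "\<dots> = 0" using i by (simp add: integral_cos_phase_eq_0[OF nz(1)] integral_cos_phase_eq_0[OF nz(2)])
      finally show ?thesis using False by simp
    qed
  qed
  have SS: "(\<integral>k. indicator torus_box k * (S k)\<^sup>2 \<partial>lborel) \<le> 2 * card Y * T"
  proof -
    have i: "integrable lborel (\<lambda>k. indicator torus_box k * (cos (phase m k) * cos (phase m' k)))" for m m' :: "int ^ 'n"
    by (rule integrable_torus_trig(1)[of _ 1]) (use cos1 in simp_all)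
    have "(\<integral>k. indicator torus_box k * (S k)\<^sup>2 \<partial>lborel) = (\<integral>k. (\<Sum>m\<in>Y. \<Sum>m'\<in>Y. sgn (a m) * sgn (a m') *
        (indicator torus_box k * (cos (phase m k) * cos (phase m' k)))) \<partial>lborel)"
      by (intro Bochner_Integration.integral_cong refl)
        (simp add: S_def power2_eq_square sum_product sum_distrib_left algebra_simps)
    also have "\<dots> = (\<Sum>m\<in>Y. \<Sum>m'\<in>Y. sgn (a m) * sgn (a m') *
        (cos_coeff m (\<lambda>k. cos (phase m' k))))"
      using i by (simp add: Bochner_Integration.integral_sum)
    also have "\<dots> \<le> (\<Sum>m\<in>Y. \<Sum>m'\<in>Y. if m' = m \<or> m' = - m then T else 0)"
    proof (intro sum_mono)
      fix m m' :: "int ^ 'n"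
      let ?I = "cos_coeff m (\<lambda>k. cos (phase m' k))"
      have "sgn (a m) * sgn (a m') * ?I \<le> \<bar>?I\<bar>"
        using abs_ge_self[of ?I] abs_ge_minus_self[of ?I] by (auto simp: sgn_if)
      also note cc
      finally show "sgn (a m) * sgn (a m') * ?I \<le> (if m' = m \<or> m' = - m then T else 0)" .
    qed
    also have "\<dots> \<le> (\<Sum>m\<in>Y. 2 * T)"
    proof (intro sum_mono)
      fix m assume "m \<in> Y"
      have "(\<Sum>m'\<in>Y. if m' = m \<or> m' = - m then T else 0) = (\<Sum>m'\<in>{m' \<in> Y. m' = m \<or> m' = - m}. T)"
        by (rule sum.inter_filter[OF Y, symmetric])
      also have "\<dots> \<le> (\<Sum>m'\<in>{m, - m}. T)" using T0 by (intro sum_mono2) auto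
      also have "\<dots> \<le> 2 * T" using T0 by (auto simp: card_insert_if intro!: mult_right_mono)
      finally show "(\<Sum>m'\<in>Y. if m' = m \<or> m' = - m then T else 0) \<le> 2 * T" .
    qed
    finally show ?thesis by simp
  qed
  have iS: "integrable lborel (\<lambda>k. indicator torus_box k * (S k)\<^sup>2)"
    by (rule integrable_torus_trig(1)[of _ "(card Y)\<^sup>2"]) (use power_mono[OF Sb abs_ge_zero, of _ 2] in auto)
  have i1: "integrable lborel (\<lambda>k::real^'n. indicator torus_box k * 1 :: real)"
    by (rule integrable_torus_trig(1)[of _ 1]) auto
  have iSV: "integrable lborel (\<lambda>k. indicator torus_box k * (cos (phase m k) * V k))" for m
  proof (rule integrable_torus_trig(1)[of _ B])
    show "\<bar>cos (phase m k) * V k\<bar> \<le> B" for k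
      using mult_mono[of "\<bar>cos (phase m k)\<bar>" 1 "\<bar>V k\<bar>" B] V(2)[of k] by (simp add: abs_mult)
  qed measurable
  have "e * card Y = (\<Sum>m\<in>Y. e)" by simp
  also have "\<dots> \<le> (\<Sum>m\<in>Y. \<bar>a m\<bar>)" using big by (intro sum_mono) (simp add: a_def)
  also have "\<dots> = (\<Sum>m\<in>Y. sgn (a m) * a m)" by (simp add: abs_sgn mult.commute)
  also have "\<dots> = (\<integral>k. (\<Sum>m\<in>Y. sgn (a m) * (indicator torus_box k * (cos (phase m k) * V k))) \<partial>lborel)"
    using iSV by (simp add: Bochner_Integration.integral_sum a_def)
  also have "\<dots> = (\<integral>k. indicator torus_box k * (V k * S k) \<partial>lborel)"
    by (intro Bochner_Integration.integral_cong refl) (simp add: S_def sum_distrib_left algebra_simps)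
  also have "\<dots> \<le> (\<integral>k. (indicator torus_box k * 1 * (l * B / 2) + indicator torus_box k * (S k)\<^sup>2 * (B / (2 * l))) \<partial>lborel)"
  proof (rule integral_mono)
    show "integrable lborel (\<lambda>k. indicator torus_box k * (V k * S k))"
    proof (rule integrable_torus_trig(1)[of _ "B * card Y"])
      show "\<bar>V k * S k\<bar> \<le> B * card Y" for k using V(2)[of k] Sb[of k] B0 by (auto simp: abs_mult intro!: mult_mono)
    qed measurable
    show "integrable lborel (\<lambda>k. indicator torus_box k * 1 * (l * B / 2) + indicator torus_box k * (S k)\<^sup>2 * (B / (2 * l)))"
      using iS i1 by (intro Bochner_Integration.integrable_add integrable_mult_left) auto
    show "indicator torus_box k * (V k * S k) \<le> indicator torus_box k * 1 * (l * B / 2) + indicator torus_box k * (S k)\<^sup>2 * (B / (2 * l))" for k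
    proof -
      have "0 \<le> (l - \<bar>S k\<bar>)\<^sup>2" by simp
      then have "2 * l * \<bar>S k\<bar> \<le> l * l + (S k)\<^sup>2" by (simp add: power2_eq_square algebra_simps)
      then have s: "\<bar>S k\<bar> \<le> l / 2 + (S k)\<^sup>2 / (2 * l)" using l0 by (simp add: field_simps)
      have "V k * S k \<le> B * \<bar>S k\<bar>"
        using V(2)[of k] mult_right_mono[of "\<bar>V k\<bar>" B "\<bar>S k\<bar>"] abs_ge_self[of "V k * S k"] by (simp add: abs_mult)
      also have "\<dots> \<le> B * (l / 2 + (S k)\<^sup>2 / (2 * l))" by (rule mult_left_mono[OF s B0])
      finally show ?thesis by (simp add: indicator_def algebra_simps)
    qed
  qed
  also have "\<dots> = T * (l * B / 2) + (\<integral>k. indicator torus_box k * (S k)\<^sup>2 \<partial>lborel) * (B / (2 * l))"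
    using iS i1 by (simp add: T_def)
  also have "\<dots> \<le> T * (l * B / 2) + 2 * card Y * T * (B / (2 * l))"
    using SS B0 l0 by (intro add_left_mono mult_right_mono) auto
  also have "\<dots> = T * (l * B / 2) + T * B * l" using ll l0 by (simp add: field_simps)
  also have "\<dots> \<le> 2 * B * T * l" using T0 B0 l0 by (simp add: field_simps)
  finally have "e * (l * l) \<le> 2 * B * T * l" by (simp add: ll)
  then have "e * l \<le> 2 * B * T" using l0 by (simp add: mult.assoc[symmetric])
  then have "(e * l)\<^sup>2 \<le> (2 * B * T)\<^sup>2" using e l0 by (intro power_mono) auto
  moreover have "(e * l)\<^sup>2 = real (card Y) * e\<^sup>2" by (simp add: power_mult_distrib l_def)
  ultimately show ?thesis by (simp add: T_def)
qed simp

text \<open>Truncating \<open>w\<close> at a large height costs less than \<open>e / 2\<close> of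
  its integral, so a coefficient of size \<open>e\<close> leaves one of size at least
  \<open>e / 2\<close> for the bounded truncation. The cardinality bound admits only finitely many
  of those.\<close>

lemma riemann_lebesgue_torus:
  fixes w :: "real ^ 'n \<Rightarrow> real"
  assumes w: "w \<in> borel_measurable borel" "\<And>k. 0 \<le> w k"
    and i: "integrable lborel (\<lambda>k. indicator torus_box k * w k)" and e: "0 < e"
  shows "finite {m :: int ^ 'n. e \<le> \<bar>cos_coeff m w\<bar>}"
proof -
  note [measurable] = w(1)
  define r where "r n k = indicator torus_box k * (w k - min (w k) (real n))" for n k
  have r0: "0 \<le> r n k" and rle: "r n k \<le> indicator torus_box k * w k" for n k
    using w(2)[of k] by (auto simp: r_def indicator_def)
  have [measurable]: "r n \<in> borel_measurable borel" for n unfolding r_def by measurable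
  have "(\<lambda>n. \<integral>k. r n k \<partial>lborel) \<longlonglongrightarrow> (\<integral>k. 0 \<partial>(lborel :: (real ^ 'n) measure))"
  proof (rule integral_dominated_convergence[OF _ _ i])
    show "AE k in lborel. (\<lambda>n. r n k) \<longlonglongrightarrow> 0"
    proof (rule AE_I2)
      fix k :: "real ^ 'n"
      have "eventually (\<lambda>n. r n k = 0) sequentially" using eventually_ge_at_top[of "nat \<lceil>w k\<rceil>"]
        by eventually_elim (auto simp: r_def min_def nat_le_iff ceiling_le_iff)
      then show "(\<lambda>n. r n k) \<longlonglongrightarrow> 0" by (rule tendsto_eventually)
    qed
    show "AE k in lborel. norm (r n k) \<le> indicator torus_box k * w k" for n by (rule AE_I2) (use r0 rle in auto)
  qed auto
  then have "(\<lambda>n. \<integral>k. r n k \<partial>lborel) \<longlonglongrightarrow> 0" by simp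
  then obtain n where n: "(\<integral>k. r n k \<partial>lborel) < e / 2"
    using e by (metis half_gt_zero order_tendstoD(2) eventually_sequentially order_refl)
  define V where "V k = min (w k) (real n)" for k
  have V: "V \<in> borel_measurable borel" "\<And>k. \<bar>V k\<bar> \<le> real n" using w(2) by (auto simp: V_def[abs_def] min_def)
  have ir: "integrable lborel (r n)" by (rule Bochner_Integration.integrable_bound[OF i]) (use r0 rle w in auto)
  have iV: "integrable lborel (\<lambda>k. indicator torus_box k * (cos (phase m k) * V k))" for m
  proof (rule integrable_torus_trig(1)[of _ "real n"])
    show "\<bar>cos (phase m k) * V k\<bar> \<le> real n" for k
      using mult_mono[of "\<bar>cos (phase m k)\<bar>" 1 "\<bar>V k\<bar>" "real n"] V(2)[of k] by (simp add: abs_mult)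
    show "(\<lambda>k. cos (phase m k) * V k) \<in> borel_measurable borel" using V(1) by measurable
  qed
  have icr: "integrable lborel (\<lambda>k. cos (phase m k) * r n k)" for m
  proof (rule Bochner_Integration.integrable_bound[OF ir])
    show "AE k in lborel. norm (cos (phase m k) * r n k) \<le> norm (r n k)"
      by (intro AE_I2) (simp add: abs_mult mult_left_le_one_le)
  qed auto
  let ?Y = "{m :: int ^ 'n. e \<le> \<bar>cos_coeff m w\<bar>}"
  have big: "e / 2 \<le> \<bar>cos_coeff m V\<bar>" if "m \<in> ?Y" for m
  proof -
    have "(cos_coeff m w) =
        (\<integral>k. indicator torus_box k * (cos (phase m k) * V k) + cos (phase m k) * r n k \<partial>lborel)"
      by (intro Bochner_Integration.integral_cong refl) (simp add: V_def r_def algebra_simps)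
    also have "\<dots> = (cos_coeff m V) + (\<integral>k. cos (phase m k) * r n k \<partial>lborel)" using iV icr by simp
    finally have 1: "cos_coeff m w = \<dots>" .
    have "\<bar>\<integral>k. cos (phase m k) * r n k \<partial>lborel\<bar> \<le> (\<integral>k. \<bar>cos (phase m k) * r n k\<bar> \<partial>lborel)"
      by (rule integral_abs_bound)
    also have "\<dots> \<le> (\<integral>k. r n k \<partial>lborel)"
      using r0 by (intro integral_mono integrable_abs icr ir) (auto simp: abs_mult mult_left_le_one_le)
    finally show ?thesis using 1 n that by simp
  qed
  show "finite ?Y"
  proof (rule ccontr)
    assume "infinite ?Y"
    let ?C = "(2 * real n * measure lborel (torus_box :: (real ^ 'n) set))\<^sup>2"
    obtain N where N: "?C < real N * (e / 2)\<^sup>2" using ex_less_of_nat_mult[of "(e / 2)\<^sup>2" ?C] e by auto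
    obtain Y where Y: "Y \<subseteq> ?Y" "finite Y" "card Y = N" using infinite_arbitrarily_large[OF \<open>infinite ?Y\<close>] by blast
    then have "real (card Y) * (e / 2)\<^sup>2 \<le> ?C" using big e by (intro fourier_coeff_card_bound[OF V]) auto
    then show False using N Y by simp
  qed
qed

section \<open>The Green's function: symmetry, boundedness and decay\<close>

definition green_weight :: "real \<Rightarrow> real ^ 'n \<Rightarrow> real" where
  "green_weight \<alpha> k = symb k powr (- \<alpha> / 2)"

lemma green_weight_measurable [measurable]: "green_weight \<alpha> \<in> borel_measurable borel"
proof -
  have "continuous_on UNIV (symb :: real ^ 'n \<Rightarrow> real)" unfolding symb_def by (intro continuous_intros)
  then have [measurable]: "(symb :: real ^ 'n \<Rightarrow> real) \<in> borel_measurable borel"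
    by (rule borel_measurable_continuous_onI)
  show ?thesis unfolding green_weight_def by measurable
qed

definition green_const :: "'n::finite itself \<Rightarrow> real \<Rightarrow> real" where
  "green_const _ \<alpha> = K_const TYPE('n) \<alpha> / (2 * pi) ^ CARD('n)"

text \<open>
  If the weight were not integrable, the Bochner integral defining the Green's function would be
  zero; treating this case here avoids a discussion of the singularity of the symbol at the origin.
\<close>

lemma green_eq:
  "green \<alpha> x y = (if integrable lborel (\<lambda>k::real ^ 'n. indicator torus_box k * green_weight \<alpha> k :: real)
     then green_const TYPE('n) \<alpha> *
       (cos_coeff (x - y) (green_weight \<alpha>))
     else 0)" for x y :: "int ^ 'n"
proof -
  let ?c = "green_const TYPE('n) \<alpha>"
  let ?f = "\<lambda>k. complex_of_real (indicator torus_box k * green_weight \<alpha> k) * exp (\<i> * complex_of_real (phase (x - y) k))"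
  have g: "green \<alpha> x y = ?c * Re (integral\<^sup>L lborel ?f)"
  proof -
    have "(LINT k : (torus_box :: (real ^ 'n) set) | lborel.
            exp (\<i> * complex_of_real (\<Sum>j\<in>UNIV. real_of_int (x $ j - y $ j) * k $ j)) *
            complex_of_real (symb k powr (- \<alpha> / 2))) = integral\<^sup>L lborel ?f"
      unfolding set_lebesgue_integral_def by (intro Bochner_Integration.integral_cong refl)
        (simp add: scaleR_conv_of_real phase_def green_weight_def)
    then show ?thesis unfolding green_def green_const_def by (simp only: times_complex.sel Re_complex_of_real Im_complex_of_real mult_zero_left diff_zero)
  qed
  have n: "norm (?f k) = norm (indicator torus_box k * green_weight \<alpha> k)" for k by (simp add: norm_mult abs_mult)
  have [measurable]: "?f \<in> borel_measurable borel" by measurable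
  show ?thesis
  proof (cases "integrable lborel (\<lambda>k::real ^ 'n. indicator torus_box k * green_weight \<alpha> k :: real)")
    case True
    then have "integrable lborel ?f"
    proof (rule Bochner_Integration.integrable_bound)
      show "AE k in lborel. norm (?f k) \<le> norm (indicator torus_box k * green_weight \<alpha> k :: real)"
        by (rule AE_I2) (simp only: n order_refl)
    qed measurable
    then have "Re (integral\<^sup>L lborel ?f) = (\<integral>k. Re (?f k) \<partial>lborel)" by (rule integral_Re[symmetric])
    also have "\<dots> = (cos_coeff (x - y) (green_weight \<alpha>))"
      by (intro Bochner_Integration.integral_cong refl) (simp add: Re_exp)
    finally show ?thesis using True g by simp
  next
    case False
    have "\<not> integrable lborel ?f"
    proof
      assume "integrable lborel ?f"
      then have "integrable lborel (\<lambda>k::real ^ 'n. indicator torus_box k * green_weight \<alpha> k :: real)"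
        by (rule Bochner_Integration.integrable_bound) (auto simp: norm_mult abs_mult)
      with False show False ..
    qed
    then have "integral\<^sup>L lborel ?f = 0" by (rule not_integrable_integral_eq)
    then show ?thesis using False g by (simp del: of_real_mult)
  qed
qed

lemma green_sym: "green \<alpha> x y = green \<alpha> y x" for x y :: "int ^ 'n"
proof -
  have "phase (x - y) k = - phase (y - x) k" for k :: "real ^ 'n" using phase_uminus[of "y - x" k] by simp
  then show ?thesis by (simp add: green_eq)
qed

lemma green_translate: "green \<alpha> (x + z) (y + z) = green \<alpha> x y"
  by (simp add: green_eq)

lemma green_weight_nonneg: "0 \<le> green_weight \<alpha> k"
  by (simp add: green_weight_def)

lemma green_bounded: "\<exists>K>0. \<forall>x y :: int ^ 'n. \<bar>green \<alpha> x y\<bar> \<le> K"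
proof -
  let ?c = "green_const TYPE('n) \<alpha>"
  let ?W = "\<integral>k. indicator (torus_box :: (real ^ 'n) set) k * green_weight \<alpha> k \<partial>lborel"
  have "\<bar>green \<alpha> x y\<bar> \<le> \<bar>?c\<bar> * ?W + 1" for x y :: "int ^ 'n"
  proof (cases "integrable lborel (\<lambda>k::real ^ 'n. indicator torus_box k * green_weight \<alpha> k :: real)")
    case True
    let ?g = "\<lambda>k::real ^ 'n. indicator torus_box k * (cos (phase (x - y) k) * green_weight \<alpha> k)"
    have le: "\<bar>?g k\<bar> \<le> indicator torus_box k * green_weight \<alpha> k" for k
      using green_weight_nonneg[of \<alpha> k] by (simp add: abs_mult indicator_def mult_left_le_one_le)
    have i: "integrable lborel ?g"
      by (rule Bochner_Integration.integrable_bound[OF True]) (use le in \<open>auto intro: order_trans[OF _ abs_ge_self]\<close>)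
    have "\<bar>integral\<^sup>L lborel ?g\<bar> \<le> (\<integral>k. \<bar>?g k\<bar> \<partial>lborel)" by (rule integral_abs_bound)
    also have "\<dots> \<le> ?W" using le by (intro integral_mono integrable_abs i True) auto
    finally show ?thesis using True by (simp add: green_eq abs_mult mult_left_mono add_increasing2)
  next
    case False
    then show ?thesis by (simp add: green_eq not_integrable_integral_eq)
  qed
  moreover have "0 < \<bar>?c\<bar> * ?W + 1"
    by (intro add_nonneg_pos mult_nonneg_nonneg Bochner_Integration.integral_nonneg) (auto simp: green_weight_nonneg)
  ultimately show ?thesis by blast
qed

text \<open>Vanishing at infinity, stated through finite superlevel sets: a convolution is then
  split into finitely many large kernel entries and a uniformly small rest.\<close>

lemma green_small_finite:
  fixes x :: "int ^ 'n" assumes e: "0 < e"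
  shows "finite {y. e \<le> \<bar>green \<alpha> x y\<bar>}"
proof (cases "integrable lborel (\<lambda>k::real ^ 'n. indicator torus_box k * green_weight \<alpha> k :: real)")
  case True
  let ?c = "green_const TYPE('n) \<alpha>"
  let ?a = "\<lambda>m :: int ^ 'n. cos_coeff m (green_weight \<alpha>)"
  \<comment> \<open>The summand \<open>1\<close> keeps the threshold meaningful when the constant is
    \<open>0\<close>.\<close>
  have "finite ((\<lambda>m. x - m) ` {m. e / (\<bar>?c\<bar> + 1) \<le> \<bar>?a m\<bar>})"
    using e by (intro finite_imageI riemann_lebesgue_torus True) (auto simp: green_weight_nonneg)
  moreover have "{y. e \<le> \<bar>green \<alpha> x y\<bar>} \<subseteq> (\<lambda>m. x - m) ` {m. e / (\<bar>?c\<bar> + 1) \<le> \<bar>?a m\<bar>}"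
  proof
    fix y assume "y \<in> {y. e \<le> \<bar>green \<alpha> x y\<bar>}"
    then have "e \<le> \<bar>?c\<bar> * \<bar>?a (x - y)\<bar>" using True by (simp add: green_eq abs_mult)
    also have "\<dots> \<le> (\<bar>?c\<bar> + 1) * \<bar>?a (x - y)\<bar>" by (intro mult_right_mono) auto
    finally have "e / (\<bar>?c\<bar> + 1) \<le> \<bar>?a (x - y)\<bar>" by (subst pos_divide_le_eq) (auto simp: mult.commute)
    then show "y \<in> (\<lambda>m. x - m) ` {m. e / (\<bar>?c\<bar> + 1) \<le> \<bar>?a m\<bar>}" by (intro image_eqI[of _ _ "x - y"]) auto
  qed
  ultimately show ?thesis by (rule finite_subset[rotated])
next
  case False
  then show ?thesis using e by (simp add: green_eq)
qed

section \<open>The Green form and the discrete gradient\<close>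

lemma l1_translate:
  fixes g :: "'a::ab_group_add \<Rightarrow> real"
  shows "l1 (\<lambda>x. g (x + z)) \<longleftrightarrow> l1 g" and "lsum (\<lambda>x. g (x + z)) = lsum g"
proof -
  have b: "bij_betw (\<lambda>x. x + z) UNIV UNIV" by (rule bij_betwI[where g = "\<lambda>x. x - z"]) auto
  show "l1 (\<lambda>x. g (x + z)) \<longleftrightarrow> l1 g" by (rule integrable_bij_count_space[OF b])
  show "lsum (\<lambda>x. g (x + z)) = lsum g" by (rule integral_bij_count_space[OF b])
qed

lemma lsum_swap:
  fixes g :: "'a::countable \<Rightarrow> 'b::countable \<Rightarrow> real"
  assumes "l1 (\<lambda>(x, y). g x y)"
  shows "lsum (\<lambda>x. lsum (\<lambda>y. g x y)) = lsum (\<lambda>y. lsum (\<lambda>x. g x y))"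
proof -
  interpret pair_sigma_finite "count_space (UNIV :: 'a set)" "count_space (UNIV :: 'b set)"
    by (simp add: pair_sigma_finite_def sigma_finite_measure_count_space_countable)
  have "count_space (UNIV :: 'a set) \<Otimes>\<^sub>M count_space (UNIV :: 'b set) = count_space UNIV"
    by (subst pair_measure_countable) auto
  then show ?thesis using Fubini_integral[of g] assms by simp
qed

lemma l1_product:
  fixes g :: "'a::countable \<Rightarrow> real" and k :: "'b::countable \<Rightarrow> real"
  assumes "l1 g" "l1 k"
  shows "l1 (\<lambda>(x, y). g x * k y)"
proof -
  interpret pair_sigma_finite "count_space (UNIV :: 'a set)" "count_space (UNIV :: 'b set)"
    by (simp add: pair_sigma_finite_def sigma_finite_measure_count_space_countable)
  have e: "count_space (UNIV :: 'a set) \<Otimes>\<^sub>M count_space (UNIV :: 'b set) = count_space UNIV"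
    by (subst pair_measure_countable) auto
  have "integrable (count_space UNIV \<Otimes>\<^sub>M count_space UNIV) (\<lambda>(x, y). g x * k y)"
    using assms by (intro Fubini_integrable) (auto simp: e abs_mult AE_count_space)
  then show ?thesis by (simp add: e)
qed

text \<open>The common bilinear form of the nonlocal energy and of its derivative. The two arguments
  are arbitrary, so that splitting errors in l^1 can be inserted as well.\<close>

definition green_form :: "real \<Rightarrow> (int ^ 'n \<Rightarrow> real) \<Rightarrow> (int ^ 'n \<Rightarrow> real) \<Rightarrow> real" where
  "green_form \<alpha> g k = lsum (\<lambda>x. green_conv \<alpha> g x * k x)"

definition green_bound :: "'n::finite itself \<Rightarrow> real \<Rightarrow> real" where
  "green_bound _ \<alpha> = (SOME K. 0 < K \<and> (\<forall>x y :: int ^ 'n. \<bar>green \<alpha> x y\<bar> \<le> K))"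

lemma green_bound_pos: "0 < green_bound TYPE('n::finite) \<alpha>"
  and green_le_bound: "\<bar>green \<alpha> x y\<bar> \<le> green_bound TYPE('n) \<alpha>" for x y :: "int ^ 'n"
  using someI_ex[OF green_bounded[where 'n = 'n and \<alpha> = \<alpha>, unfolded Bex_def]] unfolding green_bound_def by auto

lemma l1_green:
  fixes g :: "int ^ 'n \<Rightarrow> real"
  assumes "l1 g" shows "l1 (\<lambda>y. green \<alpha> x y * g y)"
proof (rule l1_bound)
  show "l1 (\<lambda>y. green_bound TYPE('n) \<alpha> * \<bar>g y\<bar>)" using assms by simp
  show "\<bar>green \<alpha> x y * g y\<bar> \<le> green_bound TYPE('n) \<alpha> * \<bar>g y\<bar>" for y
    by (simp add: abs_mult mult_right_mono green_le_bound)
qed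

lemma green_conv_bound:
  fixes g :: "int ^ 'n \<Rightarrow> real"
  assumes "l1 g" "\<And>y. \<bar>g y\<bar> \<le> w y" "l1 w"
  shows "\<bar>green_conv \<alpha> g x\<bar> \<le> green_bound TYPE('n) \<alpha> * lsum w"
proof -
  have "\<bar>green_conv \<alpha> g x\<bar> \<le> lsum (\<lambda>y. \<bar>green \<alpha> x y * g y\<bar>)" unfolding green_conv_def by (rule integral_abs_bound)
  also have "\<dots> \<le> lsum (\<lambda>y. green_bound TYPE('n) \<alpha> * w y)" by (rule lsum_mono_bound)
      (use assms in \<open>auto simp: abs_mult intro!: mult_mono green_le_bound less_imp_le[OF green_bound_pos]\<close>)
  also have "\<dots> = green_bound TYPE('n) \<alpha> * lsum w" by simp
  finally show ?thesis .
qed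

lemma l1_green_form:
  fixes g k :: "int ^ 'n \<Rightarrow> real"
  assumes "l1 g" "l1 k" shows "l1 (\<lambda>x. green_conv \<alpha> g x * k x)"
proof (rule l1_bound)
  show "l1 (\<lambda>x. green_bound TYPE('n) \<alpha> * lsum (\<lambda>y. \<bar>g y\<bar>) * \<bar>k x\<bar>)" using assms by simp
  show "\<bar>green_conv \<alpha> g x * k x\<bar> \<le> green_bound TYPE('n) \<alpha> * lsum (\<lambda>y. \<bar>g y\<bar>) * \<bar>k x\<bar>" for x
    using green_conv_bound[OF assms(1), of "\<lambda>y. \<bar>g y\<bar>" \<alpha> x] assms by (simp add: abs_mult mult_right_mono)
qed

lemma green_form_bound:
  fixes g k :: "int ^ 'n \<Rightarrow> real"
  assumes "l1 g" "l1 k"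
  shows "\<bar>green_form \<alpha> g k\<bar> \<le> green_bound TYPE('n) \<alpha> * lsum (\<lambda>x. \<bar>g x\<bar>) * lsum (\<lambda>x. \<bar>k x\<bar>)"
proof -
  have "\<bar>green_form \<alpha> g k\<bar> \<le> lsum (\<lambda>x. \<bar>green_conv \<alpha> g x * k x\<bar>)"
    unfolding green_form_def by (rule integral_abs_bound)
  also have "\<dots> \<le> lsum (\<lambda>x. green_bound TYPE('n) \<alpha> * lsum (\<lambda>y. \<bar>g y\<bar>) * \<bar>k x\<bar>)" by (rule lsum_mono_bound)
      (use green_conv_bound[OF assms(1), of "\<lambda>y. \<bar>g y\<bar>"] assms in \<open>auto simp: abs_mult mult_right_mono\<close>)
  finally show ?thesis by simp
qed

lemma green_conv_add:
  assumes "l1 g" "l1 g'"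
  shows "green_conv \<alpha> (\<lambda>x. g x + g' x) x = green_conv \<alpha> g x + green_conv \<alpha> g' x"
  unfolding green_conv_def using l1_green[OF assms(1)] l1_green[OF assms(2)] by (simp add: distrib_left)

lemma green_conv_scale: "green_conv \<alpha> (\<lambda>x. c * g x) x = c * green_conv \<alpha> g x"
  unfolding green_conv_def by (simp add: mult.left_commute)

lemma green_form_add_left:
  assumes "l1 g" "l1 g'" "l1 k"
  shows "green_form \<alpha> (\<lambda>x. g x + g' x) k = green_form \<alpha> g k + green_form \<alpha> g' k"
  unfolding green_form_def green_conv_add[OF assms(1,2)] distrib_right
  by (rule lsum_add) (use assms in \<open>auto intro: l1_green_form\<close>)

lemma green_form_add_right:
  assumes "l1 g" "l1 k" "l1 k'"
  shows "green_form \<alpha> g (\<lambda>x. k x + k' x) = green_form \<alpha> g k + green_form \<alpha> g k'"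
  unfolding green_form_def distrib_left by (rule lsum_add) (use assms in \<open>auto intro: l1_green_form\<close>)

lemma green_form_scale_left: "green_form \<alpha> (\<lambda>x. c * g x) k = c * green_form \<alpha> g k"
  unfolding green_form_def green_conv_scale by (simp add: mult.assoc)

lemma green_form_scale_right: "green_form \<alpha> g (\<lambda>x. c * k x) = c * green_form \<alpha> g k"
  unfolding green_form_def by (simp add: mult.left_commute)

text \<open>The kernel is symmetric and bounded, so the double series converges absolutely and the
  order of summation may be exchanged.\<close>

lemma green_form_sym:
  fixes g k :: "int ^ 'n \<Rightarrow> real"
  assumes "l1 g" "l1 k"
  shows "green_form \<alpha> g k = green_form \<alpha> k g"
proof -
  have i: "l1 (\<lambda>(x, y). green \<alpha> x y * g y * k x)"
  proof (rule l1_bound)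
    show "l1 (\<lambda>z. green_bound TYPE('n) \<alpha> * \<bar>case z of (x, y) \<Rightarrow> k x * g y\<bar>)"
      using l1_product[OF assms(2,1)] by (intro integrable_mult_right integrable_abs)
    show "\<bar>case z of (x, y) \<Rightarrow> green \<alpha> x y * g y * k x\<bar> \<le> green_bound TYPE('n) \<alpha> * \<bar>case z of (x, y) \<Rightarrow> k x * g y\<bar>" for z
    proof (cases z)
      case (Pair x y)
      have "\<bar>green \<alpha> x y\<bar> * \<bar>k x * g y\<bar> \<le> green_bound TYPE('n) \<alpha> * \<bar>k x * g y\<bar>"
        by (intro mult_right_mono green_le_bound) simp
      with Pair show ?thesis by (simp add: abs_mult mult_ac)
    qed
  qed
  have "green_form \<alpha> g k = lsum (\<lambda>x. lsum (\<lambda>y. green \<alpha> x y * g y * k x))"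
    unfolding green_form_def green_conv_def by simp
  also have "\<dots> = lsum (\<lambda>y. lsum (\<lambda>x. green \<alpha> x y * g y * k x))" by (rule lsum_swap[OF i])
  also have "\<dots> = lsum (\<lambda>y. lsum (\<lambda>x. green \<alpha> y x * k x * g y))"
    by (intro Bochner_Integration.integral_cong refl) (simp add: green_sym[of \<alpha> _ y for y] mult_ac)
  also have "\<dots> = green_form \<alpha> k g" unfolding green_form_def green_conv_def by simp
  finally show ?thesis .
qed

lemma green_conv_tendsto:
  fixes g :: "nat \<Rightarrow> int ^ 'n \<Rightarrow> real"
  assumes "l1 w" "\<And>n x. \<bar>g n x\<bar> \<le> w x" "\<And>x. (\<lambda>n. g n x) \<longlonglongrightarrow> g' x"
  shows "(\<lambda>n. green_conv \<alpha> (g n) x) \<longlonglongrightarrow> green_conv \<alpha> g' x" unfolding green_conv_def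
proof (rule lsum_dominated_convergence)
  show "l1 (\<lambda>y. green_bound TYPE('n) \<alpha> * w y)" using assms by simp
  show "\<bar>green \<alpha> x y * g n y\<bar> \<le> green_bound TYPE('n) \<alpha> * w y" for n y
    unfolding abs_mult using assms(2) by (intro mult_mono green_le_bound less_imp_le[OF green_bound_pos]) auto
qed (intro tendsto_intros assms)

lemma green_form_tendsto:
  fixes g k :: "nat \<Rightarrow> int ^ 'n \<Rightarrow> real"
  assumes w: "l1 w" "\<And>n x. \<bar>g n x\<bar> \<le> w x" "\<And>x. (\<lambda>n. g n x) \<longlonglongrightarrow> g' x"
    and v: "l1 v" "\<And>n x. \<bar>k n x\<bar> \<le> v x" "\<And>x. (\<lambda>n. k n x) \<longlonglongrightarrow> k' x"
  shows "(\<lambda>n. green_form \<alpha> (g n) (k n)) \<longlonglongrightarrow> green_form \<alpha> g' k'" unfolding green_form_def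
proof (rule lsum_dominated_convergence)
  show "l1 (\<lambda>x. green_bound TYPE('n) \<alpha> * lsum w * v x)" using v by simp
  have "l1 (g n)" for n by (rule l1_bound[OF w(1,2)])
  then have c: "\<bar>green_conv \<alpha> (g n) x\<bar> \<le> green_bound TYPE('n) \<alpha> * lsum w" for n x using w by (intro green_conv_bound)
  show "\<bar>green_conv \<alpha> (g n) x * k n x\<bar> \<le> green_bound TYPE('n) \<alpha> * lsum w * v x" for n x
    unfolding abs_mult using c v(2) by (intro mult_mono order_trans[OF abs_ge_zero c]) auto
qed (intro tendsto_mult green_conv_tendsto[OF w] v)

text \<open>The mass of \<open>g n\<close> is bounded in l^1 but may escape to infinity, so there is
  no dominating function for it. At a fixed \<open>x\<close> the kernel exceeds a given
  \<open>e\<close> at finitely many sites only, where \<open>g n\<close> tends to \<open>0\<close>;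
  elsewhere the kernel is small against the bounded mass. Thus the convolutions tend to
  \<open>0\<close> pointwise under a uniform bound, and the domination of \<open>k n\<close> does
  the rest.\<close>

lemma green_form_tendsto_0:
  fixes g k :: "nat \<Rightarrow> int ^ 'n \<Rightarrow> real"
  assumes g: "\<And>n. l1 (g n)" "\<And>n. lsum (\<lambda>x. \<bar>g n x\<bar>) \<le> M" "\<And>x. (\<lambda>n. g n x) \<longlonglongrightarrow> 0"
    and v: "l1 v" "\<And>n x. \<bar>k n x\<bar> \<le> v x"
  shows "(\<lambda>n. green_form \<alpha> (g n) (k n)) \<longlonglongrightarrow> 0"
proof -
  let ?K = "green_bound TYPE('n) \<alpha>"
  have K: "0 < ?K" by (rule green_bound_pos)
  have M0: "0 \<le> M" by (rule order_trans[OF Bochner_Integration.integral_nonneg g(2)[of 0]]) simp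
  have c0: "(\<lambda>n. green_conv \<alpha> (g n) x) \<longlonglongrightarrow> 0" for x
  proof (rule LIMSEQ_I)
    fix r :: real assume r: "0 < r"
    define e where "e = r / (2 * (M + 1))"
    have e: "0 < e" using r M0 by (simp add: e_def)
    define Y where "Y = {y. e \<le> \<bar>green \<alpha> x y\<bar>}"
    have Y: "finite Y" unfolding Y_def by (rule green_small_finite[OF e])
    have "(\<lambda>n. ?K * (\<Sum>y\<in>Y. \<bar>g n y\<bar>)) \<longlonglongrightarrow> ?K * (\<Sum>y\<in>Y. \<bar>0\<bar>)" by (intro tendsto_intros g)
    then have "eventually (\<lambda>n. ?K * (\<Sum>y\<in>Y. \<bar>g n y\<bar>) < r / 2) sequentially" by (rule order_tendstoD) (use r in simp)
    then obtain N where N: "\<And>n. n \<ge> N \<Longrightarrow> ?K * (\<Sum>y\<in>Y. \<bar>g n y\<bar>) < r / 2" by (auto simp: eventually_sequentially)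
    have "norm (green_conv \<alpha> (g n) x - 0) < r" if "n \<ge> N" for n
    proof -
      let ?q = "\<lambda>y. if y \<in> Y then ?K * \<bar>g n y\<bar> else 0"
      have q: "l1 ?q" "lsum ?q = ?K * (\<Sum>y\<in>Y. \<bar>g n y\<bar>)"
        using l1_finite_support[OF Y, of ?q] by (simp_all add: sum_distrib_left)
      have "\<bar>green_conv \<alpha> (g n) x\<bar> \<le> lsum (\<lambda>y. \<bar>green \<alpha> x y * g n y\<bar>)"
        unfolding green_conv_def by (rule integral_abs_bound)
      also have "\<dots> \<le> lsum (\<lambda>y. e * \<bar>g n y\<bar> + ?q y)"
      proof (rule lsum_mono_bound)
        show "l1 (\<lambda>y. e * \<bar>g n y\<bar> + ?q y)" using g q by simp
        show "\<bar>green \<alpha> x y * g n y\<bar> \<le> e * \<bar>g n y\<bar> + ?q y" for y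
        proof (cases "y \<in> Y")
          case True
          have "\<bar>green \<alpha> x y\<bar> * \<bar>g n y\<bar> \<le> ?K * \<bar>g n y\<bar>" by (intro mult_right_mono green_le_bound) simp
          with True e show ?thesis by (simp add: abs_mult add_increasing)
        next
          case False
          then have "\<bar>green \<alpha> x y\<bar> * \<bar>g n y\<bar> \<le> e * \<bar>g n y\<bar>" by (intro mult_right_mono) (auto simp: Y_def)
          with False show ?thesis by (simp add: abs_mult)
        qed
      qed simp
      also have "\<dots> = e * lsum (\<lambda>y. \<bar>g n y\<bar>) + ?K * (\<Sum>y\<in>Y. \<bar>g n y\<bar>)" using g q by simp
      also have "\<dots> < e * (M + 1) + r / 2"
        using N[OF that] g(2)[of n] e by (intro add_le_less_mono mult_left_mono) auto
      also have "\<dots> = r" using M0 by (simp add: e_def field_simps)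
      finally show ?thesis by simp
    qed
    then show "\<exists>N. \<forall>n\<ge>N. norm (green_conv \<alpha> (g n) x - 0) < r" by blast
  qed
  have c: "\<bar>green_conv \<alpha> (g n) x\<bar> \<le> ?K * M" for n x
    using green_conv_bound[OF g(1)[of n], of "\<lambda>y. \<bar>g n y\<bar>" \<alpha> x] g(1)[of n] g(2)[of n] K
    by (auto intro: order_trans[OF _ mult_left_mono])
  have "(\<lambda>n. green_form \<alpha> (g n) (k n)) \<longlonglongrightarrow> lsum (\<lambda>x::int ^ 'n. 0)" unfolding green_form_def
  proof (rule lsum_dominated_convergence)
    show "l1 (\<lambda>x. ?K * M * v x)" using v by simp
    show "\<bar>green_conv \<alpha> (g n) x * k n x\<bar> \<le> ?K * M * v x" for n x
      unfolding abs_mult using c v(2) by (intro mult_mono order_trans[OF abs_ge_zero c]) auto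
    show "(\<lambda>n. green_conv \<alpha> (g n) x * k n x) \<longlonglongrightarrow> 0" for x
    proof (rule Lim_null_comparison)
      show "eventually (\<lambda>n. norm (green_conv \<alpha> (g n) x * k n x) \<le> \<bar>green_conv \<alpha> (g n) x\<bar> * v x) sequentially"
        by (intro always_eventually) (auto simp: abs_mult intro!: mult_left_mono v(2))
      show "(\<lambda>n. \<bar>green_conv \<alpha> (g n) x\<bar> * v x) \<longlonglongrightarrow> 0"
        using tendsto_mult[OF tendsto_rabs[OF c0[of x]] tendsto_const[of "v x"]] by simp
    qed
  qed
  then show ?thesis by simp
qed

lemma green_conv_translate:
  "green_conv \<alpha> (\<lambda>y. g (y + z)) x = green_conv \<alpha> g (x + z)" unfolding green_conv_def
  using l1_translate(2)[of "\<lambda>y. green \<alpha> (x + z) y * g y" z] by (simp add: green_translate)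

lemma green_form_translate:
  "green_form \<alpha> (\<lambda>x. g (x + z)) (\<lambda>x. k (x + z)) = green_form \<alpha> g k"
  unfolding green_form_def green_conv_translate by (rule l1_translate(2))

section \<open>The discrete gradient\<close>

lemma nbrs_translate: "nbrs (x + z) = (\<lambda>y. y + z) ` nbrs x"
proof -
  have "y \<in> nbrs (x + z) \<longleftrightarrow> y - z \<in> nbrs x" for y by (simp add: nbrs_def lattice_adj_def algebra_simps)
  then show ?thesis by (force intro: image_eqI[of _ _ "y - z" for y])
qed

lemma sum_nbrs: "(\<Sum>y\<in>nbrs x. g y) = (\<Sum>e\<in>nbrs 0. g (x + e))"
  using nbrs_translate[of 0 x] by (simp add: sum.reindex add.commute)

lemma nbrs_sym: "y \<in> nbrs x \<longleftrightarrow> x \<in> nbrs y"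
  by (simp add: nbrs_def lattice_adj_def abs_minus_commute)

lemma nbrs_irrefl: "x \<notin> nbrs x"
  by (simp add: nbrs_def lattice_adj_def)

text \<open>A multiple of the Euclidean norm of the vector of differences, so that Minkowski's
  inequality becomes available.\<close>

lemma grad_norm_L2_set: "grad_norm u x = sqrt (1 / 2) * L2_set (\<lambda>y. u y - u x) (nbrs x)"
  by (simp only: grad_norm_def L2_set_def real_sqrt_mult)

lemma grad_norm_nonneg [simp]: "0 \<le> grad_norm u x"
  by (simp add: grad_norm_def sum_nonneg)

lemma grad_norm_triangle: "grad_norm (\<lambda>x. u x + v x) x \<le> grad_norm u x + grad_norm v x"
proof -
  have "L2_set (\<lambda>y. (u y + v y) - (u x + v x)) (nbrs x) = L2_set (\<lambda>y. (u y - u x) + (v y - v x)) (nbrs x)"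
    by (simp add: algebra_simps)
  also have "\<dots> \<le> L2_set (\<lambda>y. u y - u x) (nbrs x) + L2_set (\<lambda>y. v y - v x) (nbrs x)" by (rule L2_set_triangle_ineq)
  finally show ?thesis unfolding grad_norm_L2_set distrib_left[symmetric] by (intro mult_left_mono) auto
qed

lemma grad_norm_scale: "grad_norm (\<lambda>x. c * u x) x = \<bar>c\<bar> * grad_norm u x"
proof -
  have "(\<Sum>y\<in>nbrs x. (c * u y - c * u x)\<^sup>2) = c\<^sup>2 * (\<Sum>y\<in>nbrs x. (u y - u x)\<^sup>2)"
    unfolding sum_distrib_left by (intro sum.cong refl) (simp add: power2_eq_square algebra_simps)
  then show ?thesis by (simp add: grad_norm_def real_sqrt_mult real_sqrt_divide)
qed

lemma grad_prod_self: "grad_prod u u x = (grad_norm u x)\<^sup>2"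
  by (simp add: grad_prod_def grad_norm_def sum_nonneg power2_eq_square)

lemma grad_norm_translate: "grad_norm (\<lambda>x. u (x + z)) x = grad_norm u (x + z)"
  by (simp add: grad_norm_def nbrs_translate sum.reindex)

text \<open>On the lattice a gradient is controlled by finitely many translates of the function
  itself; this makes it a bounded operation on l^p.\<close>

lemma grad_norm_le_sum: "grad_norm u x \<le> (\<Sum>e\<in>nbrs 0. \<bar>u (x + e)\<bar> + \<bar>u x\<bar>)"
proof -
  have "grad_norm u x \<le> L2_set (\<lambda>y. u y - u x) (nbrs x)" unfolding grad_norm_L2_set by (rule mult_left_le_one_le) auto
  also have "\<dots> \<le> (\<Sum>y\<in>nbrs x. \<bar>u y - u x\<bar>)" by (rule L2_set_le_sum_abs)
  also have "\<dots> \<le> (\<Sum>y\<in>nbrs x. \<bar>u y\<bar> + \<bar>u x\<bar>)" by (intro sum_mono abs_triangle_ineq4)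
  finally show ?thesis by (simp add: sum_nbrs[of _ x])
qed

lemma lp_translate: "lp p u \<Longrightarrow> lp p (\<lambda>x. u (x + z))" for u :: "int ^ 'n \<Rightarrow> real"
  unfolding lp_def by (subst l1_translate(1)[of "\<lambda>x. \<bar>u x\<bar> powr p"])

lemma lp_nbr_sum:
  fixes u :: "int ^ 'n \<Rightarrow> real"
  assumes "lp p u" "0 \<le> p"
  shows "lp p (\<lambda>x. \<Sum>e\<in>nbrs 0. \<bar>u (x + e)\<bar> + \<bar>u x\<bar>)"
  using assms by (intro lp_sum lp_add finite_nbrs) (auto simp: lp_abs lp_translate)

lemma lp_grad_norm:
  fixes u :: "int ^ 'n \<Rightarrow> real"
  assumes "lp p u" "0 \<le> p"
  shows "lp p (grad_norm u)"
proof (rule lp_bound[OF lp_nbr_sum[OF assms] _ assms(2)])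
  show "\<bar>grad_norm u x\<bar> \<le> \<bar>\<Sum>e\<in>nbrs 0. \<bar>u (x + e)\<bar> + \<bar>u x\<bar>\<bar>" for x using grad_norm_le_sum[of u x] by simp
qed

lemma grad_norm_tendsto:
  assumes "\<And>x. (\<lambda>n. u n x) \<longlonglongrightarrow> v x"
  shows "(\<lambda>n. grad_norm (u n) x) \<longlonglongrightarrow> grad_norm v x" unfolding grad_norm_def by (intro tendsto_intros assms)

text \<open>The gradient adds nothing to the l^p norm up to a constant. The approximants are the
  truncations along an enumeration of the lattice, and their gradients are dominated by one sum over
  neighbours.\<close>

lemma W1p_iff_lp:
  fixes u :: "int ^ 'n \<Rightarrow> real"
  assumes p: "0 < p"
  shows "u \<in> W1p p \<longleftrightarrow> lp p u"
proof
  assume "u \<in> W1p p"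
  then obtain s where s: "finite {x. s 0 x \<noteq> 0}"
    "l1 (\<lambda>x. grad_norm (\<lambda>z. u z - s 0 z) x powr p + \<bar>u x - s (0::nat) x\<bar> powr p)" unfolding W1p_def by blast
  have "lp p (\<lambda>x. u x - s 0 x)" unfolding lp_def by (rule l1_bound[OF s(2)]) simp
  from lp_add[OF this lp_finite_support[OF s(1)]] p show "lp p u" by simp
next
  assume u: "lp p u"
  define s where "s n x = (if to_nat x < n then u x else 0)" for n x
  define W where "W x = (\<Sum>e\<in>nbrs 0. \<bar>u (x + e)\<bar> + \<bar>u x\<bar>)" for x
  have W: "l1 (\<lambda>x. \<bar>W x\<bar> powr p + \<bar>u x\<bar> powr p)"
    using lp_nbr_sum[OF u] u p unfolding W_def by (intro l1_add) (auto simp: lp_def)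
  have fin: "finite {x. s n x \<noteq> 0}" for n
  proof (rule finite_subset)
    show "{x. s n x \<noteq> 0} \<subseteq> to_nat -` {..<n}" by (auto simp: s_def)
    show "finite (to_nat -` {..<n} :: (int ^ 'n) set)" by (rule finite_vimageI) auto
  qed
  have d: "\<bar>u x - s n x\<bar> \<le> \<bar>u x\<bar>" for n x by (simp add: s_def)
  have g: "grad_norm (\<lambda>z. u z - s n z) x \<le> W x" for n x
    unfolding W_def by (rule order_trans[OF grad_norm_le_sum]) (intro sum_mono add_mono d)
  have lim: "(\<lambda>n. u x - s n x) \<longlonglongrightarrow> 0" for x
  proof (rule tendsto_eventually)
    show "eventually (\<lambda>n. u x - s n x = 0) sequentially"
      using eventually_gt_at_top[of "to_nat x"] by eventually_elim (simp add: s_def)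
  qed
  let ?D = "\<lambda>n x. grad_norm (\<lambda>z. u z - s n z) x powr p + \<bar>u x - s n x\<bar> powr p"
  have Db: "\<bar>?D n x\<bar> \<le> \<bar>W x\<bar> powr p + \<bar>u x\<bar> powr p" for n x
  proof -
    have "grad_norm (\<lambda>z. u z - s n z) x powr p \<le> \<bar>W x\<bar> powr p"
      using p order_trans[OF g abs_ge_self] by (intro powr_mono2) auto
    moreover have "\<bar>u x - s n x\<bar> powr p \<le> \<bar>u x\<bar> powr p" using p d by (intro powr_mono2) auto
    ultimately show ?thesis by simp
  qed
  have "(\<lambda>n. lsum (?D n)) \<longlonglongrightarrow> lsum (\<lambda>x::int ^ 'n. 0)"
  proof (rule lsum_dominated_convergence[OF W Db])
    fix x
    have "(\<lambda>n. grad_norm (\<lambda>z. u z - s n z) x) \<longlonglongrightarrow> grad_norm (\<lambda>_. 0) x" by (rule grad_norm_tendsto[OF lim])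
    then have 1: "(\<lambda>n. grad_norm (\<lambda>z. u z - s n z) x) \<longlonglongrightarrow> 0" by (simp add: grad_norm_def)
    have 2: "(\<lambda>n. \<bar>u x - s n x\<bar>) \<longlonglongrightarrow> 0" using tendsto_rabs[OF lim[of x]] by simp
    have "(\<lambda>n. ?D n x) \<longlonglongrightarrow> 0 powr p + 0 powr p"
      using p by (intro tendsto_add tendsto_powr'[OF 1 tendsto_const] tendsto_powr'[OF 2 tendsto_const]) auto
    then show "(\<lambda>n. ?D n x) \<longlonglongrightarrow> 0" by simp
  qed
  then have l: "(\<lambda>n. lsum (?D n)) \<longlonglongrightarrow> 0" by simp
  have "(\<lambda>n. W1p_norm p (\<lambda>z. u z - s n z)) \<longlonglongrightarrow> 0 powr (1 / p)" unfolding W1p_norm_def using p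
    by (intro tendsto_powr'[OF l tendsto_const]) (auto intro!: always_eventually Bochner_Integration.integral_nonneg)
  then have "(\<lambda>n. W1p_norm p (\<lambda>z. u z - s n z)) \<longlonglongrightarrow> 0" by simp
  moreover have "l1 (?D n)" for n by (rule l1_bound[OF W Db])
  ultimately show "u \<in> W1p p" unfolding W1p_def using fin by blast
qed

section \<open>The nonlinearity\<close>

lemma MVT_between:
  fixes g :: "real \<Rightarrow> real"
  assumes "\<And>x. (g has_real_derivative g' x) (at x)"
  obtains z where "\<bar>z - t\<bar> \<le> \<bar>s - t\<bar>" "\<bar>z\<bar> \<le> max \<bar>s\<bar> \<bar>t\<bar>" "g s - g t = (s - t) * g' z"
proof (cases s t rule: linorder_cases)
  case less
  from MVT2[OF less, of g g'] assms obtain z where "s < z" "z < t" "g t - g s = (t - s) * g' z" by blast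
  then show ?thesis by (intro that[of z]) (auto simp: algebra_simps)
next
  case equal
  then show ?thesis by (intro that[of t]) auto
next
  case greater
  from MVT2[OF greater, of g g'] assms obtain z where "t < z" "z < s" "g s - g t = (s - t) * g' z" by blast
  then show ?thesis by (intro that[of z]) auto
qed

lemma powr_diff_le_aux:
  fixes s t :: real
  assumes "0 \<le> s" "s \<le> t" "1 \<le> p"
  shows "t powr p - s powr p \<le> p * (t - s) * t powr (p - 1)"
\<comment> \<open>The derivative of \<open>powr\<close> is used at positive bases, and the mean
  value theorem asks for it at the endpoint \<open>s\<close> too; so \<open>s = 0\<close> is
  separated.\<close>
proof (cases "s = 0 \<or> s = t")
  case True
  then show ?thesis
  proof
    assume "s = 0"
    have "t powr p = t * t powr (p - 1)" using powr_minus_one_mult[of t p] assms by (simp add: mult.commute)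
    also have "\<dots> \<le> p * (t * t powr (p - 1))" using assms mult_right_mono[of 1 p "t * t powr (p - 1)"] by simp
    finally show ?thesis using \<open>s = 0\<close> assms by (simp add: mult.assoc)
  qed simp
next
  case False
  with assms have st: "0 < s" "s < t" by auto
  have "\<exists>z. s < z \<and> z < t \<and> t powr p - s powr p = (t - s) * (p * z powr (p - 1))"
    by (rule MVT2[OF st(2)]) (use st in \<open>auto intro!: has_real_derivative_powr\<close>)
  then obtain z where z: "s < z" "z < t" "t powr p - s powr p = (t - s) * (p * z powr (p - 1))" by blast
  have "z powr (p - 1) \<le> t powr (p - 1)" using z st assms by (intro powr_mono2) auto
  then have "(t - s) * (p * z powr (p - 1)) \<le> (t - s) * (p * t powr (p - 1))"
    using st assms by (intro mult_left_mono) auto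
  then show ?thesis using z by (simp add: mult_ac)
qed

lemma powr_diff_le:
  fixes s t :: real
  assumes "0 \<le> s" "0 \<le> t" "1 \<le> p" "\<bar>s - t\<bar> \<le> d" "s \<le> m" "t \<le> m"
  shows "\<bar>s powr p - t powr p\<bar> \<le> p * d * m powr (p - 1)"
proof -
  have *: "\<bar>s powr p - t powr p\<bar> \<le> p * d * m powr (p - 1)"
    if "0 \<le> s" "s \<le> t" "\<bar>s - t\<bar> \<le> d" "t \<le> m" for s t
  proof -
    have "s powr p \<le> t powr p" using that assms by (intro powr_mono2) auto
    then have "\<bar>s powr p - t powr p\<bar> \<le> p * (t - s) * t powr (p - 1)"
      using powr_diff_le_aux[of s t p] that assms by simp
    also have "\<dots> \<le> p * d * m powr (p - 1)" using that assms by (intro mult_mono powr_mono2) auto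
    finally show ?thesis .
  qed
  show ?thesis using *[of s t] *[of t s] assms by (cases "s \<le> t") (auto simp: abs_minus_commute)
qed

text \<open>The hypotheses are what the triangle inequality says about the sizes \<open>X\<close> of
  a sum and \<open>Y\<close>, \<open>Z\<close> of its summands. The smaller of \<open>Y\<close> and
  \<open>Z\<close> counts as the perturbation: its own power and the change of the other power are
  both at most a multiple of it.\<close>

lemma powr_split_le:
  fixes X Y Z :: real
  assumes "0 \<le> X" "0 \<le> Y" "0 \<le> Z" "\<bar>X - Y\<bar> \<le> Z" "\<bar>X - Z\<bar> \<le> Y" "1 \<le> p"
  shows "\<bar>X powr p - Y powr p - Z powr p\<bar> \<le> 2 * p * err p Y Z"
proof -
  have *: "\<bar>X powr p - Y powr p - Z powr p\<bar> \<le> 2 * p * (Z * (Y + Z) powr (p - 1))"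
    if "0 \<le> X" "0 \<le> Y" "0 \<le> Z" "\<bar>X - Y\<bar> \<le> Z" for X Y Z
  proof -
    have "\<bar>X powr p - Y powr p\<bar> \<le> p * Z * (Y + Z) powr (p - 1)" using that assms(6) by (intro powr_diff_le) auto
    moreover have "\<bar>Z powr p - 0 powr p\<bar> \<le> p * Z * (Y + Z) powr (p - 1)"
      using that assms(6) by (intro powr_diff_le) auto
    moreover have "\<bar>Z powr p - 0 powr p\<bar> = Z powr p" by simp
    ultimately show ?thesis using powr_ge_zero[of Z p] by linarith
  qed
  show ?thesis
  proof (cases "Y \<le> Z")
    case True
    have "X powr p - Z powr p - Y powr p = X powr p - Y powr p - Z powr p" by simp
    then show ?thesis using *[of X Z Y] assms True by (simp only: min_absorb1 add.commute[of Z Y])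
  next
    case False
    then show ?thesis using *[of X Y Z] assms by (simp only: min_absorb2 linear not_le less_imp_le)
  qed
qed

text \<open>The root need not be differentiable where \<open>q\<close> vanishes, but its power is:
  for \<open>p = 2\<close> it is \<open>q\<close> itself, and \<open>rpow\<close> contributes
  \<open>1\<close>; for \<open>p > 2\<close> the outer function has derivative \<open>0\<close> at
  \<open>0\<close>.\<close>

lemma DERIV_sqrt_powr:
  fixes q :: "real \<Rightarrow> real"
  assumes q: "(q has_real_derivative q') (at a)" and q0: "\<And>t. 0 \<le> q t" and p: "2 \<le> p"
  shows "((\<lambda>t. sqrt (q t) powr p) has_real_derivative p / 2 * rpow (sqrt (q a)) (p - 2) * q') (at a)"
proof -
  have e: "sqrt (q t) powr p = q t powr (p / 2)" for t
    using q0[of t] by (cases "q t = 0") (auto simp: powr_half_sqrt[symmetric] powr_powr)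
  consider "0 < q a" | "q a = 0" "p = 2" | "q a = 0" "2 < p" using q0[of a] p by linarith
  then show ?thesis
  proof cases
    case 1
    have "((\<lambda>t. q t powr (p / 2)) has_real_derivative (p / 2 * q a powr (p / 2 - 1)) * q') (at a)"
      by (rule DERIV_chain2[OF has_real_derivative_powr[OF 1] q])
    moreover have "q a powr (p / 2 - 1) = rpow (sqrt (q a)) (p - 2)"
      using 1 by (simp add: rpow_def powr_half_sqrt[symmetric] powr_powr diff_divide_distrib)
    ultimately show ?thesis unfolding e by simp
  next
    case 2
    then show ?thesis using q q0 unfolding e by (simp add: rpow_def)
  next
    case 3
    have "((\<lambda>s::real. \<bar>s\<bar> powr (p / 2)) has_real_derivative 0) (at 0)"
    proof -
      have "((\<lambda>s::real. \<bar>s\<bar> powr (p / 2 - 1)) \<longlongrightarrow> 0 powr (p / 2 - 1)) (at 0)"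
        using 3 by (intro tendsto_powr'[OF tendsto_rabs_zero[OF tendsto_ident_at] tendsto_const]) auto
      then have l: "((\<lambda>s::real. \<bar>s\<bar> powr (p / 2 - 1)) \<longlongrightarrow> 0) (at 0)" by simp
      have "((\<lambda>s::real. (\<bar>0 + s\<bar> powr (p / 2) - \<bar>0\<bar> powr (p / 2)) / s) \<longlongrightarrow> 0) (at 0)"
      proof (rule Lim_null_comparison[OF _ l])
        have "norm ((\<bar>0 + s\<bar> powr (p / 2) - \<bar>0\<bar> powr (p / 2)) / s) \<le> \<bar>s\<bar> powr (p / 2 - 1)" for s :: real
          using powr_minus_one_mult[of "\<bar>s\<bar>" "p / 2"] by (cases "s = 0") (auto simp: field_simps)
        then show "eventually (\<lambda>s. norm ((\<bar>0 + s\<bar> powr (p / 2) - \<bar>0\<bar> powr (p / 2)) / s) \<le> \<bar>s\<bar> powr (p / 2 - 1)) (at (0::real))"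
          by (intro always_eventually) simp
      qed
      then show ?thesis by (simp add: DERIV_def)
    qed
    then have "((\<lambda>s::real. \<bar>s\<bar> powr (p / 2)) has_real_derivative 0) (at (q a))" using 3 by simp
    from DERIV_chain2[OF this q] show ?thesis using 3 q0 unfolding e by (simp add: rpow_def)
  qed
qed

lemma DERIV_at_0_seq:
  assumes "(g has_real_derivative D) (at 0)" "\<And>n. e n \<noteq> 0" "e \<longlonglongrightarrow> 0"
  shows "(\<lambda>n. (g (e n) - g 0) / e n) \<longlonglongrightarrow> D"
proof -
  have "((\<lambda>h. (g (0 + h) - g 0) / h) \<longlongrightarrow> D) (at 0)" using assms(1) by (simp add: DERIV_def)
  from filterlim_compose[OF this, of e sequentially] assms show ?thesis by (simp add: filterlim_at)
qed

section \<open>Periods and bounds of the potential\<close>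

locale choquard =
  fixes p \<alpha> :: real and h :: "int ^ 'n \<Rightarrow> real" and f :: "real \<Rightarrow> real"
  assumes p_ge_2: "2 \<le> p"
    and h_lower: "\<exists>h0>0. \<forall>x. h x \<ge> h0"
    and h_periodic: "\<exists>T::nat. T > 0 \<and> (\<forall>x i. h (x + axis i (int T)) = h x)"
    and f_cont: "continuous_on UNIV f"
    and f_small: "f \<in> o[at 0](\<lambda>t. \<bar>t\<bar> powr (p - 1))"
    and nonlinearity_mono: "\<forall>u \<in> H_space p h - {\<lambda>_. 0}.
           strict_mono_on {0<..}
             (\<lambda>t::real. 1 / t powr p *
               (\<integral>x. green_conv \<alpha> (\<lambda>y. primitive f (t * u y)) x * f (t * u x) * u x
                  \<partial>count_space UNIV))"
begin

abbreviation (input) F :: "real \<Rightarrow> real" where "F \<equiv> primitive f"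

definition hmin :: real where "hmin = (SOME c. 0 < c \<and> (\<forall>x. c \<le> h x))"

lemma hmin: "0 < hmin" "hmin \<le> h x"
  using someI_ex[of "\<lambda>c. 0 < c \<and> (\<forall>x. c \<le> h x)"] h_lower unfolding hmin_def by auto

lemma h_nonneg: "0 \<le> h x"
  using hmin(1) hmin(2)[of x] by linarith

definition period :: "int ^ 'n \<Rightarrow> bool" where
  "period z \<longleftrightarrow> (\<forall>x. h (x + z) = h x)"

lemma period_add: "period a \<Longrightarrow> period b \<Longrightarrow> period (a + b)"
  by (simp add: period_def add.assoc[symmetric])

lemma period_uminus: "period a \<Longrightarrow> period (- a)"
  unfolding period_def using diff_add_cancel[of _ a] by (metis add_uminus_conv_diff)

lemma period_0: "period 0"
  by (simp add: period_def)

lemma period_sum: "finite A \<Longrightarrow> (\<And>a. a \<in> A \<Longrightarrow> period (g a)) \<Longrightarrow> period (sum g A)"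
  by (induction A rule: finite_induct) (auto simp: period_0 period_add)

lemma period_axis_mult:
  assumes "period (axis i t)"
  shows "period (axis i (t * m))"
proof -
  have n: "period (axis i (t * int k))" for k
  proof (induction k)
    case 0
    have "axis i (t * int 0) = (0 :: int ^ 'n)" by (simp add: axis_def vec_eq_iff)
    then show ?case by (simp only: period_0)
  next
    case (Suc k)
    have "axis i (t * int (Suc k)) = axis i (t * int k) + (axis i t :: int ^ 'n)"
      by (simp add: axis_def vec_eq_iff algebra_simps)
    then show ?case using period_add[OF Suc assms] by simp
  qed
  show ?thesis
  proof (cases m)
    case (nonneg k) then show ?thesis using n by simp
  next
    case (neg k)
    have "axis i (t * m) = - (axis i (t * int (Suc k)) :: int ^ 'n)"
      unfolding neg by (simp add: axis_def vec_eq_iff algebra_simps)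
    then show ?thesis using period_uminus[OF n[of "Suc k"]] by simp
  qed
qed

text \<open>Reduction modulo \<open>T\<close> in every coordinate. The finite set of representatives
  bounds \<open>h\<close>, and it is the window into which the members of a minimizing sequence are
  moved.\<close>

lemma fundamental_domain: "\<exists>D. finite D \<and> (\<forall>x. \<exists>z. period z \<and> x - z \<in> D)"
proof -
  obtain T :: nat where T: "T > 0" "\<And>x i. h (x + axis i (int T)) = h x" using h_periodic by blast
  let ?D = "vec_lambda ` (PiE UNIV (\<lambda>_::'n. {0..<int T}))"
  have "finite ?D" by (intro finite_imageI finite_PiE) auto
  moreover have "\<exists>z. period z \<and> x - z \<in> ?D" for x :: "int ^ 'n"
  proof -
    define z where "z = (\<Sum>i\<in>UNIV. axis i (int T * (x $ i div int T)) :: int ^ 'n)"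
    have "period (axis i (int T))" for i using T(2) by (simp add: period_def)
    then have "period z" unfolding z_def by (intro period_sum period_axis_mult) auto
    moreover have zi: "z $ i = int T * (x $ i div int T)" for i by (simp add: z_def axis_def if_distrib cong: if_cong)
    have xi: "(x - z) $ i = x $ i mod int T" for i by (simp add: zi minus_mult_div_eq_mod)
    have "vec_nth (x - z) \<in> PiE UNIV (\<lambda>_::'n. {0..<int T})"
      using T(1) by (auto simp: xi simp del: vector_minus_component)
    then have "x - z \<in> ?D" by (metis image_eqI vec_nth_inverse)
    ultimately show ?thesis by blast
  qed
  ultimately show ?thesis by blast
qed

lemma h_bounded: "\<exists>c>0. \<forall>x. h x \<le> c"
proof -
  obtain D where D: "finite D" "\<And>x. \<exists>z. period z \<and> x - z \<in> D" using fundamental_domain by blast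
  have "h x \<le> (\<Sum>d\<in>D. h d) + 1" for x
  proof -
    obtain z where z: "period z" "x - z \<in> D" using D(2) by blast
    have "h x = h (x - z)" using z(1) unfolding period_def by (metis diff_add_cancel)
    also have "\<dots> \<le> (\<Sum>d\<in>D. h d)" using z D(1) h_nonneg by (intro member_le_sum) auto
    finally show ?thesis by simp
  qed
  moreover have "0 < (\<Sum>d\<in>D. h d) + 1" by (intro add_nonneg_pos sum_nonneg h_nonneg) simp
  ultimately show ?thesis by blast
qed

definition hmax :: real where "hmax = (SOME c. 0 < c \<and> (\<forall>x. h x \<le> c))"

lemma hmax: "0 < hmax" "h x \<le> hmax"
  using someI_ex[of "\<lambda>c. 0 < c \<and> (\<forall>x. h x \<le> c)"] h_bounded unfolding hmax_def by auto

lemma l1_h_powr: "lp p u \<Longrightarrow> l1 (\<lambda>x. h x * \<bar>u x\<bar> powr p)"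
proof (rule l1_bound)
  assume "lp p u"
  then show "l1 (\<lambda>x. hmax * \<bar>u x\<bar> powr p)" by (simp add: lp_def)
  show "\<bar>h x * \<bar>u x\<bar> powr p\<bar> \<le> hmax * \<bar>u x\<bar> powr p" for x
    using h_nonneg[of x] hmax(2)[of x] by (simp add: abs_mult mult_right_mono)
qed

lemma H_space_iff: "u \<in> H_space p h \<longleftrightarrow> lp p u"
  using l1_h_powr[of u] W1p_iff_lp[of p u] p_ge_2 by (auto simp: H_space_def)

section \<open>Growth of the nonlinearity and its primitive\<close>

lemma primitive_deriv: "(F has_real_derivative f t) (at t)"
proof -
  \<comment> \<open>An interval that contains the base point \<open>0\<close> and has
    \<open>t\<close> in its interior, so that the derivative within it is the full
    derivative.\<close>
  let ?a = "- \<bar>t\<bar> - 1" and ?b = "\<bar>t\<bar> + 1"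
  have "((\<lambda>u. LBINT y = ereal 0..ereal u. f y) has_vector_derivative f t) (at t within {?a..?b})"
    by (rule interval_integral_FTC2) (auto intro: continuous_on_subset[OF f_cont])
  then have "(F has_real_derivative f t) (at t within {?a..?b})"
    by (simp add: has_real_derivative_iff_has_vector_derivative primitive_def[abs_def])
  moreover have "at t within {?a..?b} = at t" by (rule at_within_interior) (auto simp: abs_if)
  ultimately show ?thesis by simp
qed

lemma primitive_0 [simp]: "F 0 = 0"
  by (simp add: primitive_def)

lemma primitive_MVT:
  obtains z where "\<bar>z - t\<bar> \<le> \<bar>s - t\<bar>" "\<bar>z\<bar> \<le> max \<bar>s\<bar> \<bar>t\<bar>" "F s - F t = (s - t) * f z"
  by (rule MVT_between[OF primitive_deriv]) blast

lemma f_tendsto: "g \<longlonglongrightarrow> l \<Longrightarrow> (\<lambda>n. f (g n)) \<longlonglongrightarrow> f l"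
  by (rule continuous_on_tendsto_compose[OF f_cont]) simp_all

lemma primitive_tendsto: "g \<longlonglongrightarrow> l \<Longrightarrow> (\<lambda>n. F (g n)) \<longlonglongrightarrow> F l"
  by (rule isCont_tendsto_compose[OF DERIV_isCont[OF primitive_deriv]])

lemma f_small_eps:
  assumes "0 < e"
  obtains d where "0 < d" "\<And>t. \<bar>t\<bar> \<le> d \<Longrightarrow> \<bar>f t\<bar> \<le> e * \<bar>t\<bar> powr (p - 1)"
proof -
  have "eventually (\<lambda>t. \<bar>f t\<bar> \<le> e * \<bar>t\<bar> powr (p - 1)) (at 0)" using landau_o.smallD[OF f_small assms] by simp
  then have "\<exists>d>0. \<forall>t. t \<noteq> 0 \<longrightarrow> \<bar>t\<bar> < d \<longrightarrow> \<bar>f t\<bar> \<le> e * \<bar>t\<bar> powr (p - 1)"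
    by (simp add: eventually_at dist_real_def imp_conjL)
  then obtain d where d: "d > 0" "\<And>t. t \<noteq> 0 \<Longrightarrow> \<bar>t\<bar> < d \<Longrightarrow> \<bar>f t\<bar> \<le> e * \<bar>t\<bar> powr (p - 1)" by blast
  \<comment> \<open>The Landau symbol speaks of a punctured neighbourhood; the value at
    \<open>0\<close> has to come from continuity.\<close>
  have f0: "f 0 = 0"
  proof -
    have "((\<lambda>t::real. \<bar>t\<bar> powr (p - 1)) \<longlongrightarrow> 0 powr (p - 1)) (at 0)"
      by (rule tendsto_powr'[OF tendsto_rabs_zero[OF tendsto_ident_at] tendsto_const]) (use p_ge_2 in simp)
    from tendsto_mult[OF tendsto_const this, of e]
    have "((\<lambda>t. e * \<bar>t\<bar> powr (p - 1)) \<longlongrightarrow> e * 0 powr (p - 1)) (at (0::real))" .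
    then have "((\<lambda>t. e * \<bar>t\<bar> powr (p - 1)) \<longlongrightarrow> 0) (at (0::real))" by simp
    then have "(f \<longlongrightarrow> 0) (at 0)" by (rule Lim_null_comparison[rotated]) (use landau_o.smallD[OF f_small assms] in simp)
    moreover have "(f \<longlongrightarrow> f 0) (at 0)" using f_cont by (simp add: continuous_on_eq_continuous_at isCont_def)
    ultimately show ?thesis using LIM_unique[of f 0 0 "f 0"] by simp
  qed
  have "\<bar>f t\<bar> \<le> e * \<bar>t\<bar> powr (p - 1)" if "\<bar>t\<bar> \<le> d / 2" for t
  proof (cases "t = 0")
    case True
    then show ?thesis by (simp add: f0)
  next
    case False
    have "\<bar>t\<bar> < d" using that d(1) by linarith
    with False show ?thesis by (rule d(2))
  qed
  moreover have "0 < d / 2" using d(1) by simp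
  ultimately show ?thesis using that by blast
qed

abbreviation (input) growth :: "real \<Rightarrow> real \<Rightarrow> bool" where
  "growth C M \<equiv> \<forall>t. \<bar>t\<bar> \<le> M \<longrightarrow> \<bar>f t\<bar> \<le> C * \<bar>t\<bar> powr (p - 1)"

text \<open>Smallness handles the arguments near \<open>0\<close> with constant \<open>1\<close>; on
  the remaining ones compactness bounds \<open>f\<close> by \<open>b\<close>, and
  \<open>d powr (p - 1)\<close> is a lower bound for the power. The constant depends on
  \<open>M\<close>, which is harmless because l^p functions are bounded.\<close>

lemma f_growth: "\<exists>C>0. growth C M"
proof -
  obtain d where d: "0 < d" "\<And>t. \<bar>t\<bar> \<le> d \<Longrightarrow> \<bar>f t\<bar> \<le> 1 * \<bar>t\<bar> powr (p - 1)" by (rule f_small_eps[OF zero_less_one]) blast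
  have "compact (f ` {-M..M})" by (intro compact_continuous_image continuous_on_subset[OF f_cont]) auto
  then have "\<exists>b>0. \<forall>y\<in>f ` {-M..M}. norm y \<le> b" unfolding bounded_pos[symmetric] by (rule compact_imp_bounded)
  then obtain b where b: "b > 0" "\<forall>y\<in>f ` {-M..M}. norm y \<le> b" by blast
  let ?C = "b / d powr (p - 1) + 1"
  have "\<bar>f t\<bar> \<le> ?C * \<bar>t\<bar> powr (p - 1)" if "\<bar>t\<bar> \<le> M" for t
  proof (cases "\<bar>t\<bar> \<le> d")
    case True
    have "1 * \<bar>t\<bar> powr (p - 1) \<le> ?C * \<bar>t\<bar> powr (p - 1)" using b(1) d(1) by (intro mult_right_mono) auto
    then show ?thesis using d(2)[OF True] by linarith
  next
    case False
    have "\<bar>f t\<bar> \<le> b / d powr (p - 1) * d powr (p - 1)" using b(2) that d(1) by (simp add: abs_le_iff)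
    also have "\<dots> \<le> ?C * \<bar>t\<bar> powr (p - 1)" using False b(1) d(1) p_ge_2 by (intro mult_mono powr_mono2) auto
    finally show ?thesis .
  qed
  moreover have "0 < ?C" using b(1) by (simp add: add_nonneg_pos)
  ultimately show ?thesis by (intro exI[of _ ?C] conjI allI impI)
qed

lemma primitive_diff_le:
  assumes C: "0 < C" "growth C M" and m: "\<bar>s\<bar> \<le> m" "\<bar>t\<bar> \<le> m" "m \<le> M"
  shows "\<bar>F s - F t\<bar> \<le> C * (\<bar>s - t\<bar> * m powr (p - 1))"
proof -
  obtain z where z: "\<bar>z\<bar> \<le> max \<bar>s\<bar> \<bar>t\<bar>" "F s - F t = (s - t) * f z" by (rule primitive_MVT[of t s])
  have zm: "\<bar>z\<bar> \<le> m" using z m by linarith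
  then have "\<bar>f z\<bar> \<le> C * \<bar>z\<bar> powr (p - 1)" using C m by auto
  also have "\<dots> \<le> C * m powr (p - 1)" using C zm p_ge_2 by (intro mult_left_mono powr_mono2) auto
  finally have fz: "\<bar>f z\<bar> \<le> C * m powr (p - 1)" .
  have "\<bar>F s - F t\<bar> = \<bar>s - t\<bar> * \<bar>f z\<bar>" by (simp only: z(2) abs_mult)
  also have "\<dots> \<le> \<bar>s - t\<bar> * (C * m powr (p - 1))" by (rule mult_left_mono[OF fz abs_ge_zero])
  also have "\<dots> = C * (\<bar>s - t\<bar> * m powr (p - 1))" by (rule mult.left_commute)
  finally show ?thesis .
qed

lemma primitive_le:
  assumes C: "0 < C" "growth C M" and t: "\<bar>t\<bar> \<le> M"
  shows "\<bar>F t\<bar> \<le> C * \<bar>t\<bar> powr p"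
proof -
  have "\<bar>F t - F 0\<bar> \<le> C * (\<bar>t - 0\<bar> * \<bar>t\<bar> powr (p - 1))" using t by (intro primitive_diff_le[OF C]) auto
  also have "\<bar>t - 0\<bar> * \<bar>t\<bar> powr (p - 1) = \<bar>t\<bar> powr p"
    by (simp only: diff_zero mult.commute[of "\<bar>t\<bar>"] powr_minus_one_mult[OF abs_ge_zero])
  finally show ?thesis by simp
qed

lemma f_mult_le:
  assumes C: "0 < C" "growth C M" and t: "\<bar>t\<bar> \<le> M" "\<bar>t\<bar> \<le> w" "\<bar>s\<bar> \<le> w"
  shows "\<bar>f t * s\<bar> \<le> C * w powr p"
proof -
  have w: "0 \<le> w" using t by linarith
  have "\<bar>f t\<bar> * \<bar>s\<bar> \<le> (C * \<bar>t\<bar> powr (p - 1)) * w" using C t w by (intro mult_mono) auto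
  also have "\<dots> \<le> (C * w powr (p - 1)) * w"
    using C t w p_ge_2 by (intro mult_right_mono mult_left_mono powr_mono2) auto
  also have "\<dots> = C * w powr p" using powr_minus_one_mult[OF w, of p] by (simp add: mult.assoc)
  finally show ?thesis by (simp add: abs_mult)
qed

text \<open>The counterpart of \<open>powr_split_le\<close> for the primitive: the argument of
  smaller modulus is the perturbation.\<close>

lemma primitive_split_le:
  assumes C: "0 < C" "growth C M" and M: "\<bar>a\<bar> + \<bar>b\<bar> \<le> M"
  shows "\<bar>F (a + b) - F a - F b\<bar> \<le> 2 * C * err p \<bar>a\<bar> \<bar>b\<bar>"
proof -
  have *: "\<bar>F (a + b) - F a - F b\<bar> \<le> 2 * C * (\<bar>b\<bar> * (\<bar>a\<bar> + \<bar>b\<bar>) powr (p - 1))"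
    if "\<bar>a\<bar> + \<bar>b\<bar> \<le> M" for a b
  proof -
    have "\<bar>F (a + b) - F a\<bar> \<le> C * (\<bar>a + b - a\<bar> * (\<bar>a\<bar> + \<bar>b\<bar>) powr (p - 1))"
      by (rule primitive_diff_le[OF C abs_triangle_ineq _ that]) simp
    moreover have "\<bar>F b - F 0\<bar> \<le> C * (\<bar>b - 0\<bar> * (\<bar>a\<bar> + \<bar>b\<bar>) powr (p - 1))"
      by (rule primitive_diff_le[OF C _ _ that]) simp_all
    ultimately show ?thesis by (simp only: primitive_0 diff_zero add_diff_cancel_left') linarith
  qed
  show ?thesis
  proof (cases "\<bar>a\<bar> \<le> \<bar>b\<bar>")
    case True
    have "F (b + a) - F b - F a = F (a + b) - F a - F b" by (simp add: add.commute[of b a])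
    then show ?thesis using *[of b a] M True by (simp only: min_absorb1 add.commute[of "\<bar>b\<bar>" "\<bar>a\<bar>"])
  next
    case False
    then show ?thesis using *[of a b] M by (simp only: min_absorb2 linear not_le less_imp_le)
  qed
qed

section \<open>The energy functional\<close>

definition dens :: "(int ^ 'n \<Rightarrow> real) \<Rightarrow> int ^ 'n \<Rightarrow> real" where
  "dens u x = grad_norm u x powr p + h x * \<bar>u x\<bar> powr p"

definition Np :: "(int ^ 'n \<Rightarrow> real) \<Rightarrow> real" where
  "Np u = lsum (dens u)"

text \<open>The derivative of half the form \<open>B\<close> at \<open>u\<close> in the direction
  \<open>u\<close>; the Nehari condition reads \<open>Np u = A u\<close>.\<close>

definition A :: "(int ^ 'n \<Rightarrow> real) \<Rightarrow> real" where
  "A u = green_form \<alpha> (\<lambda>x. F (u x)) (\<lambda>x. f (u x) * u x)"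

definition B :: "(int ^ 'n \<Rightarrow> real) \<Rightarrow> real" where
  "B u = green_form \<alpha> (\<lambda>x. F (u x)) (\<lambda>x. F (u x))"

definition J :: "(int ^ 'n \<Rightarrow> real) \<Rightarrow> real" where
  "J u = Np u / p - B u / 2"

lemma p0: "0 \<le> p" and p1: "1 \<le> p" and p_pos: "0 < p"
  using p_ge_2 by auto

lemma dens_nonneg: "0 \<le> dens u x"
  by (simp add: dens_def h_nonneg)

lemma Np_nonneg: "0 \<le> Np u"
  unfolding Np_def by (intro Bochner_Integration.integral_nonneg dens_nonneg)

lemma l1_grad: "lp p u \<Longrightarrow> l1 (\<lambda>x. grad_norm u x powr p)"
  using lp_D[OF lp_grad_norm[of p u]] p0 by simp

lemma l1_dens: "lp p u \<Longrightarrow> l1 (dens u)"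
  unfolding dens_def[abs_def] by (intro l1_add l1_grad l1_h_powr)

lemma energy_eq: "energy p \<alpha> h f u = J u"
proof -
  have "H_norm p h u powr p = Np u"
    using p_ge_2 Np_nonneg[of u] by (simp add: H_norm_def powr_powr Np_def dens_def[abs_def])
  then show ?thesis by (simp add: energy_def J_def B_def green_form_def)
qed

lemma dens_scale: "dens (\<lambda>x. c * u x) x = \<bar>c\<bar> powr p * dens u x"
  by (simp add: dens_def grad_norm_scale abs_mult powr_mult distrib_left)

lemma Np_scale: "Np (\<lambda>x. c * u x) = \<bar>c\<bar> powr p * Np u"
  by (simp add: Np_def dens_scale[abs_def])

lemma lsum_powr_le: "lp p u \<Longrightarrow> hmin * lsum (\<lambda>x. \<bar>u x\<bar> powr p) \<le> Np u"
proof -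
  assume u: "lp p u"
  have "lsum (\<lambda>x. hmin * \<bar>u x\<bar> powr p) \<le> Np u" unfolding Np_def
  proof (rule lsum_mono_bound[OF l1_dens[OF u]])
    show "0 \<le> hmin * \<bar>u x\<bar> powr p" for x using hmin(1) by simp
    show "hmin * \<bar>u x\<bar> powr p \<le> dens u x" for x
      unfolding dens_def by (intro add_increasing mult_right_mono hmin(2)) auto
  qed
  then show ?thesis by simp
qed

lemma lsum_grad_le: "lp p u \<Longrightarrow> lsum (\<lambda>x. grad_norm u x powr p) \<le> Np u"
  unfolding Np_def by (intro lsum_mono_bound[OF l1_dens]) (auto simp: dens_def h_nonneg)

lemma Np_pos:
  assumes "lp p u" "u \<noteq> (\<lambda>_. 0)" shows "0 < Np u"
proof -
  obtain x where "u x \<noteq> 0" using assms(2) by auto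
  then have "0 < \<bar>u x\<bar> powr p" by simp
  also have "\<dots> \<le> lsum (\<lambda>x. \<bar>u x\<bar> powr p)" by (rule point_le_lsum[OF lp_D[OF assms(1)]]) simp
  finally have "0 < hmin * lsum (\<lambda>x. \<bar>u x\<bar> powr p)" using hmin(1) by simp
  then show ?thesis using lsum_powr_le[OF assms(1)] by linarith
qed

text \<open>A pointwise envelope also controls the gradients, through its sum over the
  neighbours.\<close>

lemma Np_tendsto:
  fixes u :: "nat \<Rightarrow> int ^ 'n \<Rightarrow> real"
  assumes W: "lp p W" and le: "\<And>n x. \<bar>u n x\<bar> \<le> \<bar>W x\<bar>" and lim: "\<And>x. (\<lambda>n. u n x) \<longlonglongrightarrow> v x"
  shows "(\<lambda>n. Np (u n)) \<longlonglongrightarrow> Np v" unfolding Np_def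
proof (rule lsum_dominated_convergence)
  let ?G = "\<lambda>x. \<Sum>e\<in>nbrs 0. \<bar>W (x + e)\<bar> + \<bar>W x\<bar>"
  show "l1 (\<lambda>x. \<bar>?G x\<bar> powr p + hmax * \<bar>W x\<bar> powr p)" using lp_D[OF lp_nbr_sum[OF W p0]] lp_D[OF W] by simp
  show "\<bar>dens (u n) x\<bar> \<le> \<bar>?G x\<bar> powr p + hmax * \<bar>W x\<bar> powr p" for n x
  proof -
    have "grad_norm (u n) x \<le> ?G x" by (rule order_trans[OF grad_norm_le_sum]) (intro sum_mono add_mono le)
    then have "grad_norm (u n) x powr p \<le> \<bar>?G x\<bar> powr p"
      using p0 by (intro powr_mono2) (auto intro: order_trans[OF _ abs_ge_self])
    moreover have "h x * \<bar>u n x\<bar> powr p \<le> hmax * \<bar>W x\<bar> powr p"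
      using p0 le hmax h_nonneg by (intro mult_mono powr_mono2) (auto intro: less_imp_le)
    ultimately show ?thesis using dens_nonneg[of "u n" x] by (simp add: dens_def)
  qed
  show "(\<lambda>n. dens (u n) x) \<longlonglongrightarrow> dens v x" for x unfolding dens_def using p_pos
    by (intro tendsto_add tendsto_mult tendsto_const tendsto_powr'[OF grad_norm_tendsto[OF lim] tendsto_const]
        tendsto_powr'[OF tendsto_rabs[OF lim] tendsto_const]) auto
qed

text \<open>An envelope in l^p is bounded, so a single growth constant serves all arguments below
  it. These are the dominations behind every limit under the nonlinear terms.\<close>

lemma nonlinear_bounds:
  fixes W :: "int ^ 'n \<Rightarrow> real"
  assumes W: "lp p W"
  obtains C where "0 < C" "\<And>x t. \<bar>t\<bar> \<le> \<bar>W x\<bar> \<Longrightarrow> \<bar>F t\<bar> \<le> C * \<bar>W x\<bar> powr p"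
    "\<And>x s t. \<bar>t\<bar> \<le> \<bar>W x\<bar> \<Longrightarrow> \<bar>s\<bar> \<le> \<bar>W x\<bar> \<Longrightarrow> \<bar>f t * s\<bar> \<le> C * \<bar>W x\<bar> powr p"
    "\<And>x s t. \<bar>s\<bar> \<le> \<bar>W x\<bar> \<Longrightarrow> \<bar>t\<bar> \<le> \<bar>W x\<bar> \<Longrightarrow> \<bar>F s - F t\<bar> \<le> C * (\<bar>s - t\<bar> * \<bar>W x\<bar> powr (p - 1))"
proof -
  obtain M where M: "0 < M" "\<And>x. \<bar>W x\<bar> \<le> M" using lp_bounded[OF W p_pos] by metis
  obtain C where C: "0 < C" "growth C M" using f_growth[of M] by metis
  have 1: "\<bar>F t\<bar> \<le> C * \<bar>W x\<bar> powr p" if "\<bar>t\<bar> \<le> \<bar>W x\<bar>" for x t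
  proof -
    have "\<bar>F t\<bar> \<le> C * \<bar>t\<bar> powr p" by (rule primitive_le[OF C order_trans[OF that M(2)]])
    also have "\<dots> \<le> C * \<bar>W x\<bar> powr p" using C(1) that p0 by (intro mult_left_mono powr_mono2) auto
    finally show ?thesis .
  qed
  have 2: "\<bar>f t * s\<bar> \<le> C * \<bar>W x\<bar> powr p" if "\<bar>t\<bar> \<le> \<bar>W x\<bar>" "\<bar>s\<bar> \<le> \<bar>W x\<bar>" for x s t
    by (rule f_mult_le[OF C order_trans[OF that(1) M(2)] that])
  have 3: "\<bar>F s - F t\<bar> \<le> C * (\<bar>s - t\<bar> * \<bar>W x\<bar> powr (p - 1))" if "\<bar>s\<bar> \<le> \<bar>W x\<bar>" "\<bar>t\<bar> \<le> \<bar>W x\<bar>" for x s t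
    by (rule primitive_diff_le[OF C that M(2)])
  show ?thesis by (rule that[OF C(1) 1 2 3])
qed

lemma l1_F: "lp p u \<Longrightarrow> l1 (\<lambda>x. F (u x))" for u :: "int ^ 'n \<Rightarrow> real"
proof -
  assume u: "lp p u"
  obtain C where "\<And>x t. \<bar>t\<bar> \<le> \<bar>u x\<bar> \<Longrightarrow> \<bar>F t\<bar> \<le> C * \<bar>u x\<bar> powr p" using nonlinear_bounds[OF u] by metis
  then show ?thesis by (intro l1_bound[OF integrable_mult_right[OF lp_D[OF u]]]) auto
qed

lemma lp_dominating:
  assumes "lp p u" "lp p v" obtains W where "lp p W" "\<And>x. \<bar>u x\<bar> \<le> \<bar>W x\<bar>" "\<And>x. \<bar>v x\<bar> \<le> \<bar>W x\<bar>"
proof (rule that[of "\<lambda>x. \<bar>u x\<bar> + \<bar>v x\<bar>"])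
  show "lp p (\<lambda>x. \<bar>u x\<bar> + \<bar>v x\<bar>)" using assms p0 by (intro lp_add) (simp_all add: lp_abs)
qed auto

lemma l1_f:
  fixes u \<phi> :: "int ^ 'n \<Rightarrow> real"
  assumes "lp p u" "lp p \<phi>" shows "l1 (\<lambda>x. f (u x) * \<phi> x)"
proof -
  obtain W where W: "lp p W" "\<And>x. \<bar>u x\<bar> \<le> \<bar>W x\<bar>" "\<And>x. \<bar>\<phi> x\<bar> \<le> \<bar>W x\<bar>" using lp_dominating[OF assms] by metis
  obtain C where C: "\<And>x s t. \<bar>t\<bar> \<le> \<bar>W x\<bar> \<Longrightarrow> \<bar>s\<bar> \<le> \<bar>W x\<bar> \<Longrightarrow> \<bar>f t * s\<bar> \<le> C * \<bar>W x\<bar> powr p"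
    using nonlinear_bounds[OF W(1)] by metis
  show ?thesis by (rule l1_bound[OF integrable_mult_right[OF lp_D[OF W(1)]] C[OF W(2,3)]])
qed

lemma form_Ff_tendsto:
  fixes u \<phi> :: "nat \<Rightarrow> int ^ 'n \<Rightarrow> real"
  assumes W: "lp p W" and u: "\<And>n x. \<bar>u n x\<bar> \<le> \<bar>W x\<bar>" "\<And>x. (\<lambda>n. u n x) \<longlonglongrightarrow> v x"
    and \<phi>: "\<And>n x. \<bar>\<phi> n x\<bar> \<le> \<bar>W x\<bar>" "\<And>x. (\<lambda>n. \<phi> n x) \<longlonglongrightarrow> \<psi> x"
  shows "(\<lambda>n. green_form \<alpha> (\<lambda>x. F (u n x)) (\<lambda>x. f (u n x) * \<phi> n x)) \<longlonglongrightarrow>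
    green_form \<alpha> (\<lambda>x. F (v x)) (\<lambda>x. f (v x) * \<psi> x)"
proof -
  obtain C where C: "\<And>x t. \<bar>t\<bar> \<le> \<bar>W x\<bar> \<Longrightarrow> \<bar>F t\<bar> \<le> C * \<bar>W x\<bar> powr p"
    "\<And>x s t. \<bar>t\<bar> \<le> \<bar>W x\<bar> \<Longrightarrow> \<bar>s\<bar> \<le> \<bar>W x\<bar> \<Longrightarrow> \<bar>f t * s\<bar> \<le> C * \<bar>W x\<bar> powr p" using nonlinear_bounds[OF W] by metis
  have w: "l1 (\<lambda>x. C * \<bar>W x\<bar> powr p)" using lp_D[OF W] by simp
  show ?thesis by (rule green_form_tendsto[OF w C(1)[OF u(1)] primitive_tendsto[OF u(2)] w C(2)[OF u(1) \<phi>(1)]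
          tendsto_mult[OF f_tendsto[OF u(2)] \<phi>(2)]])
qed

lemma A_tendsto:
  fixes u :: "nat \<Rightarrow> int ^ 'n \<Rightarrow> real"
  assumes "lp p W" "\<And>n x. \<bar>u n x\<bar> \<le> \<bar>W x\<bar>" "\<And>x. (\<lambda>n. u n x) \<longlonglongrightarrow> v x"
  shows "(\<lambda>n. A (u n)) \<longlonglongrightarrow> A v" unfolding A_def by (rule form_Ff_tendsto[OF assms assms(2,3)])

lemma B_tendsto:
  fixes u :: "nat \<Rightarrow> int ^ 'n \<Rightarrow> real"
  assumes W: "lp p W" and u: "\<And>n x. \<bar>u n x\<bar> \<le> \<bar>W x\<bar>" "\<And>x. (\<lambda>n. u n x) \<longlonglongrightarrow> v x"
  shows "(\<lambda>n. B (u n)) \<longlonglongrightarrow> B v"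
proof -
  obtain C where C: "\<And>x t. \<bar>t\<bar> \<le> \<bar>W x\<bar> \<Longrightarrow> \<bar>F t\<bar> \<le> C * \<bar>W x\<bar> powr p" using nonlinear_bounds[OF W] by metis
  have w: "l1 (\<lambda>x. C * \<bar>W x\<bar> powr p)" using lp_D[OF W] by simp
  show ?thesis unfolding B_def
    by (rule green_form_tendsto[OF w C[OF u(1)] primitive_tendsto[OF u(2)] w C[OF u(1)] primitive_tendsto[OF u(2)]])
qed

text \<open>Both points move, because the comparison on perturbed rays differentiates at a base
  point that itself depends on \<open>n\<close>. By symmetry the difference of the two quadratic
  values is the form applied to the difference and the sum of the primitives; divided by
  \<open>e n\<close>, the difference tends to \<open>f (u x) * \<psi> x\<close> by the mean value
  theorem.\<close>

lemma B_quotient: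
  fixes a b \<phi> :: "nat \<Rightarrow> int ^ 'n \<Rightarrow> real"
  assumes W: "lp p W" and a: "\<And>n x. \<bar>a n x\<bar> \<le> \<bar>W x\<bar>" "\<And>x. (\<lambda>n. a n x) \<longlonglongrightarrow> u x"
    and b: "\<And>n x. \<bar>b n x\<bar> \<le> \<bar>W x\<bar>" "\<And>x. (\<lambda>n. b n x) \<longlonglongrightarrow> u x"
    and \<phi>: "\<And>n x. \<bar>\<phi> n x\<bar> \<le> \<bar>W x\<bar>" "\<And>x. (\<lambda>n. \<phi> n x) \<longlonglongrightarrow> \<psi> x"
    and e: "\<And>n. e n \<noteq> 0" "\<And>n x. a n x - b n x = e n * \<phi> n x"
  shows "(\<lambda>n. (B (a n) - B (b n)) / e n) \<longlonglongrightarrow> 2 * green_form \<alpha> (\<lambda>x. F (u x)) (\<lambda>x. f (u x) * \<psi> x)"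
proof -
  obtain C where C: "0 < C" "\<And>x t. \<bar>t\<bar> \<le> \<bar>W x\<bar> \<Longrightarrow> \<bar>F t\<bar> \<le> C * \<bar>W x\<bar> powr p"
    "\<And>x s t. \<bar>s\<bar> \<le> \<bar>W x\<bar> \<Longrightarrow> \<bar>t\<bar> \<le> \<bar>W x\<bar> \<Longrightarrow> \<bar>F s - F t\<bar> \<le> C * (\<bar>s - t\<bar> * \<bar>W x\<bar> powr (p - 1))"
    using nonlinear_bounds[OF W] by metis
  define q where "q n x = (F (a n x) - F (b n x)) / e n" for n x
  define s where "s n x = F (a n x) + F (b n x)" for n x
  have w: "l1 (\<lambda>x. C * \<bar>W x\<bar> powr p)" and w2: "l1 (\<lambda>x. 2 * (C * \<bar>W x\<bar> powr p))" using lp_D[OF W] by auto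
  have qb: "\<bar>q n x\<bar> \<le> C * \<bar>W x\<bar> powr p" for n x
  proof -
    have "\<bar>q n x\<bar> \<le> C * (\<bar>e n * \<phi> n x\<bar> * \<bar>W x\<bar> powr (p - 1)) / \<bar>e n\<bar>" unfolding q_def abs_divide e(2)[symmetric]
      by (rule divide_right_mono[OF C(3)[OF a(1)[of n x] b(1)[of n x]] abs_ge_zero])
    also have "\<dots> = C * (\<bar>W x\<bar> powr (p - 1) * \<bar>\<phi> n x\<bar>)" using e(1)[of n] by (simp add: abs_mult)
    also have "\<dots> \<le> C * (\<bar>W x\<bar> powr (p - 1) * \<bar>W x\<bar>)" using C(1) \<phi>(1) by (intro mult_left_mono) auto
    also have "\<dots> = C * \<bar>W x\<bar> powr p" by (simp only: powr_minus_one_mult[OF abs_ge_zero])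
    finally show ?thesis .
  qed
  have sb: "\<bar>s n x\<bar> \<le> 2 * (C * \<bar>W x\<bar> powr p)" for n x
    unfolding s_def using C(2)[OF a(1), of n x] C(2)[OF b(1), of n x] by linarith
  have sl: "(\<lambda>n. s n x) \<longlonglongrightarrow> 2 * F (u x)" for x
    using tendsto_add[OF primitive_tendsto[OF a(2)[of x]] primitive_tendsto[OF b(2)[of x]]] by (simp add: s_def)
  have ql: "(\<lambda>n. q n x) \<longlonglongrightarrow> f (u x) * \<psi> x" for x
  proof -
    have "\<exists>z. \<forall>n. \<bar>z n - b n x\<bar> \<le> \<bar>a n x - b n x\<bar> \<and> F (a n x) - F (b n x) = (a n x - b n x) * f (z n)"
      by (rule choice) (metis primitive_MVT)
    then obtain z where z: "\<And>n. \<bar>z n - b n x\<bar> \<le> \<bar>a n x - b n x\<bar>" "\<And>n. F (a n x) - F (b n x) = (a n x - b n x) * f (z n)"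
      by blast
    have d: "(\<lambda>n. \<bar>a n x - b n x\<bar>) \<longlonglongrightarrow> 0" using tendsto_rabs[OF tendsto_diff[OF a(2) b(2)], of x x] by simp
    have "(\<lambda>n. z n - b n x) \<longlonglongrightarrow> 0" by (rule Lim_null_comparison[OF _ d]) (use z(1) in simp)
    from tendsto_add[OF this b(2)[of x]] have "z \<longlonglongrightarrow> u x" by simp
    from tendsto_mult[OF f_tendsto[OF this] \<phi>(2)[of x]]
    have "(\<lambda>n. f (z n) * \<phi> n x) \<longlonglongrightarrow> f (u x) * \<psi> x" .
    moreover have "f (z n) * \<phi> n x = q n x" for n unfolding q_def z(2) e(2) using e(1)[of n] by simp
    ultimately show ?thesis by simp
  qed
  have lim: "(\<lambda>n. green_form \<alpha> (q n) (s n)) \<longlonglongrightarrow> green_form \<alpha> (\<lambda>x. f (u x) * \<psi> x) (\<lambda>x. 2 * F (u x))"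
    by (rule green_form_tendsto[OF w qb ql w2 sb sl])
  have l1a: "l1 (\<lambda>x. F (a n x))" and l1b: "l1 (\<lambda>x. F (b n x))" for n by (rule l1_F[OF lp_bound[OF W _ p0]], rule a b)+
  have id: "(B (a n) - B (b n)) / e n = green_form \<alpha> (q n) (s n)" for n
  proof -
    have qe: "q n = (\<lambda>x. inverse (e n) * (F (a n x) + (- 1) * F (b n x)))" by (simp add: q_def[abs_def] field_simps)
    have m: "l1 (\<lambda>x. (- 1) * F (b n x))" using l1b[of n] by simp
    have d: "l1 (\<lambda>x. F (a n x) + (- 1) * F (b n x))" using l1a m by (rule l1_add)
    have "green_form \<alpha> (q n) (s n) = inverse (e n) * (green_form \<alpha> (\<lambda>x. F (a n x) + (- 1) * F (b n x)) (\<lambda>x. F (a n x))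
        + green_form \<alpha> (\<lambda>x. F (a n x) + (- 1) * F (b n x)) (\<lambda>x. F (b n x)))"
      unfolding qe s_def[abs_def] green_form_scale_left green_form_add_right[OF d l1a l1b] ..
    also have "\<dots> = inverse (e n) * (B (a n) - B (b n))"
      unfolding green_form_add_left[OF l1a m l1a] green_form_add_left[OF l1a m l1b] green_form_scale_left
      using green_form_sym[OF l1a[of n] l1b[of n], of \<alpha>] by (simp add: B_def)
    finally show ?thesis by (simp add: field_simps)
  qed
  have u: "lp p u"
  proof (rule lp_bound[OF W _ p0])
    show "\<bar>u x\<bar> \<le> \<bar>W x\<bar>" for x by (rule LIMSEQ_le_const2[OF tendsto_rabs[OF a(2)]]) (use a(1) in blast)
  qed
  have \<psi>: "lp p \<psi>"
  proof (rule lp_bound[OF W _ p0])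
    show "\<bar>\<psi> x\<bar> \<le> \<bar>W x\<bar>" for x by (rule LIMSEQ_le_const2[OF tendsto_rabs[OF \<phi>(2)]]) (use \<phi>(1) in blast)
  qed
  have "green_form \<alpha> (\<lambda>x. f (u x) * \<psi> x) (\<lambda>x. 2 * F (u x)) = 2 * green_form \<alpha> (\<lambda>x. F (u x)) (\<lambda>x. f (u x) * \<psi> x)"
    unfolding green_form_scale_right using green_form_sym[OF l1_f[OF u \<psi>] l1_F[OF u], of \<alpha>] by simp
  with lim show ?thesis unfolding id by simp
qed

end

section \<open>Rays and the Nehari manifold\<close>

lemma grad_norm_diff_le: "\<bar>grad_norm (\<lambda>x. u x + v x) x - grad_norm u x\<bar> \<le> grad_norm v x"
proof -
  have m: "grad_norm (\<lambda>x. (- 1) * v x) x = grad_norm v x" by (subst grad_norm_scale) simp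
  have "grad_norm u x = grad_norm (\<lambda>x. (u x + v x) + (- 1) * v x) x" by simp
  also have "\<dots> \<le> grad_norm (\<lambda>x. u x + v x) x + grad_norm v x"
    using grad_norm_triangle[of "\<lambda>x. u x + v x" "\<lambda>x. (- 1) * v x" x] unfolding m .
  finally show ?thesis using grad_norm_triangle[of u v x] by linarith
qed

lemma rpow_mult_self:
  assumes "0 \<le> a" shows "rpow a (p - 2) * (a * a) = a powr p"
proof (cases "p = 2")
  case True
  then show ?thesis using assms by (simp add: rpow_def powr_numeral power2_eq_square)
next
  case False
  have "rpow a (p - 2) * (a * a) = (a powr (p - 1 - 1) * a) * a" using False by (simp add: rpow_def)
  also have "\<dots> = a powr p" by (simp only: powr_minus_one_mult[OF assms])
  finally show ?thesis .
qed

context choquard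
begin

text \<open>The local part of the derivative of the energy, that is, \<open>1 / p\<close> times the
  derivative of \<open>Np\<close> at \<open>u\<close> in the direction
  \<open>\<phi>\<close>.\<close>

definition E1 :: "(int ^ 'n \<Rightarrow> real) \<Rightarrow> (int ^ 'n \<Rightarrow> real) \<Rightarrow> real" where
  "E1 u \<phi> = lsum (\<lambda>x. rpow (grad_norm u x) (p - 2) * grad_prod u \<phi> x + h x * rpow \<bar>u x\<bar> (p - 2) * u x * \<phi> x)"

lemma energy_deriv_eq:
  "energy_deriv p \<alpha> h f u \<phi> = E1 u \<phi> - green_form \<alpha> (\<lambda>x. F (u x)) (\<lambda>x. f (u x) * \<phi> x)"
  unfolding energy_deriv_def E1_def green_form_def by (simp only: mult.assoc)

lemma E1_self: "E1 u u = Np u"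
proof -
  have "rpow (grad_norm u x) (p - 2) * grad_prod u u x + h x * rpow \<bar>u x\<bar> (p - 2) * u x * u x = dens u x" for x
  proof -
    have 1: "rpow (grad_norm u x) (p - 2) * grad_prod u u x = grad_norm u x powr p"
      unfolding grad_prod_self power2_eq_square by (rule rpow_mult_self) simp
    have "rpow \<bar>u x\<bar> (p - 2) * (\<bar>u x\<bar> * \<bar>u x\<bar>) = \<bar>u x\<bar> powr p" by (rule rpow_mult_self) simp
    then have 2: "rpow \<bar>u x\<bar> (p - 2) * (u x * u x) = \<bar>u x\<bar> powr p" by simp
    show ?thesis unfolding dens_def 1 by (simp only: mult.assoc 2)
  qed
  then show ?thesis unfolding E1_def Np_def by simp
qed

lemma E1_uminus: "E1 u (\<lambda>x. - \<phi> x) = - E1 u \<phi>"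
proof -
  have "grad_prod u (\<lambda>x. - \<phi> x) x = - grad_prod u \<phi> x" for x
  proof -
    have "(u y - u x) * (- \<phi> y - - \<phi> x) = - ((u y - u x) * (\<phi> y - \<phi> x))" for y by (simp add: algebra_simps)
    then show ?thesis unfolding grad_prod_def by (simp add: sum_negf)
  qed
  then have "E1 u (\<lambda>x. - \<phi> x) = lsum (\<lambda>x. - (rpow (grad_norm u x) (p - 2) * grad_prod u \<phi> x + h x * rpow \<bar>u x\<bar> (p - 2) * u x * \<phi> x))"
    unfolding E1_def by (intro Bochner_Integration.integral_cong refl) simp
  then show ?thesis unfolding E1_def by (simp only: Bochner_Integration.integral_minus)
qed

abbreviation (input) nehari_set :: "(int ^ 'n \<Rightarrow> real) set" ("\<N>") where
  "\<N> \<equiv> nehari p \<alpha> h f"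

lemma nehari_iff: "v \<in> \<N> \<longleftrightarrow> lp p v \<and> v \<noteq> (\<lambda>_. 0) \<and> Np v = A v"
  unfolding nehari_def by (auto simp: H_space_iff energy_deriv_eq E1_self A_def)

lemma dens_deriv:
  "((\<lambda>e. dens (\<lambda>y. u y + e * \<phi> y) x) has_real_derivative
     p * (rpow (grad_norm u x) (p - 2) * grad_prod u \<phi> x + h x * rpow \<bar>u x\<bar> (p - 2) * u x * \<phi> x)) (at 0)"
proof -
  let ?q = "\<lambda>e::real. 1 / 2 * (\<Sum>y\<in>nbrs x. ((u y + e * \<phi> y) - (u x + e * \<phi> x))\<^sup>2)"
  have q: "(?q has_real_derivative 2 * grad_prod u \<phi> x) (at 0)"
  proof -
    have "(?q has_real_derivative 1 / 2 * (\<Sum>y\<in>nbrs x. 2 * ((u y + 0 * \<phi> y) - (u x + 0 * \<phi> x)) * (\<phi> y - \<phi> x))) (at 0)"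
      by (intro DERIV_cmult DERIV_sum) (auto intro!: derivative_eq_intros)
    moreover have "1 / 2 * (\<Sum>y\<in>nbrs x. 2 * ((u y + 0 * \<phi> y) - (u x + 0 * \<phi> x)) * (\<phi> y - \<phi> x)) = 2 * grad_prod u \<phi> x"
      unfolding grad_prod_def sum_distrib_left by (intro sum.cong refl) simp
    ultimately show ?thesis by (simp only:)
  qed
  have 1: "((\<lambda>e. grad_norm (\<lambda>y. u y + e * \<phi> y) x powr p) has_real_derivative
      p / 2 * rpow (sqrt (?q 0)) (p - 2) * (2 * grad_prod u \<phi> x)) (at 0)"
    unfolding grad_norm_def by (rule DERIV_sqrt_powr[OF q _ p_ge_2]) (simp add: sum_nonneg)
  \<comment> \<open>The modulus is the root of a square, so the zero-order term follows the same
    pattern as the gradient term.\<close>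
  have q2: "((\<lambda>e::real. (u x + e * \<phi> x)\<^sup>2) has_real_derivative 2 * (u x * \<phi> x)) (at 0)"
    by (auto intro!: derivative_eq_intros)
  have 2: "((\<lambda>e. sqrt ((u x + e * \<phi> x)\<^sup>2) powr p) has_real_derivative
      p / 2 * rpow (sqrt ((u x + 0 * \<phi> x)\<^sup>2)) (p - 2) * (2 * (u x * \<phi> x))) (at 0)"
    by (rule DERIV_sqrt_powr[OF q2 _ p_ge_2]) simp
  have g: "sqrt (?q 0) = grad_norm u x" by (simp add: grad_norm_def)
  from DERIV_add[OF 1 DERIV_cmult[OF 2, of "h x"]] show ?thesis unfolding dens_def g by (simp add: algebra_simps)
qed

lemma Np_quotient:
  fixes u \<phi> :: "int ^ 'n \<Rightarrow> real"
  assumes u: "lp p u" and \<phi>: "lp p \<phi>" and e: "\<And>n. e n \<noteq> 0" "\<And>n. \<bar>e n\<bar> \<le> 1" "e \<longlonglongrightarrow> 0"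
  shows "(\<lambda>n. (Np (\<lambda>x. u x + e n * \<phi> x) - Np u) / e n) \<longlonglongrightarrow> p * E1 u \<phi>"
proof -
  define q where "q n x = (dens (\<lambda>y. u y + e n * \<phi> y) x - dens u x) / e n" for n x
  \<comment> \<open>A difference of powers is at most the increment times a power of a common upper
    bound for the bases. The increment carries the factor \<open>e n\<close>, which cancels, and
    because of \<open>\<bar>e n\<bar> \<le> 1\<close> the bases have a bound independent of
    \<open>n\<close>.\<close>
  define w where "w x = p * ((grad_norm u x + grad_norm \<phi> x) powr (p - 1) * grad_norm \<phi> x)
     + hmax * (p * ((\<bar>u x\<bar> + \<bar>\<phi> x\<bar>) powr (p - 1) * \<bar>\<phi> x\<bar>))" for x
  have w: "l1 w"
  proof -
    have "l1 (\<lambda>x. \<bar>grad_norm u x + grad_norm \<phi> x\<bar> powr (p - 1) * \<bar>grad_norm \<phi> x\<bar>)"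
      by (intro lp_powr_mult lp_add lp_grad_norm u \<phi> p0 p1)
    moreover have "l1 (\<lambda>x. \<bar>\<bar>u x\<bar> + \<bar>\<phi> x\<bar>\<bar> powr (p - 1) * \<bar>\<phi> x\<bar>)"
      using u \<phi> by (intro lp_powr_mult lp_add p0 p1) (simp_all add: lp_abs)
    ultimately show ?thesis unfolding w_def[abs_def] by simp
  qed
  have qb: "\<bar>q n x\<bar> \<le> w x" for n x
  proof -
    let ?v = "\<lambda>y. u y + e n * \<phi> y"
    have eg: "\<bar>e n\<bar> * grad_norm \<phi> x \<le> grad_norm \<phi> x" and ef: "\<bar>e n\<bar> * \<bar>\<phi> x\<bar> \<le> \<bar>\<phi> x\<bar>"
      using e(2)[of n] by (auto intro: mult_left_le_one_le)
    have d: "\<bar>grad_norm ?v x - grad_norm u x\<bar> \<le> \<bar>e n\<bar> * grad_norm \<phi> x"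
      using grad_norm_diff_le[of u "\<lambda>y. e n * \<phi> y" x] by (simp add: grad_norm_scale)
    have 1: "\<bar>grad_norm ?v x powr p - grad_norm u x powr p\<bar> \<le>
        p * (\<bar>e n\<bar> * grad_norm \<phi> x) * (grad_norm u x + grad_norm \<phi> x) powr (p - 1)"
      by (rule powr_diff_le[OF _ _ p1 d]) (use d eg in \<open>auto simp: abs_le_iff\<close>)
    have d2: "\<bar>\<bar>?v x\<bar> - \<bar>u x\<bar>\<bar> \<le> \<bar>e n\<bar> * \<bar>\<phi> x\<bar>" using abs_triangle_ineq3[of "?v x" "u x"] by (simp add: abs_mult)
    have 2: "\<bar>\<bar>?v x\<bar> powr p - \<bar>u x\<bar> powr p\<bar> \<le> p * (\<bar>e n\<bar> * \<bar>\<phi> x\<bar>) * (\<bar>u x\<bar> + \<bar>\<phi> x\<bar>) powr (p - 1)"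
      by (rule powr_diff_le[OF _ _ p1 d2]) (use d2 ef in \<open>linarith+\<close>)
    have "h x * \<bar>\<bar>?v x\<bar> powr p - \<bar>u x\<bar> powr p\<bar> \<le>
        hmax * (p * (\<bar>e n\<bar> * \<bar>\<phi> x\<bar>) * (\<bar>u x\<bar> + \<bar>\<phi> x\<bar>) powr (p - 1))"
      by (intro mult_mono hmax(2) 2 less_imp_le[OF hmax(1)]) simp
    moreover have "\<bar>h x * \<bar>?v x\<bar> powr p - h x * \<bar>u x\<bar> powr p\<bar> = h x * \<bar>\<bar>?v x\<bar> powr p - \<bar>u x\<bar> powr p\<bar>"
      using h_nonneg[of x] by (simp add: right_diff_distrib[symmetric] abs_mult)
    ultimately have 3: "\<bar>h x * \<bar>?v x\<bar> powr p - h x * \<bar>u x\<bar> powr p\<bar> \<le>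
        hmax * (p * (\<bar>e n\<bar> * \<bar>\<phi> x\<bar>) * (\<bar>u x\<bar> + \<bar>\<phi> x\<bar>) powr (p - 1))" by simp
    have "\<bar>dens ?v x - dens u x\<bar> \<le> p * (\<bar>e n\<bar> * grad_norm \<phi> x) * (grad_norm u x + grad_norm \<phi> x) powr (p - 1)
        + hmax * (p * (\<bar>e n\<bar> * \<bar>\<phi> x\<bar>) * (\<bar>u x\<bar> + \<bar>\<phi> x\<bar>) powr (p - 1))"
      unfolding dens_def by (rule order_trans[OF abs_diff_triangle_ineq add_mono[OF 1 3]])
    also have "\<dots> = w x * \<bar>e n\<bar>" by (simp add: w_def algebra_simps)
    finally show ?thesis using e(1)[of n] by (simp add: q_def abs_divide divide_le_eq)
  qed
  have "(\<lambda>n. lsum (q n)) \<longlonglongrightarrow> lsum (\<lambda>x. p * (rpow (grad_norm u x) (p - 2) * grad_prod u \<phi> x + h x * rpow \<bar>u x\<bar> (p - 2) * u x * \<phi> x))"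
  proof (rule lsum_dominated_convergence[OF w qb])
    fix x
    from DERIV_at_0_seq[OF dens_deriv e(1) e(3), of u \<phi> x]
    show "(\<lambda>n. q n x) \<longlonglongrightarrow> p * (rpow (grad_norm u x) (p - 2) * grad_prod u \<phi> x + h x * rpow \<bar>u x\<bar> (p - 2) * u x * \<phi> x)"
      by (simp add: q_def)
  qed
  moreover have "lsum (q n) = (Np (\<lambda>x. u x + e n * \<phi> x) - Np u) / e n" for n
  proof -
    have "l1 (dens (\<lambda>x. u x + e n * \<phi> x))" by (intro l1_dens lp_add lp_scale u \<phi> p0)
    then show ?thesis unfolding q_def[abs_def] Np_def using l1_dens[OF u] by simp
  qed
  ultimately show ?thesis by (simp add: E1_def)
qed

text \<open>The quotient of the monotonicity hypothesis. Since it is normalized by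
  \<open>t powr p\<close>, the derivative of the energy along the ray is
  \<open>t powr (p - 1) * (Np u - t * rho u t)\<close>, with an extra factor \<open>t\<close> beside
  the monotone term.\<close>

definition rho :: "(int ^ 'n \<Rightarrow> real) \<Rightarrow> real \<Rightarrow> real" where
  "rho u t = 1 / t powr p * green_form \<alpha> (\<lambda>x. F (t * u x)) (\<lambda>x. f (t * u x) * u x)"

lemma rho_mono:
  assumes "lp p u" "u \<noteq> (\<lambda>_. 0)" "0 < s" "s < t"
  shows "rho u s < rho u t"
proof -
  have "strict_mono_on {0<..} (rho u)"
    using nonlinearity_mono assms(1,2) by (simp add: H_space_iff rho_def[abs_def] green_form_def mult.assoc)
  then show ?thesis using assms(3,4) by (auto simp: strict_mono_on_def)
qed

lemma form_ray: "t > 0 \<Longrightarrow> green_form \<alpha> (\<lambda>x. F (t * u x)) (\<lambda>x. f (t * u x) * u x) = t powr p * rho u t"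
  by (simp add: rho_def)

lemma A_ray: "t > 0 \<Longrightarrow> A (\<lambda>x. t * u x) = t powr p * (t * rho u t)"
  using form_ray[of t u] green_form_scale_right[of \<alpha> "\<lambda>x. F (t * u x)" t "\<lambda>x. f (t * u x) * u x"]
  by (simp add: A_def mult.left_commute)

text \<open>The arguments of the form are of order \<open>t powr p\<close> and
  \<open>t powr (p - 1)\<close>. After normalization the second power remains, and it is at most
  \<open>t\<close> on the unit interval because \<open>p \<ge> 2\<close>.\<close>

lemma rho_small:
  assumes u: "lp p u"
  obtains c where "0 < c" "\<And>t. 0 < t \<Longrightarrow> t \<le> 1 \<Longrightarrow> \<bar>rho u t\<bar> \<le> c * t"
proof -
  obtain M where M: "0 < M" "\<And>x. \<bar>u x\<bar> \<le> M" using lp_bounded[OF u p_pos] by metis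
  obtain C where C: "0 < C" "growth C M" using f_growth[of M] by metis
  let ?K = "green_bound TYPE('n) \<alpha>" let ?S = "lsum (\<lambda>x. \<bar>u x\<bar> powr p)"
  have K: "0 < ?K" by (rule green_bound_pos)
  have S: "0 \<le> ?S" by simp
  let ?c = "?K * (C * ?S) * (C * ?S)"
  have c0: "0 \<le> ?c" using K C(1) S by simp
  have "\<bar>rho u t\<bar> \<le> ?c * t" if t: "0 < t" "t \<le> 1" for t
  proof -
    have tu: "\<bar>t * u x\<bar> \<le> M" for x using mult_mono[OF t(2) M(2)[of x]] t by (simp add: abs_mult)
    have Fb: "\<bar>F (t * u x)\<bar> \<le> C * t powr p * \<bar>u x\<bar> powr p" for x
      using primitive_le[OF C tu[of x]] t by (simp add: abs_mult powr_mult mult.assoc)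
    have fb: "\<bar>f (t * u x) * u x\<bar> \<le> C * t powr (p - 1) * \<bar>u x\<bar> powr p" for x
    proof -
      have "\<bar>f (t * u x)\<bar> \<le> C * \<bar>t * u x\<bar> powr (p - 1)" by (rule C(2)[rule_format, OF tu])
      then have "\<bar>f (t * u x)\<bar> * \<bar>u x\<bar> \<le> C * \<bar>t * u x\<bar> powr (p - 1) * \<bar>u x\<bar>" by (rule mult_right_mono) simp
      also have "\<dots> = C * t powr (p - 1) * (\<bar>u x\<bar> powr (p - 1) * \<bar>u x\<bar>)" using t by (simp add: abs_mult powr_mult)
      also have "\<dots> = C * t powr (p - 1) * \<bar>u x\<bar> powr p" by (simp only: powr_minus_one_mult[OF abs_ge_zero])
      finally show ?thesis by (simp add: abs_mult)
    qed
    note 1 = lsum_abs_le[OF lp_D[OF u] Fb] and 2 = lsum_abs_le[OF lp_D[OF u] fb]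
    have "\<bar>green_form \<alpha> (\<lambda>x. F (t * u x)) (\<lambda>x. f (t * u x) * u x)\<bar> \<le>
        ?K * lsum (\<lambda>x. \<bar>F (t * u x)\<bar>) * lsum (\<lambda>x. \<bar>f (t * u x) * u x\<bar>)"
      by (intro green_form_bound l1_F l1_f lp_scale u)
    also have "\<dots> \<le> ?K * (C * t powr p * ?S) * (C * t powr (p - 1) * ?S)"
      using K C(1) S by (intro mult_mono 1 2 order_refl mult_nonneg_nonneg) (simp_all add: less_imp_le)
    also have "\<dots> = t powr p * (?c * t powr (p - 1))" by (simp only: mult_ac)
    finally have "t powr p * \<bar>rho u t\<bar> \<le> t powr p * (?c * t powr (p - 1))"
      unfolding form_ray[OF t(1)] by (simp only: abs_mult abs_of_nonneg[OF powr_ge_zero])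
    then have "\<bar>rho u t\<bar> \<le> ?c * t powr (p - 1)" using t by simp
    also have "\<dots> \<le> ?c * t powr 1" using t p_ge_2 c0 by (intro mult_left_mono powr_mono') auto
    finally show ?thesis using t by simp
  qed
  then have le: "\<bar>rho u t\<bar> \<le> (?c + 1) * t" if "0 < t" "t \<le> 1" for t
    by (rule order_trans) (use that in \<open>simp_all add: distrib_right\<close>)
  have "0 < ?c + 1" using c0 by simp
  then show ?thesis by (rule that[OF _ le])
qed

text \<open>A strictly increasing function with limit \<open>0\<close> at \<open>0\<close> is
  positive.\<close>

lemma rho_pos:
  assumes u: "lp p u" "u \<noteq> (\<lambda>_. 0)" and t: "0 < t"
  shows "0 < rho u t"
proof -
  obtain c where c: "0 < c" "\<And>t. 0 < t \<Longrightarrow> t \<le> 1 \<Longrightarrow> \<bar>rho u t\<bar> \<le> c * t" using rho_small[OF u(1)] by metis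
  have "0 \<le> rho u (t / 2)"
  proof (rule ccontr)
    assume "\<not> 0 \<le> rho u (t / 2)"
    then have neg: "rho u (t / 2) < 0" by simp
    \<comment> \<open>So small that \<open>rho u s\<close> cannot lie below
      \<open>rho u (t / 2)\<close>, while \<open>s < t / 2\<close> demands that it does.\<close>
    define s where "s = min (min 1 (t / 4)) (- rho u (t / 2) / c)"
    have "0 < - rho u (t / 2) / c" using neg c(1) by (intro divide_pos_pos) auto
    then have "0 < s" using t by (simp add: s_def)
    moreover have "s \<le> 1" "s \<le> t / 4" "s \<le> - rho u (t / 2) / c" unfolding s_def by linarith+
    ultimately have s: "0 < s" "s \<le> 1" "s < t / 2" "s \<le> - rho u (t / 2) / c" using t by auto
    have "c * s \<le> - rho u (t / 2)" using s(4) c(1) by (simp only: pos_le_divide_eq mult.commute)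
    then have "rho u (t / 2) \<le> rho u s" "- (c * s) \<le> rho u s" using c(2)[OF s(1,2)] by linarith+
    moreover have "rho u s < rho u (t / 2)" by (rule rho_mono[OF u s(1,3)])
    ultimately show False by linarith
  qed
  also have "rho u (t / 2) < rho u t" using t by (intro rho_mono[OF u]) auto
  finally show ?thesis .
qed

lemma ray_dominated:
  assumes u: "lp p u" and X: "X \<longlonglongrightarrow> t"
  obtains W where "lp p W" "\<And>n x. \<bar>X n * u x\<bar> \<le> \<bar>W x\<bar>" "\<And>x. \<bar>u x\<bar> \<le> \<bar>W x\<bar>"
    "\<And>x. \<bar>t * u x\<bar> \<le> \<bar>W x\<bar>" "\<And>x. (\<lambda>n. X n * u x) \<longlonglongrightarrow> t * u x"
proof -
  obtain K where K: "0 < K" "\<forall>n. norm (X n) \<le> K" using convergent_imp_Bseq[OF convergentI[OF X]] by (rule BseqE)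
  let ?W = "\<lambda>x. (K + 1 + \<bar>t\<bar>) * u x"
  show ?thesis
  proof (rule that[of ?W])
    show "lp p ?W" by (rule lp_scale[OF u])
    have w: "\<bar>c * u x\<bar> \<le> \<bar>?W x\<bar>" if "\<bar>c\<bar> \<le> K + 1 + \<bar>t\<bar>" for c x
    proof -
      have "\<bar>c\<bar> * \<bar>u x\<bar> \<le> \<bar>K + 1 + \<bar>t\<bar>\<bar> * \<bar>u x\<bar>" by (rule mult_right_mono[OF order_trans[OF that abs_ge_self] abs_ge_zero])
      then show ?thesis by (simp only: abs_mult)
    qed
    show "\<bar>X n * u x\<bar> \<le> \<bar>?W x\<bar>" for n x
    proof (rule w)
      show "\<bar>X n\<bar> \<le> K + 1 + \<bar>t\<bar>" using K(2)[rule_format, of n] by simp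
    qed
    show "\<bar>u x\<bar> \<le> \<bar>?W x\<bar>" for x using w[of 1 x] K(1) by simp
    show "\<bar>t * u x\<bar> \<le> \<bar>?W x\<bar>" for x using K(1) by (intro w) simp
    show "(\<lambda>n. X n * u x) \<longlonglongrightarrow> t * u x" for x by (intro tendsto_mult X tendsto_const)
  qed
qed

lemma rho_continuous:
  assumes u: "lp p u" and t: "0 < t"
  shows "isCont (rho u) t" unfolding isCont_def tendsto_at_iff_sequentially comp_def
proof (intro allI impI)
  fix X :: "nat \<Rightarrow> real" assume X: "X \<longlonglongrightarrow> t"
  obtain W where W: "lp p W" "\<And>n x. \<bar>X n * u x\<bar> \<le> \<bar>W x\<bar>" "\<And>x. \<bar>u x\<bar> \<le> \<bar>W x\<bar>"
    "\<And>x. (\<lambda>n. X n * u x) \<longlonglongrightarrow> t * u x" using ray_dominated[OF u X] by metis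
  have "(\<lambda>n. 1 / X n powr p) \<longlonglongrightarrow> 1 / t powr p"
    using t by (intro tendsto_divide tendsto_const tendsto_powr'[OF X tendsto_const]) auto
  then show "(\<lambda>n. rho u (X n)) \<longlonglongrightarrow> rho u t"
    unfolding rho_def by (rule tendsto_mult) (rule form_Ff_tendsto[OF W(1,2,4,3) tendsto_const])
qed

lemma B_ray_continuous:
  assumes u: "lp p u"
  shows "continuous_on S (\<lambda>t. B (\<lambda>x. t * u x))" unfolding continuous_on_def tendsto_at_iff_sequentially comp_def
proof (intro ballI allI impI)
  fix t and X :: "nat \<Rightarrow> real" assume X: "X \<longlonglongrightarrow> t"
  obtain W where W: "lp p W" "\<And>n x. \<bar>X n * u x\<bar> \<le> \<bar>W x\<bar>" "\<And>x. (\<lambda>n. X n * u x) \<longlonglongrightarrow> t * u x" using ray_dominated[OF u X] by metis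
  show "(\<lambda>n. B (\<lambda>x. X n * u x)) \<longlonglongrightarrow> B (\<lambda>x. t * u x)" by (rule B_tendsto[OF W])
qed

lemma J_ray_continuous:
  assumes u: "lp p u"
  shows "continuous_on S (\<lambda>t. J (\<lambda>x. t * u x))" unfolding J_def Np_scale using p_pos
  by (intro continuous_on_diff continuous_on_divide continuous_on_mult continuous_on_const continuous_on_powr'
      continuous_on_rabs continuous_on_id B_ray_continuous[OF u]) auto

lemma B_ray_deriv:
  assumes u: "lp p u" and t: "0 < t"
  shows "((\<lambda>t. B (\<lambda>x. t * u x)) has_real_derivative 2 * (t powr p * rho u t)) (at t)"
  unfolding has_field_derivative_iff tendsto_at_iff_sequentially comp_def
proof (intro allI impI)
  fix X :: "nat \<Rightarrow> real" assume X: "\<forall>i. X i \<in> UNIV - {t}" "X \<longlonglongrightarrow> t"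
  obtain W where W: "lp p W" "\<And>n x. \<bar>X n * u x\<bar> \<le> \<bar>W x\<bar>" "\<And>x. \<bar>u x\<bar> \<le> \<bar>W x\<bar>"
    "\<And>x. \<bar>t * u x\<bar> \<le> \<bar>W x\<bar>" "\<And>x. (\<lambda>n. X n * u x) \<longlonglongrightarrow> t * u x" using ray_dominated[OF u X(2)] by metis
  have "(\<lambda>n. (B (\<lambda>x. X n * u x) - B (\<lambda>x. t * u x)) / (X n - t)) \<longlonglongrightarrow>
      2 * green_form \<alpha> (\<lambda>x. F (t * u x)) (\<lambda>x. f (t * u x) * u x)"
  proof (rule B_quotient[where \<phi> = "\<lambda>n. u" and b = "\<lambda>n x. t * u x", OF W(1,2,5,4) tendsto_const W(3) tendsto_const])
    show "X n - t \<noteq> 0" for n using X(1) by simp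
    show "X n * u x - t * u x = (X n - t) * u x" for n x by (simp add: left_diff_distrib)
  qed
  then show "(\<lambda>n. (B (\<lambda>x. X n * u x) - B (\<lambda>x. t * u x)) / (X n - t)) \<longlonglongrightarrow> 2 * (t powr p * rho u t)"
    by (simp only: form_ray[OF t])
qed

lemma J_ray_deriv:
  assumes u: "lp p u" and t: "0 < t"
  shows "((\<lambda>t. J (\<lambda>x. t * u x)) has_real_derivative t powr (p - 1) * (Np u - t * rho u t)) (at t)"
proof -
  have tp: "t powr p = t powr (p - 1) * t" using t by (simp only: powr_minus_one_mult[OF less_imp_le])
  have 1: "((\<lambda>t. t powr p * Np u / p - B (\<lambda>x. t * u x) / 2) has_real_derivative
      p * t powr (p - 1) * Np u / p - 2 * (t powr p * rho u t) / 2) (at t)"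
    using t by (intro DERIV_diff DERIV_cdivide B_ray_deriv[OF u] DERIV_cmult_right has_real_derivative_powr)
  have 2: "p * t powr (p - 1) * Np u / p - 2 * (t powr p * rho u t) / 2 = t powr (p - 1) * (Np u - t * rho u t)"
    using p_pos unfolding tp by (simp add: right_diff_distrib)
  have 3: "t powr p * Np u / p - B (\<lambda>x. t * u x) / 2 = J (\<lambda>x. t * u x)" if "t \<in> {0<..}" for t
    using that by (simp add: J_def Np_scale)
  show ?thesis
    by (rule has_field_derivative_transform_within_open[OF 1[unfolded 2] open_greaterThan _ 3]) (use t in simp_all)
qed

lemma ray_mem_lp: "lp p u \<Longrightarrow> u \<noteq> (\<lambda>_. 0) \<Longrightarrow> t \<noteq> 0 \<Longrightarrow> lp p (\<lambda>x. t * u x) \<and> (\<lambda>x. t * u x) \<noteq> (\<lambda>_. 0)"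
  by (auto simp: lp_scale fun_eq_iff)

lemma nehari_ray_iff:
  assumes u: "lp p u" "u \<noteq> (\<lambda>_. 0)" and t: "0 < t"
  shows "(\<lambda>x. t * u x) \<in> \<N> \<longleftrightarrow> Np u = t * rho u t"
  using ray_mem_lp[OF u, of t] t by (simp add: nehari_iff Np_scale A_ray)

lemma ray_rho_mono:
  assumes u: "lp p u" "u \<noteq> (\<lambda>_. 0)" and t: "0 < s" "s < t"
  shows "s * rho u s < t * rho u t" using rho_mono[OF u t] rho_pos[OF u t(1)] t by (intro mult_strict_mono) auto

text \<open>The function \<open>t * rho u t\<close> vanishes at \<open>0\<close> and, beyond
  \<open>1\<close>, is at least \<open>t * rho u 1\<close> by monotonicity; so it crosses the
  positive value \<open>Np u\<close>. The bracket \<open>a\<close>, \<open>b\<close> makes these two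
  bounds explicit.\<close>

lemma nehari_ray_exists:
  assumes u: "lp p u" "u \<noteq> (\<lambda>_. 0)"
  obtains s where "0 < s" "(\<lambda>x. s * u x) \<in> \<N>"
proof -
  have N: "0 < Np u" by (rule Np_pos[OF u])
  obtain c where c: "0 < c" "\<And>t. 0 < t \<Longrightarrow> t \<le> 1 \<Longrightarrow> \<bar>rho u t\<bar> \<le> c * t" using rho_small[OF u(1)] by metis
  define a where "a = min 1 (Np u / c)"
  have a: "0 < a" "a \<le> 1" "a \<le> Np u / c" using N c(1) by (auto simp: a_def)
  have ca: "c * a \<le> Np u" using a(3) c(1) by (simp add: pos_le_divide_eq mult.commute)
  have "a * rho u a \<le> 1 * (c * a)" using c(2)[OF a(1,2)] a rho_pos[OF u a(1)] by (intro mult_mono) auto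
  then have lo: "a * rho u a \<le> Np u" using ca by linarith
  have r1: "0 < rho u 1" by (rule rho_pos[OF u]) simp
  define b where "b = max 1 (Np u / rho u 1)"
  have b: "1 \<le> b" "Np u / rho u 1 \<le> b" by (auto simp: b_def)
  have "Np u \<le> b * rho u 1" using b(2) r1 by (simp add: pos_divide_le_eq)
  also have "\<dots> \<le> b * rho u b" using b(1) rho_mono[OF u, of 1 b] by (cases "b = 1") (auto intro!: mult_left_mono)
  finally have hi: "Np u \<le> b * rho u b" .
  have "continuous_on {a..b} (\<lambda>t. t * rho u t)"
    using a(1) by (intro continuous_on_mult continuous_on_id continuous_at_imp_continuous_on ballI rho_continuous[OF u(1)]) auto
  then obtain s where s: "a \<le> s" "s \<le> b" "s * rho u s = Np u"
    using IVT'[of "\<lambda>t. t * rho u t" a "Np u" b] lo hi a b by auto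
  have s0: "0 < s" using s(1) a(1) by linarith
  show ?thesis by (rule that[OF s0]) (use nehari_ray_iff[OF u s0] s(3) in simp)
qed

text \<open>The derivative formula holds for positive \<open>t\<close> only; the endpoint
  \<open>a = 0\<close>, where the energy is \<open>0\<close>, is reached by continuity.\<close>

lemma J_ray_increasing:
  assumes u: "lp p u" "u \<noteq> (\<lambda>_. 0)" and s: "0 < s" "(\<lambda>x. s * u x) \<in> \<N>" and ab: "0 \<le> a" "a < b" "b \<le> s"
  shows "J (\<lambda>x. a * u x) < J (\<lambda>x. b * u x)"
proof (rule DERIV_pos_imp_increasing_open[OF ab(2)])
  have Ns: "Np u = s * rho u s" using s nehari_ray_iff[OF u s(1)] by simp
  fix t assume t: "a < t" "t < b"
  then have t0: "0 < t" "t < s" using ab by auto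
  have "0 < t powr (p - 1) * (Np u - t * rho u t)" using ray_rho_mono[OF u t0] t0 by (simp add: Ns)
  with J_ray_deriv[OF u(1) t0(1)]
  show "\<exists>y. ((\<lambda>t. J (\<lambda>x. t * u x)) has_real_derivative y) (at t) \<and> 0 < y" by blast
qed (rule J_ray_continuous[OF u(1)])

lemma J_ray_decreasing:
  assumes u: "lp p u" "u \<noteq> (\<lambda>_. 0)" and s: "0 < s" "(\<lambda>x. s * u x) \<in> \<N>" and ab: "s \<le> a" "a < b"
  shows "J (\<lambda>x. b * u x) < J (\<lambda>x. a * u x)"
proof (rule DERIV_neg_imp_decreasing_open[OF ab(2)])
  have Ns: "Np u = s * rho u s" using s nehari_ray_iff[OF u s(1)] by simp
  fix t assume t: "a < t" "t < b"
  then have t0: "0 < t" "s < t" using ab s by auto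
  have "t powr (p - 1) * (Np u - t * rho u t) < 0"
    using ray_rho_mono[OF u s(1) t0(2)] t0 by (intro mult_pos_neg) (auto simp: Ns)
  with J_ray_deriv[OF u(1) t0(1)]
  show "\<exists>y. ((\<lambda>t. J (\<lambda>x. t * u x)) has_real_derivative y) (at t) \<and> y < 0" by blast
qed (rule J_ray_continuous[OF u(1)])

lemma nehari_lp: "u \<in> \<N> \<Longrightarrow> lp p u" and nehari_nonzero: "u \<in> \<N> \<Longrightarrow> u \<noteq> (\<lambda>_. 0)"
  by (auto simp: nehari_iff)

lemma J_ray_max:
  assumes u: "u \<in> \<N>" and t: "0 \<le> t"
  shows "J (\<lambda>x. t * u x) \<le> J u"
proof -
  have n: "(\<lambda>x. 1 * u x) \<in> \<N>" using u by simp
  consider "t < 1" | "t = 1" | "1 < t" by linarith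
  then show ?thesis
  proof cases
    case 1
    from J_ray_increasing[OF nehari_lp[OF u] nehari_nonzero[OF u] zero_less_one n t 1] show ?thesis by simp
  next
    case 2
    then show ?thesis by simp
  next
    case 3
    from J_ray_decreasing[OF nehari_lp[OF u] nehari_nonzero[OF u] zero_less_one n order_refl 3] show ?thesis by simp
  qed
qed

lemma J_zero: "J (\<lambda>_. 0) = 0" and B_zero: "B (\<lambda>_. 0) = 0"
proof -
  show "B (\<lambda>_. 0) = 0" by (simp add: B_def green_form_def)
  moreover have "Np (\<lambda>_. 0) = 0" by (simp add: Np_def dens_def[abs_def] grad_norm_def)
  ultimately show "J (\<lambda>_. 0) = 0" by (simp add: J_def)
qed

text \<open>
  Along the ray, \<open>B\<close> has derivative \<open>2 * t powr p * rho u t\<close> with \<open>rho u\<close> increasing; integrating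
  up to \<open>t = 1\<close> gives \<open>B u \<le> 2 * Np u / (p + 1)\<close>.
\<close>

lemma J_coercive:
  assumes u: "u \<in> \<N>"
  shows "(1 / p - 1 / (p + 1)) * Np u \<le> J u"
proof -
  note l = nehari_lp[OF u] and nz = nehari_nonzero[OF u]
  have N: "Np u = rho u 1" using nehari_ray_iff[OF l nz, of 1] u by simp
  \<comment> \<open>The derivative is \<open>2 * t powr p * (rho u 1 - rho u t)\<close>; showing
    that \<open>\<psi>\<close> increases takes the place of integrating the inequality.\<close>
  define \<psi> where "\<psi> t = 2 * rho u 1 / (p + 1) * t powr (p + 1) - B (\<lambda>x. t * u x)" for t
  have c: "continuous_on {0..1} \<psi>" unfolding \<psi>_def using p_pos
    by (intro continuous_on_diff continuous_on_mult continuous_on_const continuous_on_powr' continuous_on_id B_ray_continuous[OF l]) auto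
  have "\<psi> 0 < \<psi> 1"
  proof (rule DERIV_pos_imp_increasing_open[OF zero_less_one _ c])
    fix t :: real assume t: "0 < t" "t < 1"
    have 1: "(\<psi> has_real_derivative 2 * rho u 1 / (p + 1) * ((p + 1) * t powr (p + 1 - 1)) - 2 * (t powr p * rho u t)) (at t)"
      unfolding \<psi>_def using t by (intro DERIV_diff B_ray_deriv[OF l] DERIV_cmult has_real_derivative_powr) auto
    have "2 * rho u 1 / (p + 1) * ((p + 1) * t powr (p + 1 - 1)) = 2 * rho u 1 * t powr p" using p_pos by simp
    then have "2 * rho u 1 / (p + 1) * ((p + 1) * t powr (p + 1 - 1)) - 2 * (t powr p * rho u t) = 2 * t powr p * (rho u 1 - rho u t)"
      by (simp only:) (simp add: algebra_simps)
    also have "0 < \<dots>" using rho_mono[OF l nz t] t by simp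
    finally show "\<exists>y. (\<psi> has_real_derivative y) (at t) \<and> 0 < y" using 1 by blast
  qed
  moreover have "\<psi> 0 = 0" using B_zero p_pos by (simp add: \<psi>_def)
  ultimately have "B u \<le> 2 * Np u / (p + 1)" by (simp add: \<psi>_def N)
  then have "B u / 2 \<le> Np u / (p + 1)" by (simp add: mult.commute)
  then show ?thesis by (simp add: J_def left_diff_distrib)
qed

lemma J_nehari_nonneg: "u \<in> \<N> \<Longrightarrow> 0 \<le> J u"
proof -
  assume u: "u \<in> \<N>"
  have "0 \<le> (1 / p - 1 / (p + 1)) * Np u"
    using Np_nonneg[of u] p_pos by (intro mult_nonneg_nonneg) (simp_all add: frac_le)
  then show ?thesis using J_coercive[OF u] by linarith
qed

text \<open>If \<open>u\<close> stayed below the smallness threshold of \<open>f\<close> everywhere,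
  then \<open>A u\<close> would be at most quadratic in the l^p sum with a tiny coefficient, hence
  less than \<open>Np u\<close>, which it has to equal. The threshold depends on \<open>M\<close>
  and not on \<open>u\<close>; this is what prevents a bounded sequence on the manifold from
  vanishing.\<close>

lemma nehari_peak:
  obtains d where "0 < d" "\<And>u. u \<in> \<N> \<Longrightarrow> lsum (\<lambda>x. \<bar>u x\<bar> powr p) \<le> M \<Longrightarrow> \<exists>x. d < \<bar>u x\<bar>"
proof -
  let ?K = "green_bound TYPE('n) \<alpha>"
  have K: "0 < ?K" by (rule green_bound_pos)
  define M' where "M' = max M 0"
  \<comment> \<open>The estimate of \<open>A u\<close> contains \<open>e * e\<close>. One factor is
    dropped by \<open>e \<le> 1\<close>; the other is chosen so that the whole is at most
    \<open>hmin / 2\<close> times the l^p sum, half of a lower bound for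
    \<open>Np u\<close>.\<close>
  define e where "e = min 1 (hmin / (2 * ?K * (M' + 1)))"
  have M': "0 \<le> M'" "M \<le> M'" by (auto simp: M'_def)
  have e: "0 < e" "e \<le> 1" using K M' hmin(1) by (auto simp: e_def)
  have "e \<le> hmin / (2 * ?K * (M' + 1))" by (simp add: e_def)
  then have "e * (2 * ?K * (M' + 1)) \<le> hmin" using K M' by (simp add: pos_le_divide_eq)
  moreover have "e * e * (2 * ?K * (M' + 1)) \<le> 1 * e * (2 * ?K * (M' + 1))"
    using e K M' by (intro mult_right_mono) auto
  ultimately have e2: "2 * ?K * e * e * (M' + 1) \<le> hmin" by (simp add: mult_ac)
  obtain d where d: "0 < d" "\<And>t. \<bar>t\<bar> \<le> d \<Longrightarrow> \<bar>f t\<bar> \<le> e * \<bar>t\<bar> powr (p - 1)" using f_small_eps[OF e(1)] by metis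
  have d': "\<forall>t. \<bar>t\<bar> \<le> d \<longrightarrow> \<bar>f t\<bar> \<le> e * \<bar>t\<bar> powr (p - 1)" using d(2) by blast
  have "\<exists>x. d < \<bar>u x\<bar>" if u: "u \<in> \<N>" "lsum (\<lambda>x. \<bar>u x\<bar> powr p) \<le> M" for u
  proof (rule ccontr)
    assume "\<nexists>x. d < \<bar>u x\<bar>"
    then have ud: "\<bar>u x\<bar> \<le> d" for x by (simp add: not_less)
    note l = nehari_lp[OF u(1)] and nz = nehari_nonzero[OF u(1)]
    let ?S = "lsum (\<lambda>x. \<bar>u x\<bar> powr p)"
    have S: "0 \<le> ?S" "?S \<le> M'" using u(2) M' by auto
    note 1 = lsum_abs_le[OF lp_D[OF l] primitive_le[OF e(1) d' ud]]
      and 2 = lsum_abs_le[OF lp_D[OF l] f_mult_le[OF e(1) d' ud order_refl order_refl]]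
    have "Np u = A u" using u(1) by (simp add: nehari_iff)
    also have "\<dots> \<le> \<bar>A u\<bar>" by (rule abs_ge_self)
    also have "\<bar>A u\<bar> \<le> ?K * lsum (\<lambda>x. \<bar>F (u x)\<bar>) * lsum (\<lambda>x. \<bar>f (u x) * u x\<bar>)"
      unfolding A_def by (rule green_form_bound[OF l1_F[OF l] l1_f[OF l l]])
    also have "\<dots> \<le> ?K * (e * ?S) * (e * ?S)"
      using K e(1) S(1) by (intro mult_mono 1 2 order_refl mult_nonneg_nonneg) (simp_all add: less_imp_le)
    also have "\<dots> = ?K * e * e * ?S * ?S" by (simp only: mult_ac)
    also have "\<dots> \<le> ?K * e * e * (M' + 1) * ?S" using K e(1) S by (intro mult_right_mono mult_left_mono) auto
    also have "\<dots> \<le> hmin / 2 * ?S" using e2 S(1) by (intro mult_right_mono) auto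
    also have "\<dots> \<le> Np u / 2" using lsum_powr_le[OF l] by simp
    finally have "Np u \<le> 0" by simp
    then show False using Np_pos[OF l nz] by simp
  qed
  then show ?thesis by (rule that[OF d(1)])
qed

section \<open>Minimizers on the Nehari manifold are critical\<close>

lemma perturbed_ray_bound:
  fixes a b t e :: real
  assumes "\<bar>t\<bar> \<le> 2" "\<bar>e\<bar> \<le> 1"
  shows "\<bar>t * (a + e * b)\<bar> \<le> \<bar>2 * (\<bar>a\<bar> + \<bar>b\<bar>)\<bar>"
proof -
  have "\<bar>e\<bar> * \<bar>b\<bar> \<le> \<bar>b\<bar>" using assms(2) by (intro mult_left_le_one_le) auto
  then have "\<bar>a + e * b\<bar> \<le> \<bar>a\<bar> + \<bar>b\<bar>" using abs_triangle_ineq[of a "e * b"] by (simp add: abs_mult)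
  then have "\<bar>t\<bar> * \<bar>a + e * b\<bar> \<le> 2 * (\<bar>a\<bar> + \<bar>b\<bar>)" using assms(1) by (intro mult_mono) auto
  then show ?thesis by (simp add: abs_mult)
qed

text \<open>For \<open>e = 0\<close> the pairing of the derivative at \<open>t * u\<close> with
  \<open>t * u\<close> changes sign strictly at \<open>t = 1\<close>. The signs at
  \<open>1 - d\<close> and \<open>1 + d\<close> persist for small \<open>e\<close>, and the
  intermediate value theorem in \<open>t\<close> yields a point of the manifold. It takes the place
  of the implicit function theorem, so \<open>t\<close> is not claimed to depend continuously on
  \<open>e\<close>.\<close>

lemma nehari_nearby:
  assumes u: "u \<in> \<N>" and \<phi>: "lp p \<phi>" and r: "0 < r"
  obtains e t where "0 < e" "e \<le> r" "\<bar>t - 1\<bar> \<le> r" "0 < t" "(\<lambda>x. t * (u x + e * \<phi> x)) \<in> \<N>"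
proof -
  note l = nehari_lp[OF u] and nz = nehari_nonzero[OF u]
  define d where "d = min (1 / 2) r"
  have d: "0 < d" "d \<le> 1 / 2" "d \<le> r" using r by (auto simp: d_def)
  define H where "H e t = Np (\<lambda>x. t * (u x + e * \<phi> x)) - A (\<lambda>x. t * (u x + e * \<phi> x))" for e t
  have N1: "Np u = 1 * rho u 1" using nehari_ray_iff[OF l nz, of 1] u by simp
  have H0: "H 0 t = t powr p * (Np u - t * rho u t)" if "0 < t" for t
    using that by (simp add: H_def Np_scale A_ray right_diff_distrib)
  have lo: "0 < H 0 (1 - d)" using ray_rho_mono[OF l nz, of "1 - d" 1] d by (subst H0) (simp_all add: N1)
  have "H 0 (1 + d) < 0"
    using ray_rho_mono[OF l nz, of 1 "1 + d"] d by (subst H0) (auto simp: N1 intro!: mult_pos_neg)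
  then have hi: "H 0 (1 + d) < 0" .
  have W: "lp p (\<lambda>x. 2 * (\<bar>u x\<bar> + \<bar>\<phi> x\<bar>))" using l \<phi> by (intro lp_scale lp_add p0) (simp_all add: lp_abs)
  have He: "(\<lambda>n. H (inverse (real (Suc n))) t) \<longlonglongrightarrow> H 0 t" if t: "\<bar>t\<bar> \<le> 2" for t
  proof -
    have e1: "\<bar>inverse (real (Suc n))\<bar> \<le> 1" for n by (simp add: inverse_le_1_iff)
    have lim: "(\<lambda>n. t * (u x + inverse (real (Suc n)) * \<phi> x)) \<longlonglongrightarrow> t * (u x + 0 * \<phi> x)" for x
      by (intro tendsto_mult tendsto_add tendsto_const LIMSEQ_inverse_real_of_nat)
    show ?thesis unfolding H_def
      by (intro tendsto_diff Np_tendsto[OF W perturbed_ray_bound[OF t e1] lim] A_tendsto[OF W perturbed_ray_bound[OF t e1] lim])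
  qed
  have "eventually (\<lambda>n. 0 < H (inverse (real (Suc n))) (1 - d)) sequentially"
    by (rule order_tendstoD(1)[OF He lo]) (use d in simp)
  moreover have "eventually (\<lambda>n. H (inverse (real (Suc n))) (1 + d) < 0) sequentially"
    by (rule order_tendstoD(2)[OF He hi]) (use d in simp)
  moreover have "eventually (\<lambda>n. inverse (real (Suc n)) < r) sequentially"
    by (rule order_tendstoD(2)[OF LIMSEQ_inverse_real_of_nat r])
  ultimately have "eventually (\<lambda>n. 0 < H (inverse (real (Suc n))) (1 - d) \<and> H (inverse (real (Suc n))) (1 + d) < 0 \<and> inverse (real (Suc n)) < r) sequentially"
    by eventually_elim simp
  then obtain n where n: "0 < H (inverse (real (Suc n))) (1 - d)" "H (inverse (real (Suc n))) (1 + d) < 0" "inverse (real (Suc n)) < r"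
    unfolding eventually_sequentially by blast
  define e where "e = inverse (real (Suc n))"
  have e: "0 < e" "e \<le> r" "\<bar>e\<bar> \<le> 1" using n(3) by (simp_all add: e_def inverse_le_1_iff)
  have cont: "continuous_on {1 - d..1 + d} (H e)" unfolding continuous_on_sequentially comp_def
  proof (intro allI ballI impI)
    fix X :: "nat \<Rightarrow> real" and t
    assume t: "t \<in> {1 - d..1 + d}" and X: "(\<forall>n. X n \<in> {1 - d..1 + d}) \<and> X \<longlonglongrightarrow> t"
    have X2: "\<bar>X n\<bar> \<le> 2" for n
    proof -
      have "X n \<in> {1 - d..1 + d}" using X by blast
      then show ?thesis using d by (simp add: abs_le_iff)
    qed
    have lim: "(\<lambda>n. X n * (u x + e * \<phi> x)) \<longlonglongrightarrow> t * (u x + e * \<phi> x)" for x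
      using X by (intro tendsto_mult tendsto_const) auto
    show "(\<lambda>n. H e (X n)) \<longlonglongrightarrow> H e t" unfolding H_def
      by (intro tendsto_diff Np_tendsto[OF W perturbed_ray_bound[OF X2 e(3)] lim] A_tendsto[OF W perturbed_ray_bound[OF X2 e(3)] lim])
  qed
  have "\<exists>t. 1 - d \<le> t \<and> t \<le> 1 + d \<and> H e t = 0" by (rule IVT2'[OF _ _ _ cont]) (use n d in \<open>simp_all add: e_def\<close>)
  then obtain t where t: "1 - d \<le> t" "t \<le> 1 + d" "H e t = 0" by blast
  have t0: "0 < t" using t(1) d(2) by linarith
  have v: "lp p (\<lambda>x. u x + e * \<phi> x)" by (intro lp_add lp_scale l \<phi> p0)
  have vn: "(\<lambda>x. u x + e * \<phi> x) \<noteq> (\<lambda>_. 0)"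
  proof
    assume z: "(\<lambda>x. u x + e * \<phi> x) = (\<lambda>_. 0)"
    have "H e (1 - d) = 0"
      unfolding H_def using fun_cong[OF z] by (simp add: Np_def dens_def[abs_def] grad_norm_def A_def green_form_def)
    then show False using n(1) by (simp add: e_def)
  qed
  have "(\<lambda>x. t * (u x + e * \<phi> x)) \<in> \<N>" using ray_mem_lp[OF v vn, of t] t0 t(3) by (simp add: nehari_iff H_def)
  moreover have "\<bar>t - 1\<bar> \<le> r" using t d by (simp add: abs_le_iff)
  ultimately show ?thesis using that e(1,2) t0 by metis
qed

text \<open>
  As \<open>f\<close> is only continuous, the Nehari manifold need not be a smooth manifold; instead of Lagrange
  multipliers, \<open>u\<close> is compared with nearby points of the manifold on the perturbed rays.
\<close>

lemma nehari_minimizer_deriv_nonneg: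
  assumes u: "u \<in> \<N>" and min: "\<And>v. v \<in> \<N> \<Longrightarrow> J u \<le> J v" and \<phi>: "lp p \<phi>"
  shows "0 \<le> energy_deriv p \<alpha> h f u \<phi>"
proof -
  note l = nehari_lp[OF u]
  define P where "P n z \<longleftrightarrow> 0 < fst z \<and> fst z \<le> inverse (real (Suc n)) \<and> \<bar>snd z - 1\<bar> \<le> inverse (real (Suc n)) \<and> 0 < snd z \<and>
      (\<lambda>x. snd z * (u x + fst z * \<phi> x)) \<in> \<N>" for n z
  have "\<exists>z. P n z" for n
  proof -
    have "0 < inverse (real (Suc n))" by simp
    then obtain e t where "0 < e" "e \<le> inverse (real (Suc n))" "\<bar>t - 1\<bar> \<le> inverse (real (Suc n))" "0 < t"
      "(\<lambda>x. t * (u x + e * \<phi> x)) \<in> \<N>" using nehari_nearby[OF u \<phi>] by metis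
    then show ?thesis by (intro exI[of _ "(e, t)"]) (simp add: P_def)
  qed
  then have "\<exists>g. \<forall>n. P n (g n)" by (intro choice allI)
  then obtain g where g: "\<forall>n. P n (g n)" by blast
  define e t where "e n = fst (g n)" and "t n = snd (g n)" for n
  have e: "0 < e n" "e n \<le> inverse (real (Suc n))"
    and t: "\<bar>t n - 1\<bar> \<le> inverse (real (Suc n))" "0 < t n"
    and v: "(\<lambda>x. t n * (u x + e n * \<phi> x)) \<in> \<N>" for n
    using g[rule_format, of n] by (simp_all add: P_def e_def t_def)
  have i1: "inverse (real (Suc n)) \<le> 1" for n by (simp add: inverse_le_1_iff)
  have e1: "\<bar>e n\<bar> \<le> 1" for n using e(1)[of n] e(2)[of n] i1[of n] by simp
  have t2: "\<bar>t n\<bar> \<le> 2" for n using t(1)[of n] i1[of n] by linarith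
  have elim: "e \<longlonglongrightarrow> 0"
    by (rule tendsto_sandwich[OF _ _ tendsto_const LIMSEQ_inverse_real_of_nat]) (use e in \<open>simp_all add: less_imp_le\<close>)
  have "(\<lambda>n. t n - 1) \<longlonglongrightarrow> 0" by (rule Lim_null_comparison[OF _ LIMSEQ_inverse_real_of_nat]) (use t(1) in simp)
  from tendsto_add[OF this tendsto_const[of 1]] have tlim: "t \<longlonglongrightarrow> 1" by simp
  define W where "W x = 2 * (\<bar>u x\<bar> + \<bar>\<phi> x\<bar>)" for x
  have W: "lp p W" unfolding W_def using l \<phi> by (intro lp_scale lp_add p0) (simp_all add: lp_abs)
  have ab: "\<bar>t n * (u x + e n * \<phi> x)\<bar> \<le> \<bar>W x\<bar>" for n x unfolding W_def by (rule perturbed_ray_bound[OF t2 e1])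
  have t2w: "\<bar>t n\<bar> * \<bar>w\<bar> \<le> 2 * \<bar>w\<bar>" for n and w :: real using t2 by (rule mult_right_mono) simp
  have bb: "\<bar>t n * u x\<bar> \<le> \<bar>W x\<bar>" for n x using t2w[of n "u x"] by (simp add: abs_mult W_def)
  have pb: "\<bar>t n * \<phi> x\<bar> \<le> \<bar>W x\<bar>" for n x using t2w[of n "\<phi> x"] by (simp add: abs_mult W_def)
  have al: "(\<lambda>n. t n * (u x + e n * \<phi> x)) \<longlonglongrightarrow> u x" for x
    using tendsto_mult[OF tlim tendsto_add[OF tendsto_const[of "u x"] tendsto_mult[OF elim tendsto_const[of "\<phi> x"]]]] by simp
  have bl: "(\<lambda>n. t n * u x) \<longlonglongrightarrow> u x" for x using tendsto_mult[OF tlim tendsto_const[of "u x"]] by simp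
  have pl: "(\<lambda>n. t n * \<phi> x) \<longlonglongrightarrow> \<phi> x" for x using tendsto_mult[OF tlim tendsto_const[of "\<phi> x"]] by simp
  have e0: "e n \<noteq> 0" for n using e(1)[of n] by simp
  have Bq: "(\<lambda>n. (B (\<lambda>x. t n * (u x + e n * \<phi> x)) - B (\<lambda>x. t n * u x)) / e n) \<longlonglongrightarrow>
      2 * green_form \<alpha> (\<lambda>x. F (u x)) (\<lambda>x. f (u x) * \<phi> x)"
    by (rule B_quotient[OF W ab al bb bl pb pl e0]) (simp add: algebra_simps)
  \<comment> \<open>By homogeneity of \<open>Np\<close> the factor \<open>t n\<close> comes out as a
    power and the quotient is taken at the fixed point \<open>u\<close>. For \<open>B\<close> there
    is no homogeneity, hence the moving base point \<open>t n * u\<close> there.\<close>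
  have Nq: "(\<lambda>n. t n powr p * ((Np (\<lambda>x. u x + e n * \<phi> x) - Np u) / e n)) \<longlonglongrightarrow> 1 powr p * (p * E1 u \<phi>)"
    by (intro tendsto_mult Np_quotient[OF l \<phi> e0 e1 elim] tendsto_powr'[OF tlim tendsto_const]) simp
  have "(\<lambda>n. t n powr p * ((Np (\<lambda>x. u x + e n * \<phi> x) - Np u) / e n) / p -
      (B (\<lambda>x. t n * (u x + e n * \<phi> x)) - B (\<lambda>x. t n * u x)) / e n / 2) \<longlonglongrightarrow>
      1 powr p * (p * E1 u \<phi>) / p - 2 * green_form \<alpha> (\<lambda>x. F (u x)) (\<lambda>x. f (u x) * \<phi> x) / 2"
    using p_pos by (intro tendsto_diff tendsto_divide Nq Bq tendsto_const) auto
  then have lim: "(\<lambda>n. t n powr p * ((Np (\<lambda>x. u x + e n * \<phi> x) - Np u) / e n) / p -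
      (B (\<lambda>x. t n * (u x + e n * \<phi> x)) - B (\<lambda>x. t n * u x)) / e n / 2) \<longlonglongrightarrow> energy_deriv p \<alpha> h f u \<phi>"
    using p_pos by (simp add: energy_deriv_eq)
  have "0 \<le> t n powr p * ((Np (\<lambda>x. u x + e n * \<phi> x) - Np u) / e n) / p -
      (B (\<lambda>x. t n * (u x + e n * \<phi> x)) - B (\<lambda>x. t n * u x)) / e n / 2" for n
  proof -
    \<comment> \<open>On its own ray \<open>u\<close> is maximal, on the manifold it is minimal, so
      \<open>J u\<close> lies between the values at two points with the same factor
      \<open>t n\<close>. No estimate of \<open>t n - 1\<close> in terms of \<open>e n\<close>
      enters, only the convergence of \<open>t n\<close> to \<open>1\<close>.\<close>
    have "J (\<lambda>x. t n * u x) \<le> J u" by (rule J_ray_max[OF u less_imp_le[OF t(2)]])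
    also have "\<dots> \<le> J (\<lambda>x. t n * (u x + e n * \<phi> x))" by (rule min[OF v])
    finally have "0 \<le> (J (\<lambda>x. t n * (u x + e n * \<phi> x)) - J (\<lambda>x. t n * u x)) / e n" using e(1)[of n] by simp
    also have "\<dots> = t n powr p * ((Np (\<lambda>x. u x + e n * \<phi> x) - Np u) / e n) / p -
      (B (\<lambda>x. t n * (u x + e n * \<phi> x)) - B (\<lambda>x. t n * u x)) / e n / 2"
    proof -
      have "(T * X / p - Y / 2 - (T * Z / p - V / 2)) / E = T * ((X - Z) / E) / p - (Y - V) / E / 2"
        if "E \<noteq> 0" for T X Y Z V E :: real
        using that p_pos by (simp add: field_simps)
      from this[OF e0] show ?thesis using t(2)[of n] by (simp only: J_def Np_scale abs_of_pos)
    qed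
    finally show ?thesis .
  qed
  then show ?thesis by (intro LIMSEQ_le_const[OF lim]) auto
qed

lemma nehari_minimizer_critical:
  assumes u: "u \<in> \<N>" and min: "\<And>v. v \<in> \<N> \<Longrightarrow> J u \<le> J v" and \<phi>: "lp p \<phi>"
  shows "energy_deriv p \<alpha> h f u \<phi> = 0"
proof -
  have "energy_deriv p \<alpha> h f u (\<lambda>x. - \<phi> x) = - energy_deriv p \<alpha> h f u \<phi>"
    using green_form_scale_right[of \<alpha> "\<lambda>x. F (u x)" "-1" "\<lambda>x. f (u x) * \<phi> x"] by (simp add: energy_deriv_eq E1_uminus)
  moreover have "0 \<le> energy_deriv p \<alpha> h f u \<phi>" "0 \<le> energy_deriv p \<alpha> h f u (\<lambda>x. - \<phi> x)"
    using nehari_minimizer_deriv_nonneg[OF u min] \<phi> lp_uminus[OF \<phi>] by blast+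
  ultimately show ?thesis by linarith
qed

lemma critical_solves_eq:
  assumes u: "lp p u" and crit: "\<And>\<phi>. lp p \<phi> \<Longrightarrow> energy_deriv p \<alpha> h f u \<phi> = 0"
  shows "solves_eq p \<alpha> h f u" unfolding solves_eq_def
proof
  fix x
  define \<delta> :: "int ^ 'n \<Rightarrow> real" where "\<delta> z = (if z = x then 1 else 0)" for z
  let ?R = "\<lambda>z. rpow (grad_norm u z) (p - 2)"
  have d: "lp p \<delta>" by (rule lp_finite_support) (simp add: \<delta>_def)
  have fin: "finite (nbrs x)" by (rule finite_nbrs)
  have gx: "grad_prod u \<delta> x = - (1 / 2 * (\<Sum>y\<in>nbrs x. u y - u x))"
  proof -
    have "(u y - u x) * (\<delta> y - \<delta> x) = - (u y - u x)" if "y \<in> nbrs x" for y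
      using that nbrs_irrefl[of x] by (auto simp: \<delta>_def)
    then show ?thesis by (simp add: grad_prod_def sum_negf[symmetric] del: minus_diff_eq)
  qed
  have gz: "grad_prod u \<delta> z = 1 / 2 * (u x - u z)" if "z \<in> nbrs x" for z
  proof -
    have zx: "z \<noteq> x" "x \<in> nbrs z" using that nbrs_irrefl[of x] nbrs_sym by auto
    have "(\<Sum>y\<in>nbrs z. (u y - u z) * (\<delta> y - \<delta> z)) = (\<Sum>y\<in>nbrs z. if y = x then u x - u z else 0)"
      using zx by (intro sum.cong) (auto simp: \<delta>_def)
    also have "\<dots> = u x - u z" using zx by (simp add: finite_nbrs)
    finally show ?thesis by (simp add: grad_prod_def)
  qed
  have g0: "grad_prod u \<delta> z = 0" if "z \<noteq> x" "z \<notin> nbrs x" for z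
  proof -
    have "x \<notin> nbrs z" using that(2) nbrs_sym by blast
    then have "(u y - u z) * (\<delta> y - \<delta> z) = 0" if "y \<in> nbrs z" for y using that \<open>z \<noteq> x\<close> by (auto simp: \<delta>_def)
    then have "(\<Sum>y\<in>nbrs z. (u y - u z) * (\<delta> y - \<delta> z)) = 0" by (intro sum.neutral ballI)
    then show ?thesis by (simp only: grad_prod_def mult_zero_right)
  qed
  let ?g = "\<lambda>z. ?R z * grad_prod u \<delta> z + h z * rpow \<bar>u z\<bar> (p - 2) * u z * \<delta> z"
  \<comment> \<open>The gradient of a point mass lives at \<open>x\<close> and at its neighbours, so
    every edge at \<open>x\<close> is seen from both ends; this produces the two weights in
    \<open>p_laplacian\<close>.\<close>
  have "E1 u \<delta> = (\<Sum>z\<in>insert x (nbrs x). ?g z)"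
    unfolding E1_def by (rule l1_finite_support(2)) (use fin g0 in \<open>auto simp: \<delta>_def\<close>)
  also have "\<dots> = ?g x + (\<Sum>z\<in>nbrs x. ?g z)" using fin nbrs_irrefl by (rule sum.insert)
  also have "(\<Sum>z\<in>nbrs x. ?g z) = (\<Sum>z\<in>nbrs x. ?R z * (1 / 2 * (u x - u z)))"
    using nbrs_irrefl[of x] by (intro sum.cong) (auto simp: gz \<delta>_def)
  also have "?g x = - (?R x * (1 / 2 * (\<Sum>y\<in>nbrs x. u y - u x))) + h x * rpow \<bar>u x\<bar> (p - 2) * u x"
    unfolding gx by (simp add: \<delta>_def)
  finally have E: "E1 u \<delta> = - p_laplacian p u x + h x * rpow \<bar>u x\<bar> (p - 2) * u x"
  proof -
    assume a: "E1 u \<delta> = - (?R x * (1 / 2 * (\<Sum>y\<in>nbrs x. u y - u x))) + h x * rpow \<bar>u x\<bar> (p - 2) * u x +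
      (\<Sum>z\<in>nbrs x. ?R z * (1 / 2 * (u x - u z)))"
    have alg: "1 / 2 * ((a + b) * (c - d)) = b * (1 / 2 * (c - d)) - a * (1 / 2 * (d - c))" for a b c d :: real
      by (simp add: field_simps)
    have "p_laplacian p u x = (\<Sum>y\<in>nbrs x. ?R x * (1 / 2 * (u y - u x)) - ?R y * (1 / 2 * (u x - u y)))"
      unfolding p_laplacian_def sum_distrib_left by (intro sum.cong refl alg)
    also have "\<dots> = ?R x * (1 / 2 * (\<Sum>y\<in>nbrs x. u y - u x)) - (\<Sum>z\<in>nbrs x. ?R z * (1 / 2 * (u x - u z)))"
      by (subst sum_subtractf) (simp only: sum_distrib_left)
    finally show ?thesis using a by simp
  qed
  have "green_form \<alpha> (\<lambda>x. F (u x)) (\<lambda>z. f (u z) * \<delta> z) = (\<Sum>z\<in>{x}. green_conv \<alpha> (\<lambda>y. F (u y)) z * (f (u z) * \<delta> z))"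
    unfolding green_form_def by (rule l1_finite_support(2)) (auto simp: \<delta>_def)
  also have "\<dots> = green_conv \<alpha> (\<lambda>y. F (u y)) x * f (u x)" by (simp add: \<delta>_def)
  finally have "energy_deriv p \<alpha> h f u \<delta> = E1 u \<delta> - green_conv \<alpha> (\<lambda>y. F (u y)) x * f (u x)"
    by (simp add: energy_deriv_eq)
  then show "- p_laplacian p u x + h x * rpow \<bar>u x\<bar> (p - 2) * u x = green_conv \<alpha> (\<lambda>y. F (u y)) x * f (u x)"
    using crit[OF d] E by simp
qed

end

section \<open>Splitting of the energy\<close>

text \<open>Tychonoff's theorem makes the box compact in the product topology, which is first
  countable for a countable index set; so compactness yields subsequences, without an explicit
  diagonal argument.\<close>

lemma pointwise_convergent_subsequence:
  fixes v :: "nat \<Rightarrow> 'a::countable \<Rightarrow> real"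
  assumes "\<And>n x. \<bar>v n x\<bar> \<le> R"
  obtains r u where "strict_mono (r :: nat \<Rightarrow> nat)" "\<And>x. (\<lambda>n. v (r n) x) \<longlonglongrightarrow> u x"
proof -
  let ?K = "PiE UNIV (\<lambda>_::'a. {-R..R})"
  have "compactin (product_topology (\<lambda>_::'a. euclideanreal) UNIV) ?K" by (simp add: compactin_PiE)
  then have "compact ?K" by (simp add: euclidean_product_topology)
  then have "seq_compact ?K" by (rule compact_imp_seq_compact)
  moreover have "\<forall>n. v n \<in> ?K" using assms by (auto simp: abs_le_iff minus_le_iff)
  ultimately obtain u r where r: "strict_mono (r :: nat \<Rightarrow> nat)" and lim: "(v \<circ> r) \<longlonglongrightarrow> u" by (rule seq_compactE)
  have "(\<lambda>n. v (r n) x) \<longlonglongrightarrow> u x" for x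
  proof -
    have "(\<lambda>n. (v \<circ> r) n x) \<longlonglongrightarrow> u x"
      by (rule continuous_on_tendsto_compose[OF continuous_on_product_coordinates lim]) simp_all
    then show ?thesis by (simp only: comp_apply)
  qed
  then show ?thesis by (rule that[OF r])
qed

lemma brezis_lieb_error_mono:
  fixes a b :: real
  assumes "0 \<le> a" "a \<le> a'" "0 \<le> b" "b \<le> b'" "1 \<le> p"
  shows "err p a b \<le> err p a' b'" using assms by (intro mult_mono powr_mono2 min.mono add_mono) auto

context choquard
begin

lemma dens_split_le:
  "\<bar>dens (\<lambda>x. u x + v x) x - dens v x - dens u x\<bar> \<le>
     2 * p * err p (grad_norm v x) (grad_norm u x)
     + hmax * (2 * p * err p \<bar>v x\<bar> \<bar>u x\<bar>)"
proof -
  have c: "(\<lambda>x. v x + u x) = (\<lambda>x. u x + v x)" by (simp add: add.commute)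
  have 1: "\<bar>grad_norm (\<lambda>x. u x + v x) x powr p - grad_norm v x powr p - grad_norm u x powr p\<bar> \<le>
      2 * p * err p (grad_norm v x) (grad_norm u x)"
    by (rule powr_split_le[OF _ _ _ _ _ p1])
      (use grad_norm_diff_le[of u v x] grad_norm_diff_le[of v u x] in \<open>simp_all add: c\<close>)
  have 2: "\<bar>\<bar>u x + v x\<bar> powr p - \<bar>v x\<bar> powr p - \<bar>u x\<bar> powr p\<bar> \<le>
      2 * p * err p \<bar>v x\<bar> \<bar>u x\<bar>"
  proof (rule powr_split_le[OF _ _ _ _ _ p1])
    show "\<bar>\<bar>u x + v x\<bar> - \<bar>v x\<bar>\<bar> \<le> \<bar>u x\<bar>" "\<bar>\<bar>u x + v x\<bar> - \<bar>u x\<bar>\<bar> \<le> \<bar>v x\<bar>"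
      using abs_triangle_ineq3[of "u x + v x" "v x"] abs_triangle_ineq3[of "u x + v x" "u x"] by simp_all
  qed simp_all
  have 3: "h x * \<bar>\<bar>u x + v x\<bar> powr p - \<bar>v x\<bar> powr p - \<bar>u x\<bar> powr p\<bar> \<le>
      hmax * (2 * p * err p \<bar>v x\<bar> \<bar>u x\<bar>)"
    by (intro mult_mono hmax(2) 2 less_imp_le[OF hmax(1)]) simp
  have "dens (\<lambda>x. u x + v x) x - dens v x - dens u x =
      (grad_norm (\<lambda>x. u x + v x) x powr p - grad_norm v x powr p - grad_norm u x powr p) +
      h x * (\<bar>u x + v x\<bar> powr p - \<bar>v x\<bar> powr p - \<bar>u x\<bar> powr p)"
    by (simp add: dens_def right_diff_distrib)
  also have "\<bar>\<dots>\<bar> \<le> \<bar>grad_norm (\<lambda>x. u x + v x) x powr p - grad_norm v x powr p - grad_norm u x powr p\<bar> +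
      \<bar>h x * (\<bar>u x + v x\<bar> powr p - \<bar>v x\<bar> powr p - \<bar>u x\<bar> powr p)\<bar>" by (rule abs_triangle_ineq)
  also have "\<bar>h x * (\<bar>u x + v x\<bar> powr p - \<bar>v x\<bar> powr p - \<bar>u x\<bar> powr p)\<bar> =
      h x * \<bar>\<bar>u x + v x\<bar> powr p - \<bar>v x\<bar> powr p - \<bar>u x\<bar> powr p\<bar>"
    by (simp only: abs_mult abs_of_nonneg[OF h_nonneg])
  finally show ?thesis using add_mono[OF 1 3] by (rule order_trans)
qed

lemma l1_brezis_lieb_error:
  assumes "l1 (\<lambda>x. a x powr p)" "l1 (\<lambda>x. b x powr p)" "\<And>x. 0 \<le> a x" "\<And>x. 0 \<le> b x"
  shows "l1 (\<lambda>x. err p (a x) (b x))"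
proof (rule l1_bound)
  have a: "lp p a" and b: "lp p b" using assms by (simp_all add: lp_def)
  show "l1 (\<lambda>x. \<bar>a x + b x\<bar> powr (p - 1) * \<bar>a x\<bar>)" by (intro lp_powr_mult lp_add a b p0 p1)
  show "\<bar>err p (a x) (b x)\<bar> \<le> \<bar>a x + b x\<bar> powr (p - 1) * \<bar>a x\<bar>" for x
  proof -
    have "err p (a x) (b x) \<le> a x * (a x + b x) powr (p - 1)" by (intro mult_right_mono) auto
    then show ?thesis using assms(3)[of x] assms(4)[of x] by (simp add: abs_mult mult.commute)
  qed
qed

text \<open>The scale \<open>t n\<close> may vary with \<open>n\<close>, because it will be tied to
  the ray of the remainder. Local terms split up to errors of the form \<open>err\<close>; the
  primitives split in l^1 up to such an error, which the bounded form tolerates.\<close>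

lemma brezis_lieb:
  fixes u :: "int ^ 'n \<Rightarrow> real" and v :: "nat \<Rightarrow> int ^ 'n \<Rightarrow> real"
  assumes u: "lp p u" and v: "\<And>n. lp p (v n)"
    and M: "\<And>n. lsum (\<lambda>x. \<bar>v n x\<bar> powr p) \<le> M" "\<And>n. lsum (\<lambda>x. grad_norm (v n) x powr p) \<le> M"
    and lim: "\<And>x. (\<lambda>n. v n x) \<longlonglongrightarrow> 0"
    and t: "\<And>n. 0 \<le> t n" "\<And>n. t n \<le> \<tau>"
  shows "(\<lambda>n. J (\<lambda>x. t n * (u x + v n x)) - J (\<lambda>x. t n * u x) - J (\<lambda>x. t n * v n x)) \<longlonglongrightarrow> 0"
proof -
  have \<tau>: "0 \<le> \<tau>" using order_trans[OF t(1)[of 0] t(2)[of 0]] .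
  define w z where "w n x = t n * u x" and "z n x = t n * v n x" for n x
  have wz: "(\<lambda>x. t n * (u x + v n x)) = (\<lambda>x. w n x + z n x)" for n by (simp add: w_def z_def distrib_left)
  have lpw: "lp p (w n)" and lpz: "lp p (z n)" for n unfolding w_def z_def by (intro lp_scale u v)+
  have tm: "t n * c \<le> \<tau> * c" if "0 \<le> c" for n c using t(2) that by (rule mult_right_mono)
  have wb: "\<bar>w n x\<bar> \<le> \<tau> * \<bar>u x\<bar>" and zb: "\<bar>z n x\<bar> \<le> \<tau> * \<bar>v n x\<bar>"
    and gwb: "grad_norm (w n) x \<le> \<tau> * grad_norm u x" and gzb: "grad_norm (z n) x \<le> \<tau> * grad_norm (v n) x" for n x
    unfolding w_def z_def grad_norm_scale abs_mult abs_of_nonneg[OF t(1)] by (simp_all add: tm)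
  \<comment> \<open>The errors are taken at the maximal scale \<open>\<tau>\<close>, where the
    envelope coming from \<open>u\<close> is fixed; monotonicity of \<open>err\<close> covers all
    \<open>t n\<close>.\<close>
  define q1 where "q1 n x = err p (\<tau> * \<bar>v n x\<bar>) (\<tau> * \<bar>u x\<bar>)" for n x
  define q2 where "q2 n x = err p (\<tau> * grad_norm (v n) x) (\<tau> * grad_norm u x)" for n x
  have ps: "(\<lambda>x. (\<tau> * k x) powr p) = (\<lambda>x. \<tau> powr p * k x powr p)" if "\<And>x. 0 \<le> k x" for k :: "int ^ 'n \<Rightarrow> real"
    using \<tau> that by (simp add: powr_mult)
  have i1: "l1 (\<lambda>x. (\<tau> * \<bar>v n x\<bar>) powr p)" "l1 (\<lambda>x. (\<tau> * \<bar>u x\<bar>) powr p)"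
    "l1 (\<lambda>x. (\<tau> * grad_norm (v n) x) powr p)" "l1 (\<lambda>x. (\<tau> * grad_norm u x) powr p)" for n
    using lp_D[OF u] lp_D[OF v[of n]] l1_grad[OF u] l1_grad[OF v[of n]] by (simp_all add: ps)
  have m1: "lsum (\<lambda>x. (\<tau> * \<bar>v n x\<bar>) powr p) \<le> \<tau> powr p * M" "lsum (\<lambda>x. (\<tau> * grad_norm (v n) x) powr p) \<le> \<tau> powr p * M" for n
    using M(1)[of n] M(2)[of n] by (simp_all add: ps mult_left_mono)
  have Q1: "(\<lambda>n. lsum (q1 n)) \<longlonglongrightarrow> 0" unfolding q1_def
  proof (rule brezis_lieb_error[OF p1 i1(2) _ _ i1(1) m1(1)])
    show "(\<lambda>n. \<tau> * \<bar>v n x\<bar>) \<longlonglongrightarrow> 0" for x using tendsto_mult[OF tendsto_const[of \<tau>] tendsto_rabs[OF lim[of x]]] by simp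
  qed (use \<tau> in simp_all)
  have Q2: "(\<lambda>n. lsum (q2 n)) \<longlonglongrightarrow> 0" unfolding q2_def
  proof (rule brezis_lieb_error[OF p1 i1(4) _ _ i1(3) m1(2)])
    fix x
    have "(\<lambda>n. grad_norm (v n) x) \<longlonglongrightarrow> grad_norm (\<lambda>_. 0) x" by (rule grad_norm_tendsto[OF lim])
    then have "(\<lambda>n. grad_norm (v n) x) \<longlonglongrightarrow> 0" by (simp add: grad_norm_def)
    from tendsto_mult[OF tendsto_const[of \<tau>] this]
    show "(\<lambda>n. \<tau> * grad_norm (v n) x) \<longlonglongrightarrow> 0" by simp
  qed (use \<tau> in simp_all)
  have lq1: "l1 (q1 n)" and lq2: "l1 (q2 n)" for n
    unfolding q1_def q2_def by (intro l1_brezis_lieb_error i1; use \<tau> in simp)+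
  have NpB: "\<bar>Np (\<lambda>x. w n x + z n x) - Np (z n) - Np (w n)\<bar> \<le> 2 * p * lsum (q2 n) + hmax * (2 * p * lsum (q1 n))" for n
  proof -
    have lwz: "lp p (\<lambda>x. w n x + z n x)" by (intro lp_add lpw lpz p0)
    have b: "\<bar>dens (\<lambda>x. w n x + z n x) x - dens (z n) x - dens (w n) x\<bar> \<le> 2 * p * q2 n x + hmax * (2 * p * q1 n x)" for x
    proof -
      have 1: "err p (grad_norm (z n) x) (grad_norm (w n) x) \<le> q2 n x"
        unfolding q2_def by (intro brezis_lieb_error_mono gzb gwb p1) simp_all
      have 2: "err p \<bar>z n x\<bar> \<bar>w n x\<bar> \<le> q1 n x" unfolding q1_def by (intro brezis_lieb_error_mono zb wb p1) simp_all
      have c: "0 \<le> 2 * p" "0 \<le> hmax" using p_pos hmax(1) by simp_all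
      show ?thesis
        by (rule order_trans[OF dens_split_le add_mono[OF mult_left_mono[OF 1 c(1)] mult_left_mono[OF mult_left_mono[OF 2 c(1)] c(2)]]])
    qed
    have eq: "Np (\<lambda>x. w n x + z n x) - Np (z n) - Np (w n) = lsum (\<lambda>x. dens (\<lambda>x. w n x + z n x) x - dens (z n) x - dens (w n) x)"
      unfolding Np_def by (simp only: lsum_diff[OF l1_diff[OF l1_dens[OF lwz] l1_dens[OF lpz]] l1_dens[OF lpw]]
          lsum_diff[OF l1_dens[OF lwz] l1_dens[OF lpz]])
    have "\<bar>Np (\<lambda>x. w n x + z n x) - Np (z n) - Np (w n)\<bar> \<le> lsum (\<lambda>x. \<bar>dens (\<lambda>x. w n x + z n x) x - dens (z n) x - dens (w n) x\<bar>)"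
      unfolding eq by (rule integral_abs_bound)
    also have "\<dots> \<le> lsum (\<lambda>x. 2 * p * q2 n x + hmax * (2 * p * q1 n x))"
      by (rule lsum_mono_bound[OF l1_add[OF integrable_mult_right[OF lq2]
            integrable_mult_right[OF integrable_mult_right[OF lq1]]] abs_ge_zero b])
    also have "\<dots> = 2 * p * lsum (q2 n) + hmax * (2 * p * lsum (q1 n))"
      by (simp only: lsum_add[OF integrable_mult_right[OF lq2]
            integrable_mult_right[OF integrable_mult_right[OF lq1]]] integral_mult_right_zero)
    finally show ?thesis .
  qed
  have Nlim: "(\<lambda>n. Np (\<lambda>x. w n x + z n x) - Np (z n) - Np (w n)) \<longlonglongrightarrow> 0"
  proof (rule Lim_null_comparison)
    show "eventually (\<lambda>n. norm (Np (\<lambda>x. w n x + z n x) - Np (z n) - Np (w n)) \<le>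
        2 * p * lsum (q2 n) + hmax * (2 * p * lsum (q1 n))) sequentially"
      using NpB by (intro always_eventually allI) (simp only: real_norm_def)
    have "(\<lambda>n. 2 * p * lsum (q2 n) + hmax * (2 * p * lsum (q1 n))) \<longlonglongrightarrow> 2 * p * 0 + hmax * (2 * p * 0)"
      by (intro tendsto_add tendsto_mult tendsto_const Q1 Q2)
    then show "(\<lambda>n. 2 * p * lsum (q2 n) + hmax * (2 * p * lsum (q1 n))) \<longlonglongrightarrow> 0" by simp
  qed
  obtain Mu where Mu: "0 < Mu" "\<And>x. \<bar>u x\<bar> \<le> Mu" using lp_bounded[OF u p_pos] by metis
  have Mv: "\<bar>v n x\<bar> \<le> M powr (1 / p)" for n x by (rule lp_le_norm[OF v M(1) p_pos])
  define M0 where "M0 = \<tau> * M powr (1 / p) + \<tau> * Mu"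
  have zM: "\<bar>z n x\<bar> + \<bar>w n x\<bar> \<le> M0" for n x
  proof -
    have "\<tau> * \<bar>v n x\<bar> \<le> \<tau> * M powr (1 / p)" "\<tau> * \<bar>u x\<bar> \<le> \<tau> * Mu" using \<tau> Mv Mu(2) by (auto intro: mult_left_mono)
    then show ?thesis using zb[of n x] wb[of n x] by (simp add: M0_def)
  qed
  have zM': "\<bar>z n x\<bar> \<le> M0" and wM': "\<bar>w n x\<bar> \<le> M0" for n x using zM[of n x] by linarith+
  obtain C where C: "0 < C" "growth C M0" using f_growth[of M0] by metis
  have Fz: "\<bar>F (z n x)\<bar> \<le> C * (\<tau> * \<bar>v n x\<bar>) powr p" for n x using primitive_le[OF C zM', of n x] zb[of n x] C(1) p0
    by (elim order_trans) (auto intro!: mult_left_mono powr_mono2)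
  have Fw: "\<bar>F (w n x)\<bar> \<le> C * (\<tau> * \<bar>u x\<bar>) powr p" for n x using primitive_le[OF C wM', of n x] wb[of n x] C(1) p0
    by (elim order_trans) (auto intro!: mult_left_mono powr_mono2)
  define e where "e n x = F (w n x + z n x) - F (z n x) - F (w n x)" for n x
  have eb: "\<bar>e n x\<bar> \<le> 2 * C * q1 n x" for n x
  proof -
    have "\<bar>e n x\<bar> \<le> 2 * C * err p \<bar>z n x\<bar> \<bar>w n x\<bar>"
      using primitive_split_le[OF C zM, of n x] by (simp add: e_def add.commute)
    also have "\<dots> \<le> 2 * C * q1 n x"
      unfolding q1_def using C(1) by (intro mult_left_mono brezis_lieb_error_mono zb wb p1) simp_all
    finally show ?thesis .
  qed
  have le: "l1 (e n)" for n by (rule l1_bound[OF integrable_mult_right[OF lq1] eb])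
  have lFw: "l1 (\<lambda>x. F (w n x))" and lFz: "l1 (\<lambda>x. F (z n x))" for n by (intro l1_F lpw lpz)+
  define E where "E n = lsum (\<lambda>x. \<bar>e n x\<bar>)" for n
  have E0: "0 \<le> E n" for n by (simp add: E_def)
  have Elim: "E \<longlonglongrightarrow> 0"
  proof (rule tendsto_sandwich[OF _ _ tendsto_const])
    show "eventually (\<lambda>n. E n \<le> 2 * C * lsum (q1 n)) sequentially"
      unfolding E_def by (intro always_eventually allI lsum_abs_le lq1 eb)
    show "(\<lambda>n. 2 * C * lsum (q1 n)) \<longlonglongrightarrow> 0" using tendsto_mult[OF tendsto_const[of "2 * C"] Q1] by simp
  qed (use E0 in simp)
  define L where "L = C * (\<tau> powr p * M) + C * lsum (\<lambda>x. (\<tau> * \<bar>u x\<bar>) powr p)"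
  have Lz: "lsum (\<lambda>x. \<bar>F (z n x)\<bar>) \<le> C * (\<tau> powr p * M)" for n
    by (rule order_trans[OF lsum_abs_le[OF i1(1) Fz] mult_left_mono[OF m1(1) less_imp_le[OF C(1)]]])
  have Lw: "lsum (\<lambda>x. \<bar>F (w n x)\<bar>) \<le> C * lsum (\<lambda>x. (\<tau> * \<bar>u x\<bar>) powr p)" for n by (rule lsum_abs_le[OF i1(2) Fw])
  let ?K = "green_bound TYPE('n) \<alpha>" and ?S = "green_form \<alpha>"
  have K: "0 < ?K" by (rule green_bound_pos)
  \<comment> \<open>The interaction of the two parts through the kernel. Neither part need be small
    in l^1; the term vanishes by the decay of the Green's function.\<close>
  define X where "X n = ?S (\<lambda>x. F (z n x)) (\<lambda>x. F (w n x))" for n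
  have Xlim: "X \<longlonglongrightarrow> 0" unfolding X_def[abs_def]
  proof (rule green_form_tendsto_0[OF lFz Lz _ integrable_mult_right[OF i1(2)] Fw])
    fix x
    have "(\<lambda>n. z n x) \<longlonglongrightarrow> 0"
    proof (rule Lim_null_comparison)
      show "eventually (\<lambda>n. norm (z n x) \<le> \<tau> * \<bar>v n x\<bar>) sequentially" using zb by simp
      show "(\<lambda>n. \<tau> * \<bar>v n x\<bar>) \<longlonglongrightarrow> 0" using tendsto_mult[OF tendsto_const[of \<tau>] tendsto_rabs[OF lim[of x]]] by simp
    qed
    from primitive_tendsto[OF this] show "(\<lambda>n. F (z n x)) \<longlonglongrightarrow> 0" by simp
  qed
  \<comment> \<open>Expanding the form leaves the cross term twice, by symmetry, and terms in which
    the error \<open>e n\<close> occurs, each carrying its l^1 norm \<open>E n\<close>.\<close>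
  have BB: "\<bar>B (\<lambda>x. w n x + z n x) - B (z n) - B (w n)\<bar> \<le> 2 * \<bar>X n\<bar> + ?K * (2 * L + E n) * E n" for n
  proof -
    let ?a = "\<lambda>x. F (w n x)" and ?b = "\<lambda>x. F (z n x)"
    let ?s = "\<lambda>x. ?a x + ?b x"
    have s: "l1 ?s" by (rule l1_add[OF lFw lFz])
    have g: "(\<lambda>x. F (w n x + z n x)) = (\<lambda>x. ?s x + e n x)" by (simp add: e_def)
    have ls: "l1 (\<lambda>x. ?s x + e n x)" by (rule l1_add[OF s le])
    have "B (\<lambda>x. w n x + z n x) = ?S ?s (\<lambda>x. ?s x + e n x) + ?S (e n) (\<lambda>x. ?s x + e n x)"
      unfolding B_def g by (rule green_form_add_left[OF s le ls])
    also have "?S ?s (\<lambda>x. ?s x + e n x) = ?S ?s ?s + ?S ?s (e n)" by (rule green_form_add_right[OF s s le])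
    also have "?S ?s ?s = (?S ?a ?a + ?S ?a ?b) + (?S ?b ?a + ?S ?b ?b)"
      unfolding green_form_add_left[OF lFw lFz s] green_form_add_right[OF lFw lFw lFz] green_form_add_right[OF lFz lFw lFz] ..
    also have "?S ?a ?b = ?S ?b ?a" by (rule green_form_sym[OF lFw lFz])
    finally have eq: "B (\<lambda>x. w n x + z n x) - B (z n) - B (w n) = 2 * X n + ?S ?s (e n) + ?S (e n) (\<lambda>x. ?s x + e n x)"
      by (simp add: B_def X_def)
    have l1s: "lsum (\<lambda>x. \<bar>?s x\<bar>) \<le> L"
    proof -
      have "lsum (\<lambda>x. \<bar>?s x\<bar>) \<le> lsum (\<lambda>x. \<bar>?a x\<bar> + \<bar>?b x\<bar>)"
        by (rule lsum_mono_bound[OF _ abs_ge_zero abs_triangle_ineq]) (use lFw lFz in simp)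
      also have "\<dots> = lsum (\<lambda>x. \<bar>?a x\<bar>) + lsum (\<lambda>x. \<bar>?b x\<bar>)" using lFw lFz by simp
      finally show ?thesis using Lz[of n] Lw[of n] by (simp add: L_def)
    qed
    have l1g: "lsum (\<lambda>x. \<bar>?s x + e n x\<bar>) \<le> L + E n"
    proof -
      have "lsum (\<lambda>x. \<bar>?s x + e n x\<bar>) \<le> lsum (\<lambda>x. \<bar>?s x\<bar> + \<bar>e n x\<bar>)"
        by (rule lsum_mono_bound[OF l1_add[OF integrable_abs[OF s] integrable_abs[OF le]] abs_ge_zero abs_triangle_ineq])
      also have "\<dots> = lsum (\<lambda>x. \<bar>?s x\<bar>) + E n"
        unfolding E_def by (rule lsum_add[OF integrable_abs[OF s] integrable_abs[OF le]])
      finally show ?thesis using l1s by linarith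
    qed
    have "\<bar>?S ?s (e n)\<bar> \<le> ?K * lsum (\<lambda>x. \<bar>?s x\<bar>) * E n" unfolding E_def by (rule green_form_bound[OF s le])
    also have "\<dots> \<le> ?K * L * E n" using K E0[of n] by (intro mult_right_mono mult_left_mono l1s) auto
    finally have 1: "\<bar>?S ?s (e n)\<bar> \<le> ?K * L * E n" .
    have "\<bar>?S (e n) (\<lambda>x. ?s x + e n x)\<bar> \<le> ?K * E n * lsum (\<lambda>x. \<bar>?s x + e n x\<bar>)"
      unfolding E_def by (rule green_form_bound[OF le ls])
    also have "\<dots> \<le> ?K * E n * (L + E n)" using K E0[of n] by (intro mult_left_mono l1g) auto
    finally have 2: "\<bar>?S (e n) (\<lambda>x. ?s x + e n x)\<bar> \<le> ?K * E n * (L + E n)" .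
    have "\<bar>2 * X n + ?S ?s (e n) + ?S (e n) (\<lambda>x. ?s x + e n x)\<bar> \<le> 2 * \<bar>X n\<bar> + ?K * L * E n + ?K * E n * (L + E n)"
      using 1 2 by linarith
    also have "\<dots> = 2 * \<bar>X n\<bar> + ?K * (2 * L + E n) * E n" by (simp add: algebra_simps)
    finally show ?thesis unfolding eq .
  qed
  have Blim: "(\<lambda>n. B (\<lambda>x. w n x + z n x) - B (z n) - B (w n)) \<longlonglongrightarrow> 0"
  proof (rule Lim_null_comparison)
    show "eventually (\<lambda>n. norm (B (\<lambda>x. w n x + z n x) - B (z n) - B (w n)) \<le> 2 * \<bar>X n\<bar> + ?K * (2 * L + E n) * E n) sequentially"
      using BB by (intro always_eventually allI) (simp only: real_norm_def)
    have "(\<lambda>n. 2 * \<bar>X n\<bar> + ?K * (2 * L + E n) * E n) \<longlonglongrightarrow> 2 * \<bar>0\<bar> + ?K * (2 * L + 0) * 0"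
      by (intro tendsto_add tendsto_mult tendsto_const tendsto_rabs Xlim Elim)
    then show "(\<lambda>n. 2 * \<bar>X n\<bar> + ?K * (2 * L + E n) * E n) \<longlonglongrightarrow> 0" by simp
  qed
  have "(\<lambda>n. (Np (\<lambda>x. w n x + z n x) - Np (z n) - Np (w n)) / p - (B (\<lambda>x. w n x + z n x) - B (z n) - B (w n)) / 2) \<longlonglongrightarrow> 0 / p - 0 / 2"
    using p_pos by (intro tendsto_diff tendsto_divide Nlim Blim tendsto_const) auto
  moreover have "(Np (\<lambda>x. w n x + z n x) - Np (z n) - Np (w n)) / p - (B (\<lambda>x. w n x + z n x) - B (z n) - B (w n)) / 2 =
      J (\<lambda>x. w n x + z n x) - J (w n) - J (z n)" for n
    by (simp add: J_def diff_divide_distrib)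
  ultimately have "(\<lambda>n. J (\<lambda>x. w n x + z n x) - J (w n) - J (z n)) \<longlonglongrightarrow> 0" by simp
  then show ?thesis unfolding wz by (simp only: w_def[abs_def] z_def[abs_def])
qed

section \<open>Existence of a minimizer\<close>

lemma dens_translate: "period z \<Longrightarrow> dens (\<lambda>x. u (x + z)) x = dens u (x + z)"
  unfolding dens_def grad_norm_translate by (simp add: period_def)

lemma Np_translate: "period z \<Longrightarrow> Np (\<lambda>x. u (x + z)) = Np u"
proof -
  assume "period z"
  then have "dens (\<lambda>x. u (x + z)) = (\<lambda>x. dens u (x + z))" by (intro ext dens_translate)
  then show ?thesis unfolding Np_def by (simp only: l1_translate(2))
qed

lemma nehari_translate:
  assumes z: "period z" and u: "u \<in> \<N>"
  shows "(\<lambda>x. u (x + z)) \<in> \<N>" "J (\<lambda>x. u (x + z)) = J u"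
proof -
  have A: "A (\<lambda>x. u (x + z)) = A u"
    using green_form_translate[of \<alpha> "\<lambda>x. F (u x)" z "\<lambda>x. f (u x) * u x"] by (simp add: A_def)
  have B: "B (\<lambda>x. u (x + z)) = B u"
    using green_form_translate[of \<alpha> "\<lambda>x. F (u x)" z "\<lambda>x. F (u x)"] by (simp add: B_def)
  have "(\<lambda>x. u (x + z)) \<noteq> (\<lambda>_. 0)"
  proof
    assume e: "(\<lambda>x. u (x + z)) = (\<lambda>_. 0)"
    have "u x = 0" for x using fun_cong[OF e, of "x - z"] by simp
    then show False using nehari_nonzero[OF u] by auto
  qed
  then show "(\<lambda>x. u (x + z)) \<in> \<N>" using u by (simp add: nehari_iff lp_translate Np_translate[OF z] A)
  show "J (\<lambda>x. u (x + z)) = J u" by (simp add: J_def Np_translate[OF z] B)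
qed

lemma nehari_nonempty: "\<N> \<noteq> {}"
proof -
  define \<delta> :: "int ^ 'n \<Rightarrow> real" where "\<delta> z = (if z = 0 then 1 else 0)" for z
  have "lp p \<delta>" by (rule lp_finite_support) (simp add: \<delta>_def)
  moreover have "\<delta> \<noteq> (\<lambda>_. 0)"
  proof
    assume "\<delta> = (\<lambda>_. 0)"
    then have "\<delta> 0 = 0" by (rule fun_cong)
    then show False by (simp add: \<delta>_def)
  qed
  ultimately obtain s where "(\<lambda>x. s * \<delta> x) \<in> \<N>" using nehari_ray_exists by metis
  then show ?thesis by auto
qed

text \<open>A real infimum, meaningful because the energy is nonnegative on the nonempty manifold;
  at the end it is matched with the infimum in the extended reals.\<close>

definition level :: real where "level = Inf (J ` \<N>)"

lemma level_le: "v \<in> \<N> \<Longrightarrow> level \<le> J v"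
  unfolding level_def by (rule cInf_lower) (auto intro: bdd_belowI[of _ 0] J_nehari_nonneg)

lemma level_approx:
  assumes "0 < e" obtains v where "v \<in> \<N>" "J v < level + e"
proof -
  have "Inf (J ` \<N>) < level + e" using assms by (simp add: level_def)
  then have "\<exists>y\<in>J ` \<N>. y < level + e" by (rule cInf_lessD[rotated]) (simp add: nehari_nonempty)
  then show ?thesis using that by blast
qed

text \<open>Coercivity bounds the sequence in l^p, hence every member has a site of modulus above a
  fixed \<open>d\<close>. A period moves that site into the finite fundamental domain, and there the
  pointwise limit cannot forget it. The limit need not lie on the manifold.\<close>

lemma minimizing_sequence:
  obtains v R u where "\<And>n. v n \<in> \<N>" "\<And>n. J (v n) < level + inverse (real (Suc n))"
    "\<And>n. Np (v n) \<le> R" "\<And>x. (\<lambda>n. v n x) \<longlonglongrightarrow> u x" "lp p u" "u \<noteq> (\<lambda>_. 0)"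
proof -
  define \<kappa> where "\<kappa> = 1 / p - 1 / (p + 1)"
  have \<kappa>: "0 < \<kappa>" using p_pos by (simp add: \<kappa>_def frac_less2)
  define R where "R = (level + 1) / \<kappa>"
  have NR: "Np v \<le> R" if "v \<in> \<N>" "J v < level + 1" for v
  proof -
    have "\<kappa> * Np v \<le> level + 1" using J_coercive[OF that(1)] that(2) by (simp add: \<kappa>_def)
    then show ?thesis using \<kappa> by (simp add: R_def pos_le_divide_eq mult.commute)
  qed
  have SR: "lsum (\<lambda>x. \<bar>v x\<bar> powr p) \<le> R / hmin" if "lp p v" "Np v \<le> R" for v
    using lsum_powr_le[OF that(1)] that(2) hmin(1) by (simp add: pos_le_divide_eq mult.commute)
  obtain d where d: "0 < d" "\<And>u. u \<in> \<N> \<Longrightarrow> lsum (\<lambda>x. \<bar>u x\<bar> powr p) \<le> R / hmin \<Longrightarrow> \<exists>x. d < \<bar>u x\<bar>"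
    using nehari_peak[of "R / hmin"] by metis
  obtain D where D: "finite D" "\<And>x. \<exists>z. period z \<and> x - z \<in> D" using fundamental_domain by blast
  have "\<exists>v. v \<in> \<N> \<and> J v < level + inverse (real (Suc n)) \<and> (\<exists>x\<in>D. d < \<bar>v x\<bar>)" for n
  proof -
    have "0 < inverse (real (Suc n))" by simp
    then obtain v where v: "v \<in> \<N>" "J v < level + inverse (real (Suc n))" by (rule level_approx) blast
    have "inverse (real (Suc n)) \<le> 1" by (simp add: inverse_le_1_iff)
    then have "Np v \<le> R" using v by (intro NR) auto
    then obtain x where x: "d < \<bar>v x\<bar>" using d(2)[OF v(1) SR[OF nehari_lp[OF v(1)]]] by blast
    obtain z where z: "period z" "x - z \<in> D" using D(2) by blast
    show ?thesis
    proof (intro exI conjI bexI)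
      show "(\<lambda>x. v (x + z)) \<in> \<N>" by (rule nehari_translate(1)[OF z(1) v(1)])
      show "J (\<lambda>x. v (x + z)) < level + inverse (real (Suc n))" using v(2) nehari_translate(2)[OF z(1) v(1)] by simp
      show "d < \<bar>v (x - z + z)\<bar>" using x by simp
    qed (rule z(2))
  qed
  then have "\<exists>v. \<forall>n. v n \<in> \<N> \<and> J (v n) < level + inverse (real (Suc n)) \<and> (\<exists>x\<in>D. d < \<bar>v n x\<bar>)" by (intro choice allI)
  then obtain v where v: "\<forall>n. v n \<in> \<N> \<and> J (v n) < level + inverse (real (Suc n)) \<and> (\<exists>x\<in>D. d < \<bar>v n x\<bar>)" by blast
  have vM: "v n \<in> \<N>" and vJ: "J (v n) < level + inverse (real (Suc n))" and vD: "\<exists>x\<in>D. d < \<bar>v n x\<bar>" for n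
    using v by blast+
  have vR: "Np (v n) \<le> R" for n
  proof (rule NR[OF vM])
    have "inverse (real (Suc n)) \<le> 1" by (simp add: inverse_le_1_iff)
    then show "J (v n) < level + 1" using vJ[of n] by linarith
  qed
  have vb: "\<bar>v n x\<bar> \<le> (R / hmin) powr (1 / p)" for n x
    by (rule lp_le_norm[OF nehari_lp[OF vM] SR[OF nehari_lp[OF vM] vR] p_pos])
  then obtain r u where r: "strict_mono (r :: nat \<Rightarrow> nat)" "\<And>x. (\<lambda>n. v (r n) x) \<longlonglongrightarrow> u x"
    using pointwise_convergent_subsequence[of v, OF vb] by metis
  have u: "lp p u" unfolding lp_def
  proof (rule l1_Fatou)
    show "l1 (\<lambda>x. \<bar>v (r n) x\<bar> powr p)" for n by (rule lp_D[OF nehari_lp[OF vM]])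
    show "lsum (\<lambda>x. \<bar>v (r n) x\<bar> powr p) \<le> R / hmin" for n by (rule SR[OF nehari_lp[OF vM] vR])
    show "(\<lambda>n. \<bar>v (r n) x\<bar> powr p) \<longlonglongrightarrow> \<bar>u x\<bar> powr p" for x
      by (rule tendsto_powr'[OF tendsto_rabs[OF r(2)] tendsto_const]) (use p_pos in simp)
  qed simp
  \<comment> \<open>The site may change with \<open>n\<close>; the sum over \<open>D\<close> spares
    a further subsequence on which it is constant.\<close>
  have "d \<le> (\<Sum>x\<in>D. \<bar>v (r n) x\<bar>)" for n
  proof -
    obtain x where "x \<in> D" "d < \<bar>v (r n) x\<bar>" using vD by blast
    then show ?thesis using member_le_sum[of x D "\<lambda>x. \<bar>v (r n) x\<bar>"] D(1) by simp
  qed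
  moreover have "(\<lambda>n. \<Sum>x\<in>D. \<bar>v (r n) x\<bar>) \<longlonglongrightarrow> (\<Sum>x\<in>D. \<bar>u x\<bar>)" by (intro tendsto_sum tendsto_rabs r(2))
  ultimately have "d \<le> (\<Sum>x\<in>D. \<bar>u x\<bar>)" by (intro LIMSEQ_le_const) auto
  then have nz: "u \<noteq> (\<lambda>_. 0)" using d(1) by auto
  show ?thesis
  proof (rule that[OF vM _ vR r(2) u nz])
    fix n
    have "inverse (real (Suc (r n))) \<le> inverse (real (Suc n))"
      using seq_suble[OF r(1), of n] by (intro le_imp_inverse_le) auto
    then show "J (v (r n)) < level + inverse (real (Suc n))" using vJ[of "r n"] by linarith
  qed
qed

text \<open>
  On a common scale the energy splits between the weak limit \<open>u\<close> of a minimizing sequence and the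
  remainder \<open>w n\<close>. If the ray of \<open>w n\<close> met the manifold before that of \<open>u\<close>, the remainder alone
  would use up the whole level while \<open>u\<close> still contributes positive energy. So the scale \<open>\<tau>\<close> of
  \<open>u\<close> comes first, and there the remainder contributes nonnegatively.
\<close>

lemma nehari_minimizer: "\<exists>u\<in>\<N>. J u = level"
proof -
  obtain v R u where v: "\<And>n. v n \<in> \<N>" "\<And>n. J (v n) < level + inverse (real (Suc n))"
    "\<And>n. Np (v n) \<le> R" "\<And>x. (\<lambda>n. v n x) \<longlonglongrightarrow> u x" and u: "lp p u" "u \<noteq> (\<lambda>_. 0)"
    using minimizing_sequence by metis
  define w where "w n x = v n x - u x" for n x
  have lv: "lp p (v n)" for n by (rule nehari_lp[OF v(1)])
  have lw: "lp p (w n)" for n unfolding w_def by (intro lp_diff lv u p0)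
  have uw: "(\<lambda>x. t * (u x + w n x)) = (\<lambda>x. t * v n x)" for t n by (simp add: w_def)
  have wlim: "(\<lambda>n. w n x) \<longlonglongrightarrow> 0" for x unfolding w_def using tendsto_diff[OF v(4) tendsto_const, of x "u x"] by simp
  define M where "M = 2 powr p * ((R + Np u) + (R + Np u) / hmin)"
  have R0: "0 \<le> R" using Np_nonneg[of "v 0"] v(3)[of 0] by linarith
  have wM: "lsum (\<lambda>x. grad_norm (w n) x powr p) \<le> M" "lsum (\<lambda>x. \<bar>w n x\<bar> powr p) \<le> M" for n
  proof -
    have g: "grad_norm (w n) x \<le> grad_norm (v n) x + grad_norm u x" for x
    proof -
      have "grad_norm (\<lambda>x. (- 1) * u x) x = grad_norm u x" by (subst grad_norm_scale) simp
      then show ?thesis using grad_norm_triangle[of "v n" "\<lambda>x. (- 1) * u x" x] by (simp add: w_def[abs_def])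
    qed
    have a: "\<bar>w n x\<bar> \<le> \<bar>v n x\<bar> + \<bar>u x\<bar>" for x unfolding w_def by (rule abs_triangle_ineq4)
    have N: "0 \<le> R + Np u" using R0 Np_nonneg[of u] by simp
    have "lsum (\<lambda>x. grad_norm (w n) x powr p) \<le> 2 powr p * (lsum (\<lambda>x. grad_norm (v n) x powr p) + lsum (\<lambda>x. grad_norm u x powr p))"
      by (rule lsum_powr_add_le[OF l1_grad[OF lv] l1_grad[OF u(1)] _ _ _ g p0]) simp_all
    also have "\<dots> \<le> 2 powr p * (R + Np u)"
      using lsum_grad_le[OF lv[of n]] lsum_grad_le[OF u(1)] v(3)[of n] by (intro mult_left_mono) auto
    also have "\<dots> \<le> M" unfolding M_def using N hmin(1) by (intro mult_left_mono) auto
    finally show "lsum (\<lambda>x. grad_norm (w n) x powr p) \<le> M" .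
    have "lsum (\<lambda>x. \<bar>w n x\<bar> powr p) \<le> 2 powr p * (lsum (\<lambda>x. \<bar>v n x\<bar> powr p) + lsum (\<lambda>x. \<bar>u x\<bar> powr p))"
      by (rule lsum_powr_add_le[OF lp_D[OF lv] lp_D[OF u(1)] _ _ _ a p0]) simp_all
    also have "\<dots> \<le> 2 powr p * ((R + Np u) / hmin)"
    proof (rule mult_left_mono)
      have "hmin * (lsum (\<lambda>x. \<bar>v n x\<bar> powr p) + lsum (\<lambda>x. \<bar>u x\<bar> powr p)) \<le> R + Np u"
        using lsum_powr_le[OF lv[of n]] lsum_powr_le[OF u(1)] v(3)[of n] by (simp add: distrib_left)
      then show "lsum (\<lambda>x. \<bar>v n x\<bar> powr p) + lsum (\<lambda>x. \<bar>u x\<bar> powr p) \<le> (R + Np u) / hmin"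
        using hmin(1) by (simp only: pos_le_divide_eq mult.commute)
    qed simp
    also have "\<dots> \<le> M" unfolding M_def using N by (intro mult_left_mono) auto
    finally show "lsum (\<lambda>x. \<bar>w n x\<bar> powr p) \<le> M" .
  qed
  have split: "(\<lambda>n. J (\<lambda>x. t n * v n x) - J (\<lambda>x. t n * u x) - J (\<lambda>x. t n * w n x)) \<longlonglongrightarrow> 0"
    if "\<And>n. 0 \<le> t n" "\<And>n. t n \<le> \<tau>" for t \<tau>
    using brezis_lieb[OF u(1) lw wM(2) wM(1) wlim that] by (simp only: uw)
  obtain \<tau> where \<tau>: "0 < \<tau>" "(\<lambda>x. \<tau> * u x) \<in> \<N>" by (rule nehari_ray_exists[OF u])
  have wb: "\<bar>w n x\<bar> \<le> M powr (1 / p)" for n x by (rule lp_le_norm[OF lw wM(2) p_pos])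
  obtain d where d: "0 < d" "\<And>u. u \<in> \<N> \<Longrightarrow> lsum (\<lambda>x. \<bar>u x\<bar> powr p) \<le> \<tau> powr p * M \<Longrightarrow> \<exists>x. d < \<bar>u x\<bar>"
    using nehari_peak[of "\<tau> powr p * M"] by metis
  have Jv: "J (\<lambda>x. t * v n x) < level + inverse (real (Suc n))" if "0 \<le> t" for t n
    by (rule order.strict_trans1[OF J_ray_max[OF v(1) that] v(2)])
  \<comment> \<open>A lower bound for the ray parameters of the remainders: a point
    \<open>s * w n\<close> of the manifold has a value of modulus above \<open>d\<close>, while
    \<open>w n\<close> is uniformly bounded.\<close>
  define s0 where "s0 = min \<tau> (d / (M powr (1 / p) + 1))"
  have s0: "0 < s0" "s0 \<le> \<tau>" using \<tau>(1) d(1) by (simp_all add: s0_def add_nonneg_pos)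
  \<comment> \<open>Along its ray the energy rises from \<open>0\<close> until the manifold is met;
    a negative value at \<open>\<tau>\<close> therefore certifies that \<open>w n\<close> is nonzero
    and meets the manifold before \<open>\<tau>\<close>.\<close>
  have ray: "\<exists>s. s0 \<le> s \<and> s \<le> \<tau> \<and> level \<le> J (\<lambda>x. s * w n x)" if neg: "J (\<lambda>x. \<tau> * w n x) < 0" for n
  proof -
    have nz: "w n \<noteq> (\<lambda>_. 0)"
    proof
      assume "w n = (\<lambda>_. 0)"
      then have "J (\<lambda>x. \<tau> * w n x) = 0" using J_zero by simp
      with neg show False by simp
    qed
    obtain s where s: "0 < s" "(\<lambda>x. s * w n x) \<in> \<N>" by (rule nehari_ray_exists[OF lw nz])
    have st: "s < \<tau>"
    proof (rule ccontr)
      assume "\<not> s < \<tau>"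
      then have "J (\<lambda>x. 0 * w n x) < J (\<lambda>x. \<tau> * w n x)" using \<tau>(1) by (intro J_ray_increasing[OF lw nz s]) auto
      then show False using neg J_zero by simp
    qed
    have "lsum (\<lambda>x. \<bar>s * w n x\<bar> powr p) = s powr p * lsum (\<lambda>x. \<bar>w n x\<bar> powr p)"
      using s(1) by (simp add: abs_mult powr_mult)
    also have "\<dots> \<le> \<tau> powr p * M" using s(1) st p0 wM(2)[of n] by (intro mult_mono powr_mono2) auto
    finally obtain x where "d < \<bar>s * w n x\<bar>" using d(2)[OF s(2)] by blast
    also have "\<dots> \<le> s * (M powr (1 / p) + 1)"
    proof -
      have "s * \<bar>w n x\<bar> \<le> s * (M powr (1 / p) + 1)" using wb[of n x] s(1) by (intro mult_left_mono) auto
      then show ?thesis using s(1) by (simp add: abs_mult)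
    qed
    finally have "d \<le> s * (M powr (1 / p) + 1)" by simp
    moreover have "0 < M powr (1 / p) + 1" by (simp add: add_nonneg_pos)
    ultimately have "d / (M powr (1 / p) + 1) \<le> s" by (simp only: pos_divide_le_eq)
    then have "s0 \<le> s" by (simp add: s0_def)
    moreover have "level \<le> J (\<lambda>x. s * w n x)" by (rule level_le[OF s(2)])
    ultimately show ?thesis using st by (intro exI[of _ s]) simp
  qed
  have "\<not> eventually (\<lambda>n. J (\<lambda>x. \<tau> * w n x) < 0) sequentially"
  proof
    assume "eventually (\<lambda>n. J (\<lambda>x. \<tau> * w n x) < 0) sequentially"
    then obtain N where N: "\<And>n. n \<ge> N \<Longrightarrow> J (\<lambda>x. \<tau> * w n x) < 0" by (auto simp: eventually_sequentially)
    have "\<exists>s. s0 \<le> s \<and> s \<le> \<tau> \<and> (n \<ge> N \<longrightarrow> level \<le> J (\<lambda>x. s * w n x))" for n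
      using ray[OF N, of n] s0(2) by (cases "n \<ge> N") auto
    then have "\<exists>t. \<forall>n. s0 \<le> t n \<and> t n \<le> \<tau> \<and> (n \<ge> N \<longrightarrow> level \<le> J (\<lambda>x. t n * w n x))" by (intro choice allI)
    then obtain t where t: "\<forall>n. s0 \<le> t n \<and> t n \<le> \<tau> \<and> (n \<ge> N \<longrightarrow> level \<le> J (\<lambda>x. t n * w n x))" by blast
    have t1: "s0 \<le> t n" and t2: "t n \<le> \<tau>" for n using t by auto
    have t0: "0 \<le> t n" for n using t1[of n] s0(1) by linarith
    \<comment> \<open>Scales in the interval from \<open>s0\<close> to \<open>\<tau>\<close> stay
      away from \<open>0\<close>, and the energy of \<open>u\<close> increases there; so the share
      of \<open>u\<close> is at least \<open>\<eta>\<close> uniformly in \<open>n\<close>.\<close>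
    define \<eta> where "\<eta> = J (\<lambda>x. s0 * u x)"
    have "J (\<lambda>x. 0 * u x) < \<eta>" unfolding \<eta>_def by (rule J_ray_increasing[OF u \<tau> order_refl s0])
    then have \<eta>: "0 < \<eta>" using J_zero by simp
    have \<eta>le: "\<eta> \<le> J (\<lambda>x. t n * u x)" for n
    proof (cases "t n = s0")
      case False
      then have "s0 < t n" using t1[of n] by simp
      from J_ray_increasing[OF u \<tau> less_imp_le[OF s0(1)] this t2] show ?thesis by (simp add: \<eta>_def)
    qed (simp add: \<eta>_def)
    have "eventually (\<lambda>n. J (\<lambda>x. t n * v n x) - J (\<lambda>x. t n * u x) - J (\<lambda>x. t n * w n x) \<le> inverse (real (Suc n)) - \<eta>) sequentially"
      using eventually_ge_at_top[of N]
    proof eventually_elim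
      fix n assume "N \<le> n"
      then have "level \<le> J (\<lambda>x. t n * w n x)" using t by blast
      then show "J (\<lambda>x. t n * v n x) - J (\<lambda>x. t n * u x) - J (\<lambda>x. t n * w n x) \<le> inverse (real (Suc n)) - \<eta>"
        using Jv[OF t0, of n n] \<eta>le[of n] by linarith
    qed
    from tendsto_le[OF _ tendsto_diff[OF LIMSEQ_inverse_real_of_nat tendsto_const] split[OF t0 t2] this]
    have "0 \<le> 0 - \<eta>" by simp
    then show False using \<eta> by simp
  qed
  then have freq: "frequently (\<lambda>n. 0 \<le> J (\<lambda>x. \<tau> * w n x)) sequentially" by (simp add: frequently_def not_le)
  \<comment> \<open>The remainder is known to be nonnegative for infinitely many \<open>n\<close>
    only. By contradiction this suffices: an excess over the level would force negative energy of
    the remainder for all large \<open>n\<close>.\<close>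
  have "J (\<lambda>x. \<tau> * u x) \<le> level"
  proof (rule ccontr)
    assume "\<not> J (\<lambda>x. \<tau> * u x) \<le> level"
    then have pos: "0 < (J (\<lambda>x. \<tau> * u x) - level) / 2" by simp
    have "(\<lambda>n. J (\<lambda>x. \<tau> * v n x) - J (\<lambda>x. \<tau> * u x) - J (\<lambda>x. \<tau> * w n x)) \<longlonglongrightarrow> 0"
      by (rule split[of "\<lambda>_. \<tau>" \<tau>]) (use \<tau>(1) in simp_all)
    then have "eventually (\<lambda>n. - ((J (\<lambda>x. \<tau> * u x) - level) / 2) < J (\<lambda>x. \<tau> * v n x) - J (\<lambda>x. \<tau> * u x) - J (\<lambda>x. \<tau> * w n x)) sequentially"
      by (rule order_tendstoD) (use pos in simp)
    moreover have "eventually (\<lambda>n. inverse (real (Suc n)) < (J (\<lambda>x. \<tau> * u x) - level) / 2) sequentially"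
      by (rule order_tendstoD(2)[OF LIMSEQ_inverse_real_of_nat pos])
    ultimately have "eventually (\<lambda>n. J (\<lambda>x. \<tau> * w n x) < 0) sequentially"
    proof eventually_elim
      case (elim n)
      have "c < 0" if "- ((a - l) / 2) < b - a - c" "i < (a - l) / 2" "b < l + i" for a b c i l :: real
        using that by argo
      from this[OF elim Jv[OF less_imp_le[OF \<tau>(1)]]] show ?case .
    qed
    then show False using freq by (simp add: frequently_def not_le)
  qed
  then have "J (\<lambda>x. \<tau> * u x) = level" using level_le[OF \<tau>(2)] by simp
  then show ?thesis using \<tau>(2) by blast
qed

lemma ground_state_exists: "\<exists>u. ground_state p \<alpha> h f u \<and> solves_eq p \<alpha> h f u"
proof -
  obtain u where u: "u \<in> \<N>" "J u = level" using nehari_minimizer by blast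
  have min: "J u \<le> J v" if "v \<in> \<N>" for v using level_le[OF that] u(2) by simp
  have crit: "energy_deriv p \<alpha> h f u \<phi> = 0" if "lp p \<phi>" for \<phi> using nehari_minimizer_critical[OF u(1) min that] .
  have "(INF v\<in>\<N>. ereal (energy p \<alpha> h f v)) = ereal (energy p \<alpha> h f u)"
  proof (rule antisym)
    show "(INF v\<in>\<N>. ereal (energy p \<alpha> h f v)) \<le> ereal (energy p \<alpha> h f u)" by (rule INF_lower[OF u(1)])
    show "ereal (energy p \<alpha> h f u) \<le> (INF v\<in>\<N>. ereal (energy p \<alpha> h f v))"
      by (rule INF_greatest) (simp add: energy_eq min)
  qed
  then have "ground_state p \<alpha> h f u"
    unfolding ground_state_def using crit nehari_lp[OF u(1)] nehari_nonzero[OF u(1)] by (simp add: H_space_iff)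
  moreover have "solves_eq p \<alpha> h f u" by (rule critical_solves_eq[OF nehari_lp[OF u(1)] crit])
  ultimately show ?thesis by blast
qed

end

theorem theorem1p1:
  fixes p \<alpha> :: real
    and h :: "int ^ 'n \<Rightarrow> real"
    and f :: "real \<Rightarrow> real"
  assumes "p \<ge> 2"
    and "0 < \<alpha>" and "\<alpha> < real CARD('n)"
    and "\<exists>h0>0. \<forall>x. h x \<ge> h0"
    and "\<exists>T::nat. T > 0 \<and> (\<forall>x i. h (x + axis i (int T)) = h x)"
    and "continuous_on UNIV f"
    and "f \<in> o[at 0](\<lambda>t. \<bar>t\<bar> powr (p - 1))"
    and "\<exists>C>0. \<exists>\<tau>>(real CARD('n) + \<alpha>) * p / (2 * real CARD('n)).
           \<forall>t. \<bar>f t\<bar> \<le> C * (1 + \<bar>t\<bar> powr (\<tau> - 1))"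
    and "\<exists>\<theta>>p. \<forall>t. 0 \<le> \<theta> * primitive f t \<and> \<theta> * primitive f t \<le> 2 * f t * t"
    and "\<forall>u \<in> H_space p h - {\<lambda>_. 0}.
           strict_mono_on {0<..}
             (\<lambda>t::real. 1 / t powr p *
               (\<integral>x. green_conv \<alpha> (\<lambda>y. primitive f (t * u y)) x * f (t * u x) * u x
                  \<partial>count_space UNIV))"
  shows "\<exists>u. ground_state p \<alpha> h f u \<and> solves_eq p \<alpha> h f u"
proof -
  interpret choquard p \<alpha> h f
    by unfold_locales (fact assms)+
  show ?thesis by (rule ground_state_exists)
qed

end
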